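(* Let $\mathcal{C}$ be a Hom-finite 2-Calabi-Yau triangulated category over a field $k$, and let $\mathscr{T}$ be the collection of maximal rigid objects in $\mathcal{C}$ (each identified with the set of isomorphism classes of its indecomposable direct summands). Assume that for each $T\in\mathscr{T}$ and each indecomposable summand $T_i$ of $T$, the middle terms $U_{T_i,T/T_i}$ and $U'_{T_i,T/T_i}$ of the two exchange triangles of $T_i$ with respect to $T/T_i$ have no common non-zero direct summands. Then $\mathscr{T}$ has a cluster structure.
   Context: Hom-finite: all $\operatorname{Hom}_{\mathcal{C}}(X,Y)$ are finite dimensional over $k$; $\mathcal{C}$ is Krull-Schmidt. $\operatorname{Ext}^i_{\mathcal C}(X,Y)=\operatorname{Hom}_{\mathcal C}(X,Y[i])$. $\mathcal{C}$ is 2-Calabi-Yau if there are (functorial) isomorphisms $D\operatorname{Ext}^i_{\mathcal C}(X,Y)\simeq\operatorname{Ext}^{2-i}_{\mathcal C}(Y,X)$ for all objects $X,Y$ and all $i\in\mathbb{Z}$, where $D=\operatorname{Hom}_k(-,k)$. An object $T$ is rigid if $\operatorname{Ext}^1_{\mathcal C}(T,T)=0$, and maximal rigid if moreover $\operatorname{Ext}^1_{\mathcal C}(T\amalg X,T\amalg X)=0$ implies $X\in\operatorname{add}T$. Let $\mathscr{T}$ be a collection of sets of non-isomorphic indecomposable objects of $\mathcal C$ (each such set, called a precluster, is identified with the direct sum of its elements). $\mathscr{T}$ has a weak cluster structure if: (a) for each precluster $T=\overline{T}\,\dot\cup\,\{M\}$ with $M$ indecomposable there is a unique indecomposable $M^*\not\simeq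 M$ such that $T^*=\overline{T}\,\dot\cup\,\{M^*\}$ is a precluster; (b) $M$ and $M^*$ are related by triangles $M^*\overset{f}{\to}U_{M,\overline T}\overset{g}{\to}M\to$ and $M\overset{s}{\to}U'_{M,\overline T}\overset{t}{\to}M^*\to$, where $f,s$ are minimal left $\operatorname{add}\overline T$-approximations and $g,t$ are minimal right $\operatorname{add}\overline T$-approximations. These are called the exchange triangles of $M$ with respect to $\overline T$. It is known (Iyama-Yoshino, Buan-Iyama-Reiten-Scott) that the collection of maximal rigid objects in any Hom-finite 2-CY triangulated category has a weak cluster structure. If $\mathscr{T}$ has a weak cluster structure, then for $T=\{T_i\}_{i\in I}\in\mathscr{T}$ define the matrix $B_T=(b_{ij})$ by $b_{ij}=\alpha_{U'_{T_i,T/T_i}}T_j-\alpha_{U_{T_i,T/T_i}}T_j$, where $\alpha_YX$ is the multiplicity of $X$ as a direct summand of $Y$ and $T/T_i$ denotes $T$ with the summand $T_i$ removed. Fomin-Zelevinsky mutation at $k$ of a matrix $B=(b_{ij})$ is the matrix $(b^*_{ij})$ with $b^*_{ij}=-b_{ij}$ if $i=k$ or $j=k$, and $b^*_{ij}=b_{ij}+\frac{|b_{ik}|b_{kj}+b_{ik}|b_{kj}|}{2}$ if $i,j\ne k$. $\mathscr{T}$ has a cluster structure if it has a weak cluster structure and in addition: (c) for each $T\in\mathscr{T}$ and each $T_i\in T$, the objects $U_{T_i,T/T_i}$ and $U'_{T_i,T/T_i}$ have no common direct summands; (d) if $T=\overline T\cup\{T_k\}$ and $T^*=\overline T\cup\{T_k^*\}$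 are preclusters with $T_k\not\simeq T_k^*$ indecomposable, then $B_T$ and $B_{T^*}$ are related by Fomin-Zelevinsky matrix mutation at $k$ (with $T_k^*$ given the index $k$). *)

theory Defs
  imports Complex_Main
begin

section \<open>Linear categories\<close>

text \<open>
  The data of a linear category with a shift and a class of triangles.  All objects form the
  type \<open>'o\<close>.  The spaces \<open>Hom C X Y\<close> are linear subspaces of one ambient vector space \<open>'m\<close>; this
  is no restriction, since one can take the direct sum of all Hom spaces as the ambient space.
  In particular every zero morphism is the element \<open>0\<close>.  \<open>g \<cdot> f\<close> means first \<open>f\<close>, then \<open>g\<close>.
  \<open>shO\<close> and \<open>shM\<close> are the shift functor on objects and on morphisms, and \<open>tri C X Y Z f g h\<close> says
  that \<open>X \<rightarrow> Y \<rightarrow> Z \<rightarrow> X[1]\<close> (with maps \<open>f\<close>, \<open>g\<close>, \<open>h\<close>) is a distinguished triangle.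
\<close>

record ('k, 'o, 'm) tricat =
  smul :: "'k \<Rightarrow> 'm \<Rightarrow> 'm"
  Hom :: "'o \<Rightarrow> 'o \<Rightarrow> 'm set"
  Comp :: "'m \<Rightarrow> 'm \<Rightarrow> 'm"  (infixl \<open>\<cdot>\<index>\<close> 70)
  ident :: "'o \<Rightarrow> 'm"
  shO :: "'o \<Rightarrow> 'o"
  shM :: "'m \<Rightarrow> 'm"
  tri :: "'o \<Rightarrow> 'o \<Rightarrow> 'o \<Rightarrow> 'm \<Rightarrow> 'm \<Rightarrow> 'm \<Rightarrow> bool"

locale linear_category = vector_space "smul C"
  for C :: "('k::field, 'o, 'm::ab_group_add) tricat" (structure) +
  assumes Hom_subspace: "subspace (Hom C X Y)"
    and ident_in_Hom: "ident C X \<in> Hom C X X"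
    and Comp_in_Hom: "\<lbrakk>f \<in> Hom C X Y; g \<in> Hom C Y Z\<rbrakk> \<Longrightarrow> g \<cdot> f \<in> Hom C X Z"
    and Comp_assoc: "\<lbrakk>f \<in> Hom C W X; g \<in> Hom C X Y; h \<in> Hom C Y Z\<rbrakk>
          \<Longrightarrow> (h \<cdot> g) \<cdot> f = h \<cdot> (g \<cdot> f)"
    and Comp_ident_left: "f \<in> Hom C X Y \<Longrightarrow> ident C Y \<cdot> f = f"
    and Comp_ident_right: "f \<in> Hom C X Y \<Longrightarrow> f \<cdot> ident C X = f"
    and Comp_add_left: "\<lbrakk>f \<in> Hom C X Y; g \<in> Hom C Y Z; g' \<in> Hom C Y Z\<rbrakk>
          \<Longrightarrow> (g + g') \<cdot> f = g \<cdot> f + g' \<cdot> f"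
    and Comp_add_right: "\<lbrakk>f \<in> Hom C X Y; f' \<in> Hom C X Y; g \<in> Hom C Y Z\<rbrakk>
          \<Longrightarrow> g \<cdot> (f + f') = g \<cdot> f + g \<cdot> f'"
    and Comp_smul_left: "\<lbrakk>f \<in> Hom C X Y; g \<in> Hom C Y Z\<rbrakk>
          \<Longrightarrow> smul C c g \<cdot> f = smul C c (g \<cdot> f)"
    and Comp_smul_right: "\<lbrakk>f \<in> Hom C X Y; g \<in> Hom C Y Z\<rbrakk>
          \<Longrightarrow> g \<cdot> smul C c f = smul C c (g \<cdot> f)"

definition is_iso :: "('k::field, 'o, 'm::ab_group_add) tricat \<Rightarrow> 'o \<Rightarrow> 'o \<Rightarrow> 'm \<Rightarrow> bool" where
  "is_iso C X Y f \<longleftrightarrow> f \<in> Hom C X Y \<and>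
     (\<exists>g \<in> Hom C Y X. g \<cdot>\<^bsub>C\<^esub> f = ident C X \<and> f \<cdot>\<^bsub>C\<^esub> g = ident C Y)"

definition isomorphic :: "('k::field, 'o, 'm::ab_group_add) tricat \<Rightarrow> 'o \<Rightarrow> 'o \<Rightarrow> bool" where
  "isomorphic C X Y \<longleftrightarrow> (\<exists>f. is_iso C X Y f)"

definition zero_object :: "('k::field, 'o, 'm::ab_group_add) tricat \<Rightarrow> 'o \<Rightarrow> bool" where
  "zero_object C X \<longleftrightarrow> ident C X = 0"

definition is_direct_sum ::
  "('k::field, 'o, 'm::ab_group_add) tricat \<Rightarrow> 'o \<Rightarrow> 'o list \<Rightarrow> bool" where
  "is_direct_sum C X Xs \<longleftrightarrow> (\<exists>inj prj.
     (\<forall>i < length Xs. inj i \<in> Hom C (Xs ! i) X \<and> prj i \<in> Hom C X (Xs ! i)) \<and>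
     (\<forall>i < length Xs. \<forall>j < length Xs.
        prj i \<cdot>\<^bsub>C\<^esub> inj j = (if i = j then ident C (Xs ! i) else 0)) \<and>
     (\<Sum>i < length Xs. inj i \<cdot>\<^bsub>C\<^esub> prj i) = ident C X)"

definition summand :: "('k::field, 'o, 'm::ab_group_add) tricat \<Rightarrow> 'o \<Rightarrow> 'o \<Rightarrow> bool" where
  "summand C X Y \<longleftrightarrow> (\<exists>Z. is_direct_sum C Y [X, Z])"

definition indecomposable :: "('k::field, 'o, 'm::ab_group_add) tricat \<Rightarrow> 'o \<Rightarrow> bool" where
  "indecomposable C X \<longleftrightarrow> \<not> zero_object C X \<and>
     (\<forall>Y Z. is_direct_sum C X [Y, Z] \<longrightarrow> zero_object C Y \<or> zero_object C Z)"

definition add_of :: "('k::field, 'o, 'm::ab_group_add) tricat \<Rightarrow> 'o set \<Rightarrow> 'o set" where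
  "add_of C S = {X. \<exists>Y Ys. set Ys \<subseteq> S \<and> is_direct_sum C Y Ys \<and> summand C X Y}"

definition local_End :: "('k::field, 'o, 'm::ab_group_add) tricat \<Rightarrow> 'o \<Rightarrow> bool" where
  "local_End C X \<longleftrightarrow> \<not> zero_object C X \<and>
     (\<forall>f \<in> Hom C X X. \<forall>g \<in> Hom C X X.
        \<not> is_iso C X X f \<longrightarrow> \<not> is_iso C X X g \<longrightarrow> \<not> is_iso C X X (f + g))"

definition Krull_Schmidt :: "('k::field, 'o, 'm::ab_group_add) tricat \<Rightarrow> bool" where
  "Krull_Schmidt C \<longleftrightarrow> (\<forall>X. \<exists>Xs. is_direct_sum C X Xs \<and> (\<forall>Y \<in> set Xs. local_End C Y))"

definition Hom_finite :: "('k::field, 'o, 'm::ab_group_add) tricat \<Rightarrow> bool" where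
  "Hom_finite C \<longleftrightarrow>
     (\<forall>X Y. \<exists>B. finite B \<and> B \<subseteq> Hom C X Y \<and> Hom C X Y = module.span (smul C) B)"

text \<open>Well defined in a Krull-Schmidt category, by the Krull-Schmidt theorem.\<close>

definition multiplicity_in ::
  "('k::field, 'o, 'm::ab_group_add) tricat \<Rightarrow> 'o \<Rightarrow> 'o \<Rightarrow> nat" where
  "multiplicity_in C Y X = (THE n. \<exists>Ys. is_direct_sum C Y Ys \<and>
     (\<forall>Z \<in> set Ys. indecomposable C Z) \<and> n = length (filter (isomorphic C X) Ys))"


section \<open>Triangulated categories\<close>

text \<open>
  The shift is an automorphism of the category.  Bijectivity of \<open>shM\<close> on the whole ambient space
  is again no restriction (extend it to the direct sum of all Hom spaces); it makes \<open>inv (shM C)\<close>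
  the action of the inverse shift on all morphisms.
\<close>

locale triangulated_category = linear_category C
  for C :: "('k::field, 'o, 'm::ab_group_add) tricat" (structure) +
  assumes ex_zero_object: "\<exists>Z. zero_object C Z"
    and ex_direct_sum: "\<exists>S. is_direct_sum C S [X, Y]"
    and shO_bij: "bij (shO C)"
    and shM_bij: "bij (shM C)"
    and shM_Hom: "shM C ` Hom C X Y = Hom C (shO C X) (shO C Y)"
    and shM_ident: "shM C (ident C X) = ident C (shO C X)"
    and shM_Comp: "\<lbrakk>f \<in> Hom C X Y; g \<in> Hom C Y Z\<rbrakk> \<Longrightarrow> shM C (g \<cdot> f) = shM C g \<cdot> shM C f"
    and shM_add: "\<lbrakk>f \<in> Hom C X Y; f' \<in> Hom C X Y\<rbrakk> \<Longrightarrow> shM C (f + f') = shM C f + shM C f'"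
    and shM_smul: "f \<in> Hom C X Y \<Longrightarrow> shM C (smul C r f) = smul C r (shM C f)"
    and tri_in_Hom: "tri C X Y Z f g h
          \<Longrightarrow> f \<in> Hom C X Y \<and> g \<in> Hom C Y Z \<and> h \<in> Hom C Z (shO C X)"
    and tri_iso: "\<lbrakk>tri C X Y Z f g h; is_iso C X X' a; is_iso C Y Y' b; is_iso C Z Z' c;
          f' \<in> Hom C X' Y'; g' \<in> Hom C Y' Z'; h' \<in> Hom C Z' (shO C X');
          b \<cdot> f = f' \<cdot> a; c \<cdot> g = g' \<cdot> b; shM C a \<cdot> h = h' \<cdot> c\<rbrakk> \<Longrightarrow> tri C X' Y' Z' f' g' h'"
    and tri_ident: "zero_object C Z \<Longrightarrow> tri C X X Z (ident C X) 0 0"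
    and tri_complete: "f \<in> Hom C X Y \<Longrightarrow> \<exists>Z g h. tri C X Y Z f g h"
    and tri_rotate: "\<lbrakk>f \<in> Hom C X Y; g \<in> Hom C Y Z; h \<in> Hom C Z (shO C X)\<rbrakk>
          \<Longrightarrow> tri C X Y Z f g h \<longleftrightarrow> tri C Y Z (shO C X) g h (- shM C f)"
    and tri_morphism: "\<lbrakk>tri C X Y Z f g h; tri C X' Y' Z' f' g' h';
          a \<in> Hom C X X'; b \<in> Hom C Y Y'; b \<cdot> f = f' \<cdot> a\<rbrakk>
          \<Longrightarrow> \<exists>c \<in> Hom C Z Z'. c \<cdot> g = g' \<cdot> b \<and> shM C a \<cdot> h = h' \<cdot> c"
    and octahedral: "\<lbrakk>tri C X Y Z' f i i'; tri C Y Z X' g j j'; tri C X Z Y' (g \<cdot> f) k k'\<rbrakk>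
          \<Longrightarrow> \<exists>u v. tri C Z' Y' X' u v (shM C i \<cdot> j') \<and>
                u \<cdot> i = k \<cdot> g \<and> k' \<cdot> u = i' \<and> v \<cdot> k = j \<and> j' \<cdot> v = shM C f \<cdot> k'"

definition int_iterate :: "int \<Rightarrow> ('a \<Rightarrow> 'a) \<Rightarrow> 'a \<Rightarrow> 'a" where
  "int_iterate n f = (if n \<ge> 0 then f ^^ nat n else inv f ^^ nat (- n))"

definition Ext ::
  "('k::field, 'o, 'm::ab_group_add) tricat \<Rightarrow> int \<Rightarrow> 'o \<Rightarrow> 'o \<Rightarrow> 'm set" where
  "Ext C i X Y = Hom C X (int_iterate i (shO C) Y)"

text \<open>
  The dual space of a subspace \<open>V\<close>.  Functionals are normalised to vanish outside \<open>V\<close>, so that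
  equality of functions is equality of functionals on \<open>V\<close>.
\<close>

definition dual :: "('k::field, 'o, 'm::ab_group_add) tricat \<Rightarrow> 'm set \<Rightarrow> ('m \<Rightarrow> 'k) set" where
  "dual C V = {\<xi>. (\<forall>x \<in> V. \<forall>y \<in> V. \<xi> (x + y) = \<xi> x + \<xi> y) \<and>
     (\<forall>c. \<forall>x \<in> V. \<xi> (smul C c x) = c * \<xi> x) \<and> (\<forall>x. x \<notin> V \<longrightarrow> \<xi> x = 0)}"

text \<open>The functional \<open>\<xi> \<circ> \<phi>\<close> on \<open>V\<close>; for linear \<open>\<phi> : V \<rightarrow> W\<close> this is the dual map \<open>DW \<rightarrow> DV\<close>.\<close>

definition pullback :: "'m set \<Rightarrow> ('m \<Rightarrow> 'm) \<Rightarrow> ('m \<Rightarrow> 'k::zero) \<Rightarrow> 'm \<Rightarrow> 'k" where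
  "pullback V \<phi> \<xi> = (\<lambda>x. if x \<in> V then \<xi> (\<phi> x) else 0)"

text \<open>
  \<open>\<Phi> i X Y\<close> is the isomorphism from the dual of \<open>Ext\<close> in degree \<open>i\<close> of \<open>(X, Y)\<close> to \<open>Ext\<close> in degree
  \<open>2 - i\<close> of \<open>(Y, X)\<close>.  The last two conditions are naturality in \<open>X\<close> and in \<open>Y\<close>.
\<close>

definition two_Calabi_Yau :: "('k::field, 'o, 'm::ab_group_add) tricat \<Rightarrow> bool" where
  "two_Calabi_Yau C \<longleftrightarrow> (\<exists>\<Phi>.
     (\<forall>i X Y. bij_betw (\<Phi> i X Y) (dual C (Ext C i X Y)) (Ext C (2 - i) Y X)) \<and>
     (\<forall>i X Y. \<forall>\<xi> \<in> dual C (Ext C i X Y). \<forall>\<eta> \<in> dual C (Ext C i X Y).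
        \<Phi> i X Y (\<lambda>x. \<xi> x + \<eta> x) = \<Phi> i X Y \<xi> + \<Phi> i X Y \<eta>) \<and>
     (\<forall>i X Y c. \<forall>\<xi> \<in> dual C (Ext C i X Y). \<Phi> i X Y (\<lambda>x. c * \<xi> x) = smul C c (\<Phi> i X Y \<xi>)) \<and>
     (\<forall>i X X' Y. \<forall>a \<in> Hom C X' X. \<forall>\<xi> \<in> dual C (Ext C i X' Y).
        \<Phi> i X Y (pullback (Ext C i X Y) (\<lambda>x. x \<cdot>\<^bsub>C\<^esub> a) \<xi>)
          = int_iterate (2 - i) (shM C) a \<cdot>\<^bsub>C\<^esub> \<Phi> i X' Y \<xi>) \<and>
     (\<forall>i X Y Y'. \<forall>b \<in> Hom C Y Y'. \<forall>\<xi> \<in> dual C (Ext C i X Y').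
        \<Phi> i X Y (pullback (Ext C i X Y) (\<lambda>x. int_iterate i (shM C) b \<cdot>\<^bsub>C\<^esub> x) \<xi>)
          = \<Phi> i X Y' \<xi> \<cdot>\<^bsub>C\<^esub> b))"

definition rigid :: "('k::field, 'o, 'm::ab_group_add) tricat \<Rightarrow> 'o \<Rightarrow> bool" where
  "rigid C T \<longleftrightarrow> Ext C 1 T T = {0}"

definition maximal_rigid :: "('k::field, 'o, 'm::ab_group_add) tricat \<Rightarrow> 'o \<Rightarrow> bool" where
  "maximal_rigid C T \<longleftrightarrow> rigid C T \<and>
     (\<forall>X S. is_direct_sum C S [T, X] \<longrightarrow> rigid C S \<longrightarrow> X \<in> add_of C {T})"


section \<open>Approximations\<close>

definition minimal_right_approx ::
  "('k::field, 'o, 'm::ab_group_add) tricat \<Rightarrow> 'o set \<Rightarrow> 'o \<Rightarrow> 'o \<Rightarrow> 'm \<Rightarrow> bool" where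
  "minimal_right_approx C A U M g \<longleftrightarrow> U \<in> A \<and> g \<in> Hom C U M \<and>
     (\<forall>V \<in> A. \<forall>h \<in> Hom C V M. \<exists>h' \<in> Hom C V U. h = g \<cdot>\<^bsub>C\<^esub> h') \<and>
     (\<forall>\<phi> \<in> Hom C U U. g \<cdot>\<^bsub>C\<^esub> \<phi> = g \<longrightarrow> is_iso C U U \<phi>)"

definition minimal_left_approx ::
  "('k::field, 'o, 'm::ab_group_add) tricat \<Rightarrow> 'o set \<Rightarrow> 'o \<Rightarrow> 'o \<Rightarrow> 'm \<Rightarrow> bool" where
  "minimal_left_approx C A M U f \<longleftrightarrow> U \<in> A \<and> f \<in> Hom C M U \<and>
     (\<forall>V \<in> A. \<forall>h \<in> Hom C M V. \<exists>h' \<in> Hom C U V. h = h' \<cdot>\<^bsub>C\<^esub> f) \<and>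
     (\<forall>\<phi> \<in> Hom C U U. \<phi> \<cdot>\<^bsub>C\<^esub> f = f \<longrightarrow> is_iso C U U \<phi>)"


section \<open>Cluster structures\<close>

text \<open>
  Isomorphism classes of indecomposables are handled through representatives: a precluster is a
  set of pairwise non-isomorphic indecomposable objects, and uniqueness of objects is uniqueness
  up to isomorphism.
\<close>

definition nonisomorphic_indecomposables ::
  "('k::field, 'o, 'm::ab_group_add) tricat \<Rightarrow> 'o set \<Rightarrow> bool" where
  "nonisomorphic_indecomposables C T \<longleftrightarrow> (\<forall>M \<in> T. indecomposable C M) \<and>
     (\<forall>M \<in> T. \<forall>N \<in> T. isomorphic C M N \<longrightarrow> M = N)"

text \<open>\<open>N\<close> can play the role of \<open>M*\<close> for the precluster \<open>insert M Tb\<close>.\<close>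

definition is_exchange_partner ::
  "('k::field, 'o, 'm::ab_group_add) tricat \<Rightarrow> 'o set set \<Rightarrow> 'o set \<Rightarrow> 'o \<Rightarrow> 'o \<Rightarrow> bool" where
  "is_exchange_partner C \<T> Tb M N \<longleftrightarrow>
     indecomposable C N \<and> \<not> isomorphic C N M \<and> N \<notin> Tb \<and> insert N Tb \<in> \<T>"

text \<open>There are exchange triangles \<open>N \<rightarrow> U \<rightarrow> M \<rightarrow> N[1]\<close> and \<open>M \<rightarrow> U' \<rightarrow> N \<rightarrow> M[1]\<close>.\<close>

definition exchange_triangles ::
  "('k::field, 'o, 'm::ab_group_add) tricat \<Rightarrow> 'o set \<Rightarrow> 'o \<Rightarrow> 'o \<Rightarrow> 'o \<Rightarrow> 'o \<Rightarrow> bool" where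
  "exchange_triangles C Tb M N U U' \<longleftrightarrow> (\<exists>f g h s t u.
     tri C N U M f g h \<and> tri C M U' N s t u \<and>
     minimal_left_approx C (add_of C Tb) N U f \<and> minimal_right_approx C (add_of C Tb) U M g \<and>
     minimal_left_approx C (add_of C Tb) M U' s \<and> minimal_right_approx C (add_of C Tb) U' N t)"

definition weak_cluster_structure ::
  "('k::field, 'o, 'm::ab_group_add) tricat \<Rightarrow> 'o set set \<Rightarrow> bool" where
  "weak_cluster_structure C \<T> \<longleftrightarrow>
     (\<forall>T \<in> \<T>. nonisomorphic_indecomposables C T) \<and>
     (\<forall>T \<in> \<T>. \<forall>M \<in> T.
        (\<exists>N. is_exchange_partner C \<T> (T - {M}) M N) \<and>
        (\<forall>N N'. is_exchange_partner C \<T> (T - {M}) M N \<longrightarrow>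
                is_exchange_partner C \<T> (T - {M}) M N' \<longrightarrow> isomorphic C N N')) \<and>
     (\<forall>T \<in> \<T>. \<forall>M \<in> T. \<forall>N. is_exchange_partner C \<T> (T - {M}) M N \<longrightarrow>
        (\<exists>U U'. exchange_triangles C (T - {M}) M N U U'))"

text \<open>
  The middle terms of the exchange triangles of \<open>M\<close> with respect to \<open>Tb\<close>.  They exist and are unique
  up to isomorphism if \<open>\<T>\<close> has a weak cluster structure and \<open>insert M Tb \<in> \<T>\<close>, \<open>M \<notin> Tb\<close>.
\<close>

definition exchange_middles ::
  "('k::field, 'o, 'm::ab_group_add) tricat \<Rightarrow> 'o set set \<Rightarrow> 'o \<Rightarrow> 'o set \<Rightarrow> 'o \<times> 'o" where
  "exchange_middles C \<T> M Tb = (SOME (U, U'). \<exists>N. is_exchange_partner C \<T> Tb M N \<and>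
     exchange_triangles C Tb M N U U')"

definition middle_U ::
  "('k::field, 'o, 'm::ab_group_add) tricat \<Rightarrow> 'o set set \<Rightarrow> 'o \<Rightarrow> 'o set \<Rightarrow> 'o" where
  "middle_U C \<T> M Tb = fst (exchange_middles C \<T> M Tb)"

definition middle_U' ::
  "('k::field, 'o, 'm::ab_group_add) tricat \<Rightarrow> 'o set set \<Rightarrow> 'o \<Rightarrow> 'o set \<Rightarrow> 'o" where
  "middle_U' C \<T> M Tb = snd (exchange_middles C \<T> M Tb)"

definition no_common_summand ::
  "('k::field, 'o, 'm::ab_group_add) tricat \<Rightarrow> 'o \<Rightarrow> 'o \<Rightarrow> bool" where
  "no_common_summand C U V \<longleftrightarrow>
     \<not> (\<exists>X. \<not> zero_object C X \<and> summand C X U \<and> summand C X V)"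

text \<open>The rows and columns of the matrix of \<open>T\<close> are indexed by the elements of \<open>T\<close> themselves.\<close>

definition exchange_matrix ::
  "('k::field, 'o, 'm::ab_group_add) tricat \<Rightarrow> 'o set set \<Rightarrow> 'o set \<Rightarrow> 'o \<Rightarrow> 'o \<Rightarrow> int" where
  "exchange_matrix C \<T> T X Y =
     int (multiplicity_in C (middle_U' C \<T> X (T - {X})) Y)
     - int (multiplicity_in C (middle_U C \<T> X (T - {X})) Y)"

text \<open>The integer division is exact: the numerator is always even.\<close>

definition FZ_mutation :: "'i \<Rightarrow> ('i \<Rightarrow> 'i \<Rightarrow> int) \<Rightarrow> 'i \<Rightarrow> 'i \<Rightarrow> int" where
  "FZ_mutation k B i j =
     (if i = k \<or> j = k then - B i j
      else B i j + (\<bar>B i k\<bar> * B k j + B i k * \<bar>B k j\<bar>) div 2)"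

text \<open>
  In the last condition the elements of \<open>T* = insert N (T - {M})\<close> are indexed by \<open>T\<close> through the
  bijection \<open>id(M := N)\<close>, which gives \<open>N\<close> the index \<open>M\<close>.
\<close>

definition cluster_structure ::
  "('k::field, 'o, 'm::ab_group_add) tricat \<Rightarrow> 'o set set \<Rightarrow> bool" where
  "cluster_structure C \<T> \<longleftrightarrow>
     weak_cluster_structure C \<T> \<and>
     (\<forall>T \<in> \<T>. \<forall>M \<in> T.
        no_common_summand C (middle_U C \<T> M (T - {M})) (middle_U' C \<T> M (T - {M}))) \<and>
     (\<forall>T \<in> \<T>. \<forall>M \<in> T. \<forall>N. is_exchange_partner C \<T> (T - {M}) M N \<longrightarrow>
        (\<forall>X \<in> T. \<forall>Y \<in> T.
           exchange_matrix C \<T> (insert N (T - {M})) ((id(M := N)) X) ((id(M := N)) Y)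
             = FZ_mutation M (exchange_matrix C \<T> T) X Y))"

text \<open>\<open>S\<close> represents the isomorphism classes of indecomposable direct summands of \<open>T\<close>.\<close>

definition represents_summands ::
  "('k::field, 'o, 'm::ab_group_add) tricat \<Rightarrow> 'o \<Rightarrow> 'o set \<Rightarrow> bool" where
  "represents_summands C T S \<longleftrightarrow> nonisomorphic_indecomposables C S \<and>
     (\<forall>M \<in> S. summand C M T) \<and>
     (\<forall>M. indecomposable C M \<longrightarrow> summand C M T \<longrightarrow> (\<exists>N \<in> S. isomorphic C M N))"

definition maximal_rigid_preclusters ::
  "('k::field, 'o, 'm::ab_group_add) tricat \<Rightarrow> 'o set set" where
  "maximal_rigid_preclusters C = {S. \<exists>T. maximal_rigid C T \<and> represents_summands C T S}"

end

(*
  Exchange triangles come from minimal add(T/M)-approximations. Rigidity of the cocone and maximality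
  of T show that T/M has exactly two complements: for a second complement N, the minimal right add
  T-approximation T1 -> T0 -> N has T1, T0 in add T without common summands, so T1 = M, T0 lies in
  add(T/M), and N is the cone of the minimal left add(T/M)-approximation of M.

  For the matrices, write m for the multiplicity of T_k in U'_i and suppose T_k does not occur in U_i.
  Replacing T_k by U'_k in U'_i along T_k -> U'_k -> T_k^* and applying the octahedral axiom twice
  gives triangles T_i -> W -> X and X -> U_i + m T_k^* -> T_i, where W arises from U'_i by replacing m T_k by
  m U'_k. They are exchange triangles for T_i in the mutated precluster up to one common
  summand of both middle terms, which cancels in the matrix entry. The remaining case follows by
  mutating back.
*)

theory Submission
  imports Defs
begin

section \<open>Linear categories and biproducts\<close>

text \<open>Two consequences of the Calabi-Yau condition carry the argument: symmetry of
  \<open>orth\<close>, and \<open>orth_cone\<close>, where naturality of the duality turns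
  surjectivity of Hom(W, V) -> Hom(M, V) into injectivity on Ext^2. The obstacle in the matrix part
  is that row i and row k are read off from different triangles, and no relation between the sizes
  of b_ik and b_ki is established. A coherence of signs replaces it: if T_k occurs in U'_i then T_i
  occurs in U_k, and if T_k occurs in U_i then T_i occurs in U'_k. So if T_k is absent from U_i,
  then T_i is absent from U'_k, and replacing T_k by U'_k stays among the summands common to both
  preclusters. In the remaining case the hypothesis on common summands secures the same condition
  for the mutated precluster at T_k^*. The triangles constructed by replacement need not be
  minimal.\<close>

context linear_category
begin

lemma zero_in_Hom [simp]: "0 \<in> Hom C X Y"
  using subspace_0[OF Hom_subspace] .

lemma add_in_Hom: "\<lbrakk>f \<in> Hom C X Y; g \<in> Hom C X Y\<rbrakk> \<Longrightarrow> f + g \<in> Hom C X Y"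
  using subspace_add[OF Hom_subspace] .

lemma diff_in_Hom: "\<lbrakk>f \<in> Hom C X Y; g \<in> Hom C X Y\<rbrakk> \<Longrightarrow> f - g \<in> Hom C X Y"
  using subspace_diff[OF Hom_subspace] .

lemma minus_in_Hom: "f \<in> Hom C X Y \<Longrightarrow> - f \<in> Hom C X Y"
  using subspace_neg[OF Hom_subspace] .

lemma sum_in_Hom: "(\<And>x. x \<in> S \<Longrightarrow> f x \<in> Hom C X Y) \<Longrightarrow> sum f S \<in> Hom C X Y"
  by (rule subspace_sum[OF Hom_subspace])

lemmas Hom_intros = Comp_in_Hom ident_in_Hom add_in_Hom diff_in_Hom minus_in_Hom zero_in_Hom

lemma Comp_zero_left [simp]: "f \<in> Hom C X Y \<Longrightarrow> 0 \<cdot> f = 0"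
  using Comp_add_left[of f X Y 0 Y 0] by simp

lemma Comp_zero_right [simp]: "g \<in> Hom C Y Z \<Longrightarrow> g \<cdot> 0 = 0"
  using Comp_add_right[of 0 Y Y 0 g Z] by simp

lemma Comp_minus_left: "\<lbrakk>f \<in> Hom C X Y; g \<in> Hom C Y Z\<rbrakk> \<Longrightarrow> (- g) \<cdot> f = - (g \<cdot> f)"
  using Comp_add_left[of f X Y g Z "- g"] minus_in_Hom[of g Y Z]
  by (metis Comp_zero_left add.right_inverse minus_unique)

lemma Comp_minus_right: "\<lbrakk>f \<in> Hom C X Y; g \<in> Hom C Y Z\<rbrakk> \<Longrightarrow> g \<cdot> (- f) = - (g \<cdot> f)"
  using Comp_add_right[of f X Y "- f" g Z] minus_in_Hom[of f X Y]
  by (metis Comp_zero_right add.right_inverse minus_unique)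

lemma Comp_diff_left: "\<lbrakk>f \<in> Hom C X Y; g \<in> Hom C Y Z; g' \<in> Hom C Y Z\<rbrakk> \<Longrightarrow> (g - g') \<cdot> f = g \<cdot> f - g' \<cdot> f"
  using Comp_add_left[of f X Y g Z "- g'"] minus_in_Hom[of g' Y Z] Comp_minus_left[of f X Y g' Z]
  by simp

lemma Comp_diff_right: "\<lbrakk>f \<in> Hom C X Y; f' \<in> Hom C X Y; g \<in> Hom C Y Z\<rbrakk> \<Longrightarrow> g \<cdot> (f - f') = g \<cdot> f - g \<cdot> f'"
  using Comp_add_right[of f X Y "- f'" g Z] minus_in_Hom[of f' X Y] Comp_minus_right[of f' X Y g Z]
  by simp

lemma Comp_sum_left:
  assumes "finite S" "f \<in> Hom C X Y" "\<And>x. x \<in> S \<Longrightarrow> g x \<in> Hom C Y Z"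
  shows "sum g S \<cdot> f = (\<Sum>x\<in>S. g x \<cdot> f)"
  using assms(1,3)
proof (induction S rule: finite_induct)
  case empty
  show ?case using assms(2) by simp
next
  case (insert x S)
  then show ?case
    using Comp_add_left[OF assms(2), of "g x" Z "sum g S"] sum_in_Hom[of S g] by simp
qed

lemma Comp_sum_right:
  assumes "finite S" "g \<in> Hom C Y Z" "\<And>x. x \<in> S \<Longrightarrow> f x \<in> Hom C X Y"
  shows "g \<cdot> sum f S = (\<Sum>x\<in>S. g \<cdot> f x)"
  using assms(1,3)
proof (induction S rule: finite_induct)
  case empty
  show ?case using assms(2) by simp
next
  case (insert x S)
  then show ?case
    using Comp_add_right[of "f x" X Y "sum f S" g Z] assms(2) sum_in_Hom[of S f] by simp
qed

lemma is_isoI: "\<lbrakk>f \<in> Hom C X Y; g \<in> Hom C Y X; g \<cdot> f = ident C X; f \<cdot> g = ident C Y\<rbrakk> \<Longrightarrow> is_iso C X Y f"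
  unfolding is_iso_def by blast

lemma is_isoE:
  assumes "is_iso C X Y f"
  obtains g where "f \<in> Hom C X Y" "g \<in> Hom C Y X" "g \<cdot> f = ident C X" "f \<cdot> g = ident C Y"
    "is_iso C Y X g"
  using assms unfolding is_iso_def by blast

lemma is_iso_ident: "is_iso C X X (ident C X)"
  by (rule is_isoI[of _ _ _ "ident C X"]) (auto simp: ident_in_Hom Comp_ident_left[OF ident_in_Hom])

lemma inverse_unique:
  assumes "f \<in> Hom C X Y" "g \<in> Hom C Y X" "h \<in> Hom C Y X" "g \<cdot> f = ident C X" "f \<cdot> h = ident C Y"
  shows "g = h"
  using assms Comp_assoc[of h Y X f Y g X] by (metis Comp_ident_left Comp_ident_right)

lemma is_iso_of_left_right:
  assumes "f \<in> Hom C X Y" "g \<in> Hom C Y X" "h \<in> Hom C Y X" "g \<cdot> f = ident C X" "f \<cdot> h = ident C Y"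
  shows "is_iso C X Y f"
  using inverse_unique[OF assms] assms is_isoI by metis

lemma is_iso_Comp:
  assumes "is_iso C X Y f" "is_iso C Y Z g"
  shows "is_iso C X Z (g \<cdot> f)"
proof -
  obtain f' where f: "f \<in> Hom C X Y" "f' \<in> Hom C Y X" "f' \<cdot> f = ident C X" "f \<cdot> f' = ident C Y"
    using assms(1) by (rule is_isoE)
  obtain g' where g: "g \<in> Hom C Y Z" "g' \<in> Hom C Z Y" "g' \<cdot> g = ident C Y" "g \<cdot> g' = ident C Z"
    using assms(2) by (rule is_isoE)
  note t = Comp_in_Hom[OF f(1) g(1)] Comp_in_Hom[OF g(2) f(2)]
  have "(f' \<cdot> g') \<cdot> (g \<cdot> f) = f' \<cdot> ((g' \<cdot> g) \<cdot> f)"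
    using f(1,2) g(1,2) t by (simp add: Comp_assoc)
  moreover have "(g \<cdot> f) \<cdot> (f' \<cdot> g') = g \<cdot> ((f \<cdot> f') \<cdot> g')"
    using f(1,2) g(1,2) t by (simp add: Comp_assoc)
  ultimately show ?thesis
    using f g t by (intro is_isoI[of _ _ _ "f' \<cdot> g'"]) (simp_all add: Comp_ident_left)
qed

lemma isomorphic_refl [simp]: "isomorphic C X X"
  using is_iso_ident unfolding isomorphic_def by blast

lemma isomorphic_sym: "isomorphic C X Y \<Longrightarrow> isomorphic C Y X"
  unfolding isomorphic_def is_iso_def by blast

lemma isomorphic_trans: "\<lbrakk>isomorphic C X Y; isomorphic C Y Z\<rbrakk> \<Longrightarrow> isomorphic C X Z"
  unfolding isomorphic_def using is_iso_Comp by blast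

lemma is_iso_cancel_right:
  assumes "f \<in> Hom C X Y" "is_iso C W X e" "is_iso C W Y (f \<cdot> e)"
  shows "is_iso C X Y f"
proof -
  obtain e' where e: "e \<in> Hom C W X" "e' \<in> Hom C X W" "e' \<cdot> e = ident C W" "e \<cdot> e' = ident C X" "is_iso C X W e'"
    using assms(2) by (rule is_isoE)
  have "f = (f \<cdot> e) \<cdot> e'"
    using e(1,2,4) assms(1) by (simp add: Comp_assoc Comp_ident_right)
  then show ?thesis using is_iso_Comp[OF e(5) assms(3)] by simp
qed

lemma is_iso_cancel_left:
  assumes "f \<in> Hom C X Y" "is_iso C Y Z e" "is_iso C X Z (e \<cdot> f)"
  shows "is_iso C X Y f"
proof -
  obtain e' where e: "e \<in> Hom C Y Z" "e' \<in> Hom C Z Y" "e' \<cdot> e = ident C Y" "e \<cdot> e' = ident C Z" "is_iso C Z Y e'"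
    using assms(2) by (rule is_isoE)
  have "f = e' \<cdot> (e \<cdot> f)"
    using Comp_assoc[OF assms(1) e(1,2)] e(3) Comp_ident_left[OF assms(1)] by simp
  then show ?thesis using is_iso_Comp[OF assms(3) e(5)] by simp
qed

lemma is_iso_of_Comps:
  assumes "f \<in> Hom C X Y" "g \<in> Hom C Y X" "is_iso C X X (g \<cdot> f)" "is_iso C Y Y (f \<cdot> g)"
  shows "is_iso C X Y f"
proof -
  obtain a where a: "a \<in> Hom C X X" "a \<cdot> (g \<cdot> f) = ident C X" using assms(3) by (auto elim: is_isoE)
  obtain b where b: "b \<in> Hom C Y Y" "(f \<cdot> g) \<cdot> b = ident C Y" using assms(4) by (auto elim: is_isoE)
  show ?thesis
    using Comp_assoc[OF assms(1,2) a(1)] Comp_assoc[OF b(1) assms(2,1)] a b assms(1,2)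
    by (intro is_iso_of_left_right[of _ _ _ "a \<cdot> g" "g \<cdot> b"]) (auto intro: Comp_in_Hom)
qed

text \<open>With \<open>n = f - 1\<close> of square zero the inverse is \<open>1 - n\<close>.
  Invertibility of endomorphisms of triangles is obtained in this way.\<close>

lemma is_iso_ident_plus_nilpotent:
  assumes "f \<in> Hom C X X" "(f - ident C X) \<cdot> (f - ident C X) = 0"
  shows "is_iso C X X f"
proof -
  define n where "n = f - ident C X"
  have n: "n \<in> Hom C X X" and f: "f = ident C X + n"
    using assms(1) by (auto simp: n_def intro: Hom_intros)
  have nn: "n \<cdot> n = 0" using assms(2) by (simp add: n_def)
  show ?thesis
    unfolding f
    using n nn ident_in_Hom[of X] diff_in_Hom[OF ident_in_Hom n] add_in_Hom[OF ident_in_Hom n]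
    by (intro is_isoI[of _ _ _ "ident C X - n"])
       (simp_all add: Comp_add_left Comp_add_right Comp_diff_right Comp_diff_left
          Comp_ident_left Comp_ident_right)
qed

section \<open>Zero objects and two-term direct sums\<close>

lemma zero_object_Hom_to: "\<lbrakk>zero_object C X; f \<in> Hom C W X\<rbrakk> \<Longrightarrow> f = 0"
  unfolding zero_object_def using Comp_ident_left Comp_zero_left by metis

lemma zero_object_Hom_from: "\<lbrakk>zero_object C X; f \<in> Hom C X W\<rbrakk> \<Longrightarrow> f = 0"
  unfolding zero_object_def using Comp_ident_right Comp_zero_right by metis

lemma zero_object_isomorphic: "\<lbrakk>isomorphic C X Y; zero_object C X\<rbrakk> \<Longrightarrow> zero_object C Y"
  unfolding isomorphic_def
  by (metis Comp_zero_left is_isoE zero_object_Hom_from zero_object_def)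

text \<open>Names the four maps of a two-term direct sum, which \<open>is_direct_sum\<close> hides
  behind an existential over indexed families.\<close>

definition biproduct :: "'o \<Rightarrow> 'o \<Rightarrow> 'o \<Rightarrow> 'm \<Rightarrow> 'm \<Rightarrow> 'm \<Rightarrow> 'm \<Rightarrow> bool" where
  "biproduct X A B i p j q \<longleftrightarrow> i \<in> Hom C A X \<and> p \<in> Hom C X A \<and> j \<in> Hom C B X \<and> q \<in> Hom C X B \<and>
     p \<cdot> i = ident C A \<and> q \<cdot> j = ident C B \<and> i \<cdot> p + j \<cdot> q = ident C X"

text \<open>The orthogonality relations follow from the other three equations: composing
  \<open>i p + j q = 1\<close> with \<open>j\<close> gives \<open>i p j = 0\<close>, and
  \<open>p i = 1\<close> cancels \<open>i\<close>; symmetrically for \<open>q i\<close>.\<close>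

lemma biproductD:
  assumes "biproduct X A B i p j q"
  shows "i \<in> Hom C A X" "p \<in> Hom C X A" "j \<in> Hom C B X" "q \<in> Hom C X B"
    "p \<cdot> i = ident C A" "q \<cdot> j = ident C B" "i \<cdot> p + j \<cdot> q = ident C X"
    "p \<cdot> j = 0" "q \<cdot> i = 0"
proof -
  show t: "i \<in> Hom C A X" "p \<in> Hom C X A" "j \<in> Hom C B X" "q \<in> Hom C X B"
    and e: "p \<cdot> i = ident C A" "q \<cdot> j = ident C B" "i \<cdot> p + j \<cdot> q = ident C X"
    using assms unfolding biproduct_def by auto
  have z: "p \<cdot> i \<cdot> (p \<cdot> j) = p \<cdot> j" "q \<cdot> j \<cdot> (q \<cdot> i) = q \<cdot> i"
    using t e Comp_in_Hom[OF t(3,2)] Comp_in_Hom[OF t(1,4)] by (simp_all add: Comp_ident_left)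
  have ip: "i \<cdot> p \<in> Hom C X X" "j \<cdot> q \<in> Hom C X X" using t by (auto intro: Comp_in_Hom)
  have "(i \<cdot> p) \<cdot> j + (j \<cdot> q) \<cdot> j = j"
    using Comp_add_left[OF t(3) ip] e(3) t(3) by (simp add: Comp_ident_left)
  then have "i \<cdot> (p \<cdot> j) = 0"
    using t e by (simp add: Comp_assoc Comp_ident_right)
  then have "p \<cdot> (i \<cdot> (p \<cdot> j)) = 0" using t(2) by simp
  then show "p \<cdot> j = 0" using z(1) Comp_assoc[OF Comp_in_Hom[OF t(3,2)] t(1,2)] by simp
  have "(i \<cdot> p) \<cdot> i + (j \<cdot> q) \<cdot> i = i"
    using Comp_add_left[OF t(1) ip] e(3) t(1) by (simp add: Comp_ident_left)
  then have "j \<cdot> (q \<cdot> i) = 0"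
    using t e by (simp add: Comp_assoc Comp_ident_right)
  then have "q \<cdot> (j \<cdot> (q \<cdot> i)) = 0" using t(4) by simp
  then show "q \<cdot> i = 0" using z(2) Comp_assoc[OF Comp_in_Hom[OF t(1,4)] t(3,4)] by simp
qed

lemma biproduct_elements:
  assumes "biproduct X A B i p j q"
  shows "x \<in> Hom C W A \<Longrightarrow> p \<cdot> (i \<cdot> x) = x" "x \<in> Hom C W B \<Longrightarrow> q \<cdot> (j \<cdot> x) = x"
    "x \<in> Hom C W B \<Longrightarrow> p \<cdot> (j \<cdot> x) = 0" "x \<in> Hom C W A \<Longrightarrow> q \<cdot> (i \<cdot> x) = 0"
    "x \<in> Hom C W X \<Longrightarrow> i \<cdot> (p \<cdot> x) + j \<cdot> (q \<cdot> x) = x"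
    "y \<in> Hom C X W \<Longrightarrow> (y \<cdot> i) \<cdot> p + (y \<cdot> j) \<cdot> q = y"
proof -
  note b = biproductD[OF assms]
  show "x \<in> Hom C W A \<Longrightarrow> p \<cdot> (i \<cdot> x) = x" "x \<in> Hom C W B \<Longrightarrow> q \<cdot> (j \<cdot> x) = x"
    "x \<in> Hom C W B \<Longrightarrow> p \<cdot> (j \<cdot> x) = 0" "x \<in> Hom C W A \<Longrightarrow> q \<cdot> (i \<cdot> x) = 0"
    using Comp_assoc[of x W A i X p A] Comp_assoc[of x W B j X q B] Comp_assoc[of x W B j X p A]
      Comp_assoc[of x W A i X q B] b
    by (simp_all add: Comp_ident_left)
  have ip: "i \<cdot> p \<in> Hom C X X" "j \<cdot> q \<in> Hom C X X" using b by (auto intro: Comp_in_Hom)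
  show "i \<cdot> (p \<cdot> x) + j \<cdot> (q \<cdot> x) = x" if "x \<in> Hom C W X"
    using Comp_add_left[OF that ip] Comp_assoc[OF that b(2,1)] Comp_assoc[OF that b(4,3)] b(7)
      Comp_ident_left[OF that] by simp
  show "(y \<cdot> i) \<cdot> p + (y \<cdot> j) \<cdot> q = y" if "y \<in> Hom C X W"
    using Comp_add_right[OF ip that] Comp_assoc[OF b(2,1) that] Comp_assoc[OF b(4,3) that] b(7)
      Comp_ident_right[OF that] by simp
qed

lemma biproduct_commute: "biproduct X A B i p j q \<Longrightarrow> biproduct X B A j q i p"
  unfolding biproduct_def by (simp add: add.commute)

lemma is_direct_sum_biproduct: "is_direct_sum C X [A, B] \<longleftrightarrow> (\<exists>i p j q. biproduct X A B i p j q)"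
proof
  assume "is_direct_sum C X [A, B]"
  then obtain inj prj where
    t: "\<forall>i < 2. inj i \<in> Hom C ([A, B] ! i) X \<and> prj i \<in> Hom C X ([A, B] ! i)" and
    d: "\<forall>i < 2. \<forall>j < 2. prj i \<cdot> inj j = (if i = j then ident C ([A, B] ! i) else 0)" and
    s: "(\<Sum>i < 2. inj i \<cdot> prj i) = ident C X"
    unfolding is_direct_sum_def by (auto simp: numeral_2_eq_2)
  have "biproduct X A B (inj 0) (prj 0) (inj 1) (prj 1)"
    using t[rule_format, of 0] t[rule_format, of 1] d[rule_format, of 0 0] d[rule_format, of 1 1] s
    unfolding biproduct_def by (simp add: numeral_2_eq_2)
  then show "\<exists>i p j q. biproduct X A B i p j q" by blast
next
  assume "\<exists>i p j q. biproduct X A B i p j q"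
  then obtain i p j q where "biproduct X A B i p j q" by blast
  note b = biproductD[OF this]
  show "is_direct_sum C X [A, B]"
    unfolding is_direct_sum_def
    by (rule exI[of _ "\<lambda>n. if n = 0 then i else j"], rule exI[of _ "\<lambda>n. if n = 0 then p else q"])
       (use b in \<open>auto simp: less_Suc_eq numeral_2_eq_2\<close>)
qed

lemma is_direct_sum_Nil: "is_direct_sum C X [] \<longleftrightarrow> zero_object C X"
  unfolding is_direct_sum_def zero_object_def by auto

lemma summand_iff: "summand C A X \<longleftrightarrow> (\<exists>B i p j q. biproduct X A B i p j q)"
  unfolding summand_def is_direct_sum_biproduct ..

lemma biproduct_isomorphic_left:
  assumes "biproduct X A B i p j q" "isomorphic C A A'"
  shows "\<exists>i p j q. biproduct X A' B i p j q"
proof -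
  note b = biproductD[OF assms(1)]
  obtain u v where u: "u \<in> Hom C A A'" "v \<in> Hom C A' A" "v \<cdot> u = ident C A" "u \<cdot> v = ident C A'"
    using assms(2) unfolding isomorphic_def is_iso_def by blast
  have "biproduct X A' B (i \<cdot> v) (u \<cdot> p) j q"
    unfolding biproduct_def
  proof (intro conjI)
    show "u \<cdot> p \<cdot> (i \<cdot> v) = ident C A'"
      using Comp_assoc[OF Comp_in_Hom[OF u(2) b(1)] b(2) u(1)] biproduct_elements(1)[OF assms(1) u(2)] u(4) by simp
    have "i \<cdot> v \<cdot> (u \<cdot> p) = i \<cdot> (v \<cdot> u \<cdot> p)"
      using Comp_assoc[OF Comp_in_Hom[OF b(2) u(1)] u(2) b(1)] Comp_assoc[OF b(2) u(1,2)] by simp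
    then show "i \<cdot> v \<cdot> (u \<cdot> p) + j \<cdot> q = ident C X" using b(7) u(3) Comp_ident_left[OF b(2)] by simp
  qed (auto intro!: Comp_in_Hom[OF u(2)] Comp_in_Hom[OF _ u(1)] b)
  then show ?thesis by blast
qed

text \<open>Let \<open>w\<close> invert the component \<open>A -> A'\<close>. Then
  \<open>e = i w p'\<close> is the idempotent with image \<open>A\<close> and kernel
  \<open>R\<close>, so \<open>n = 1 - e\<close> projects onto \<open>R\<close> along
  \<open>A\<close>. Both \<open>Y\<close> and \<open>R\<close> are complements of the same copy of
  \<open>A\<close>, and \<open>q j'\<close> and \<open>q' n j\<close> identify them.\<close>

lemma biproduct_cancel:
  assumes X: "biproduct X A Y i p j q" and X': "biproduct X A' R i' p' j' q'"
    and iso: "is_iso C A A' (p' \<cdot> i)"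
  shows "isomorphic C Y R"
proof -
  note b = biproductD[OF X] and b' = biproductD[OF X']
  obtain w where w: "w \<in> Hom C A' A" "w \<cdot> (p' \<cdot> i) = ident C A" "(p' \<cdot> i) \<cdot> w = ident C A'"
    using iso by (auto elim: is_isoE)
  define e where "e = i \<cdot> (w \<cdot> p')"
  have wp: "w \<cdot> p' \<in> Hom C X A" using w b' by (auto intro: Comp_in_Hom)
  have e: "e \<in> Hom C X X" unfolding e_def using wp b by (auto intro: Comp_in_Hom)
  have pe: "p' \<cdot> e = p'"
    using Comp_assoc[OF wp b(1) b'(2)] Comp_assoc[OF b'(2) w(1) Comp_in_Hom[OF b(1) b'(2)]] w(3)
      Comp_ident_left[OF b'(2)] by (simp add: e_def)
  have ei: "e \<cdot> i = i"
    using Comp_assoc[OF b(1) wp b(1)] Comp_assoc[OF b(1) b'(2) w(1)] w(2) Comp_ident_right[OF b(1)]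
    by (simp add: e_def)
  have qe: "q \<cdot> e = 0"
    unfolding e_def using biproduct_elements(4)[OF X wp] .
  have ej: "e \<cdot> j' = 0"
    using Comp_assoc[OF b'(3) wp b(1)] Comp_assoc[OF b'(3,2) w(1)] b'(8) w(1) b(1) by (simp add: e_def)
  define n where "n = ident C X - e"
  have n: "n \<in> Hom C X X" unfolding n_def using e by (auto intro: Hom_intros)
  have pn: "p' \<cdot> n = 0" and ni: "n \<cdot> i = 0" and qn: "q \<cdot> n = q" and nj: "n \<cdot> j' = j'"
    using pe ei qe ej e b b' ident_in_Hom[of X]
    by (simp_all add: n_def Comp_diff_right[of _ X X] Comp_diff_left[of _ _ X] Comp_ident_left Comp_ident_right)
  have jqn: "j' \<cdot> (q' \<cdot> n) = n" using biproduct_elements(5)[OF X' n] pn b'(1) by simp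
  have njq: "(n \<cdot> j) \<cdot> q = n" using biproduct_elements(6)[OF X n] ni b(2) by simp
  have t: "q \<cdot> j' \<in> Hom C R Y" "q' \<cdot> (n \<cdot> j) \<in> Hom C Y R" "n \<cdot> j \<in> Hom C Y X"
    using b b' n by (auto intro: Comp_in_Hom)
  have "(q' \<cdot> (n \<cdot> j)) \<cdot> (q \<cdot> j') = q' \<cdot> ((n \<cdot> j) \<cdot> q \<cdot> j')"
    using Comp_assoc[OF t(1) t(3) b'(4)] Comp_assoc[OF b'(3) b(4) t(3)] by simp
  then have 1: "(q' \<cdot> (n \<cdot> j)) \<cdot> (q \<cdot> j') = ident C R" using njq nj b'(6) by simp
  have "(q \<cdot> j') \<cdot> (q' \<cdot> (n \<cdot> j)) = q \<cdot> (j' \<cdot> (q' \<cdot> n) \<cdot> j)"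
    using Comp_assoc[OF t(2) b'(3) b(4)] Comp_assoc[OF b(3) n b'(4)] Comp_assoc[OF b(3) Comp_in_Hom[OF n b'(4)] b'(3)]
    by simp
  then have 2: "(q \<cdot> j') \<cdot> (q' \<cdot> (n \<cdot> j)) = ident C Y"
    using jqn Comp_assoc[OF b(3) n b(4)] qn b(6) by simp
  show ?thesis unfolding isomorphic_def using is_isoI[OF t(2,1) 2 1]  by blast
qed

end

section \<open>Triangles\<close>

context triangulated_category
begin

lemma shM_in_Hom: "f \<in> Hom C X Y \<Longrightarrow> shM C f \<in> Hom C (shO C X) (shO C Y)"
  using shM_Hom by blast

lemma shM_Hom_obtains:
  assumes "g \<in> Hom C (shO C X) (shO C Y)"
  obtains f where "f \<in> Hom C X Y" "g = shM C f"
  using assms shM_Hom by blast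

lemma shM_inject: "shM C f = shM C g \<longleftrightarrow> f = g"
  using shM_bij by (meson bij_is_inj inj_eq)

lemma shM_zero [simp]: "shM C 0 = 0"
  using shM_add[of 0 X Y 0 for X Y] by simp

lemma shM_minus: "f \<in> Hom C X Y \<Longrightarrow> shM C (- f) = - shM C f"
  using shM_add[of f X Y "- f"] minus_in_Hom[of f X Y] by (simp add: eq_neg_iff_add_eq_0 add.commute)

lemma shM_eq_zero_iff: "shM C f = 0 \<longleftrightarrow> f = 0"
  using shM_inject[of f 0] by simp

lemma shO_obtains: obtains X where "Y = shO C X"
  using shO_bij by (meson bij_pointE)

lemma is_iso_shM_iff:
  assumes "f \<in> Hom C X Y"
  shows "is_iso C (shO C X) (shO C Y) (shM C f) \<longleftrightarrow> is_iso C X Y f"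
proof
  assume "is_iso C X Y f"
  then obtain g where "f \<in> Hom C X Y" "g \<in> Hom C Y X" "g \<cdot> f = ident C X" "f \<cdot> g = ident C Y"
    by (rule is_isoE)
  then show "is_iso C (shO C X) (shO C Y) (shM C f)"
    by (intro is_isoI[of _ _ _ "shM C g"]) (auto simp: shM_in_Hom shM_ident simp flip: shM_Comp)
next
  assume "is_iso C (shO C X) (shO C Y) (shM C f)"
  then obtain h where h: "h \<in> Hom C (shO C Y) (shO C X)" "h \<cdot> shM C f = ident C (shO C X)"
    "shM C f \<cdot> h = ident C (shO C Y)"
    by (rule is_isoE)
  obtain g where g: "g \<in> Hom C Y X" "h = shM C g" using h(1) by (rule shM_Hom_obtains)
  have "shM C (g \<cdot> f) = shM C (ident C X)" "shM C (f \<cdot> g) = shM C (ident C Y)"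
    using h g assms by (simp_all add: shM_Comp shM_ident)
  then show "is_iso C X Y f"
    using assms g(1) by (intro is_isoI[of _ _ _ g]) (auto simp: shM_inject)
qed

lemma zero_object_shO_iff: "zero_object C (shO C X) \<longleftrightarrow> zero_object C X"
  unfolding zero_object_def using shM_ident[of X] shM_eq_zero_iff by metis

section \<open>Rotation, and exactness of Hom along a triangle\<close>

lemma rotate: "tri C X Y Z f g h \<Longrightarrow> tri C Y Z (shO C X) g h (- shM C f)"
  using tri_rotate tri_in_Hom by blast

lemma tri_Hom:
  assumes "tri C X Y Z f g h"
  shows "f \<in> Hom C X Y" "g \<in> Hom C Y Z" "h \<in> Hom C Z (shO C X)"
  using tri_in_Hom[OF assms] by auto

lemma unrotate:
  assumes "tri C Y Z (shO C X) g h k"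
  obtains f where "f \<in> Hom C X Y" "k = - shM C f" "tri C X Y Z f g h"
proof -
  note t = tri_Hom[OF assms]
  have "- k \<in> Hom C (shO C X) (shO C Y)" using t by (auto intro: minus_in_Hom)
  then obtain f where f: "f \<in> Hom C X Y" "- k = shM C f" by (rule shM_Hom_obtains)
  then have "k = - shM C f" by (metis minus_minus)
  with f that assms t tri_rotate[of f X Y g Z h] show ?thesis by auto
qed

text \<open>The maps \<open>1\<close> and \<open>f\<close> extend to a morphism from the triangle
  \<open>X = X -> 0\<close> to the given one, so \<open>g f\<close> factors through a zero object.
  Rotation gives the other two equations.\<close>

lemma tri_Comp_zero:
  assumes "tri C X Y Z f g h"
  shows "g \<cdot> f = 0" "h \<cdot> g = 0" "shM C f \<cdot> h = 0"
proof -
  have *: "g \<cdot> f = 0" if T: "tri C X Y Z f g h" for X Y Z f g h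
  proof -
    obtain N where N: "zero_object C N" using ex_zero_object by blast
    note t = tri_Hom[OF T]
    obtain c where "c \<in> Hom C N Z" "c \<cdot> 0 = g \<cdot> f"
      using tri_morphism[OF tri_ident[OF N, of X] T ident_in_Hom, of f] t by blast
    then show ?thesis by simp
  qed
  note t = tri_Hom[OF assms]
  show "g \<cdot> f = 0" "h \<cdot> g = 0" using *[OF assms] *[OF rotate[OF assms]] .
  have "(- shM C f) \<cdot> h = 0" using *[OF rotate[OF rotate[OF assms]]] .
  then show "shM C f \<cdot> h = 0" using Comp_minus_left[of h Z _ "shM C f"] t shM_in_Hom by fastforce
qed

text \<open>Comparison with the rotated identity triangle \<open>W -> 0 -> W[1]\<close>: the third
  component of the morphism is the shift of the wanted lift, and the signs from rotating both
  triangles cancel.\<close>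

lemma tri_factor_through_first:
  assumes "tri C X Y Z f g h" "x \<in> Hom C W Y" "g \<cdot> x = 0"
  obtains y where "y \<in> Hom C W X" "x = f \<cdot> y"
proof -
  note t = tri_Hom[OF assms(1)]
  obtain N where N: "zero_object C N" using ex_zero_object by blast
  have W: "tri C W N (shO C W) 0 0 (- shM C (ident C W))"
    by (rule rotate[OF tri_ident[OF N]])
  obtain c where c: "c \<in> Hom C (shO C W) (shO C X)" "shM C x \<cdot> (- shM C (ident C W)) = (- shM C f) \<cdot> c"
    using tri_morphism[OF W rotate[OF assms(1)] assms(2), of 0] assms(2,3) by fastforce
  obtain y where y: "y \<in> Hom C W X" "c = shM C y" using c(1) by (rule shM_Hom_obtains)
  have "shM C x = shM C f \<cdot> shM C y"
    using c(2) y(2) Comp_minus_right[OF ident_in_Hom shM_in_Hom[OF assms(2)]]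
      Comp_minus_left[OF c(1) shM_in_Hom] t Comp_ident_right[OF shM_in_Hom[OF assms(2)]]
    by (metis minus_equation_iff shM_ident)
  then have "x = f \<cdot> y" using shM_Comp[of y W X f Y] y t shM_inject[of x "f \<cdot> y"] by simp
  with y that show ?thesis by blast
qed

text \<open>Comparison with the triangle \<open>0 -> W = W\<close>, whose first object is a
  desuspended zero object.\<close>

lemma tri_factor_through_second:
  assumes "tri C X Y Z f g h" "y \<in> Hom C Y W" "y \<cdot> f = 0"
  obtains z where "z \<in> Hom C Z W" "y = z \<cdot> g"
proof -
  note t = tri_Hom[OF assms(1)]
  obtain N where N: "zero_object C N" using ex_zero_object by blast
  obtain N' where N': "N = shO C N'" by (rule shO_obtains)
  obtain k where k: "tri C N' W W k (ident C W) 0"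
    using unrotate[of W W N' "ident C W" 0 0] tri_ident[OF N] N' by metis
  obtain z where "z \<in> Hom C Z W" "z \<cdot> g = ident C W \<cdot> y"
    using tri_morphism[OF assms(1) k, of 0 y] assms(2,3) tri_Hom[OF k] by fastforce
  then show ?thesis using that assms(2) Comp_ident_left by metis
qed

lemma tri_factor_through_middle:
  assumes "tri C X Y Z f g h" "x \<in> Hom C W Z" "h \<cdot> x = 0"
  obtains y where "y \<in> Hom C W Y" "x = g \<cdot> y"
  using tri_factor_through_first[OF rotate[OF assms(1)] assms(2,3)] .

lemma tri_factor_through_third:
  assumes "tri C X Y Z f g h" "x \<in> Hom C W (shO C X)" "shM C f \<cdot> x = 0"
  obtains y where "y \<in> Hom C W Z" "x = h \<cdot> y"
proof -
  have "(- shM C f) \<cdot> x = 0"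
    using assms tri_Hom[OF assms(1)] shM_in_Hom[of f X Y] by (simp add: Comp_minus_left)
  then show ?thesis using tri_factor_through_first[OF rotate[OF rotate[OF assms(1)]] assms(2)] that by blast
qed

lemma tri_extend_third:
  assumes "tri C X Y Z f g h" "z \<in> Hom C Z W" "z \<cdot> g = 0"
  obtains w where "w \<in> Hom C (shO C X) W" "z = w \<cdot> h"
  using tri_factor_through_second[OF rotate[OF assms(1)] assms(2,3)] .

text \<open>The obstruction to extending \<open>z\<close> over \<open>f\<close> is
  \<open>z[1] h\<close>. After rotating twice the map to be factored through is
  \<open>- f[1]\<close>, hence the witness \<open>- y\<close>.\<close>

lemma tri_extend_first:
  assumes "tri C X Y Z f g h" "z \<in> Hom C X W" "shM C z \<cdot> h = 0"
  obtains y where "y \<in> Hom C Y W" "z = y \<cdot> f"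
proof -
  note t = tri_Hom[OF assms(1)]
  obtain v where v: "v \<in> Hom C (shO C Y) (shO C W)" "shM C z = v \<cdot> (- shM C f)"
    using tri_factor_through_second[OF rotate[OF rotate[OF assms(1)]] shM_in_Hom[OF assms(2)] assms(3)] .
  obtain y where y: "y \<in> Hom C Y W" "v = shM C y" using v(1) by (rule shM_Hom_obtains)
  have "shM C z = shM C (- y \<cdot> f)"
    using v y Comp_minus_left[OF t(1) y(1)] Comp_minus_right[OF shM_in_Hom[OF t(1)] v(1)] shM_Comp[OF t(1) y(1)]
      shM_minus[OF Comp_in_Hom[OF t(1) y(1)]] by simp
  then show ?thesis using that[of "- y"] y t by (simp add: shM_inject minus_in_Hom)
qed

text \<open>The retraction forces \<open>h = p[1] i[1] h = 0\<close>, so \<open>g\<close> has a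
  section. Since \<open>1 - i p\<close> kills \<open>i\<close>, it factors as \<open>j' g\<close>,
  and this \<open>j'\<close> is the section that fits with \<open>p\<close>.\<close>

lemma split_mono_biproduct:
  assumes "i \<in> Hom C A X" "p \<in> Hom C X A" "p \<cdot> i = ident C A" "tri C A X Y i g h"
  obtains j where "biproduct X A Y i p j g"
proof -
  note t = tri_Hom[OF assms(4)] and z = tri_Comp_zero[OF assms(4)]
  have h0: "h = 0"
  proof -
    have "shM C p \<cdot> (shM C i \<cdot> h) = h"
      using Comp_assoc[of h Y "shO C A" "shM C i" "shO C X" "shM C p" "shO C A"] t assms
      by (simp add: shM_in_Hom shM_ident Comp_ident_left flip: shM_Comp)
    then show ?thesis using z(3) shM_in_Hom[OF assms(2)] by simp
  qed
  obtain j where j: "j \<in> Hom C Y X" "ident C Y = g \<cdot> j"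
    using tri_factor_through_middle[OF assms(4) ident_in_Hom] h0 ident_in_Hom Comp_zero_left by metis
  define d where "d = ident C X - i \<cdot> p"
  have ip: "i \<cdot> p \<in> Hom C X X" and d: "d \<in> Hom C X X"
    using assms unfolding d_def by (auto intro: Hom_intros)
  note d_simps = Comp_diff_left Comp_diff_right Comp_ident_left Comp_ident_right
  have di: "d \<cdot> i = 0" using assms(1-3) ip ident_in_Hom[of X]
    by (simp add: d_def d_simps Comp_assoc)
  have pd: "p \<cdot> d = 0" using assms(1-3) ip ident_in_Hom[of X] Comp_assoc[OF assms(2,1,2)]
    by (simp add: d_def d_simps)
  have gd: "g \<cdot> d = g" using Comp_assoc[OF assms(2,1) t(2)] t(2) ip z(1) assms(2) ident_in_Hom[of X]
    by (simp add: d_def d_simps)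
  obtain j' where j': "j' \<in> Hom C Y X" "d = j' \<cdot> g"
    using tri_factor_through_second[OF assms(4) d di] .
  have "(g \<cdot> j') \<cdot> g = g" using Comp_assoc[of g X Y j' X g Y] t j' gd by simp
  then have "(g \<cdot> j') \<cdot> (g \<cdot> j) = g \<cdot> j"
    using Comp_assoc[of j Y X g Y "g \<cdot> j'" Y] t j j' by (metis Comp_in_Hom)
  then have "g \<cdot> j' = ident C Y"
    using j(2) Comp_ident_right[of "g \<cdot> j'" Y Y] Comp_in_Hom[of j' Y X g Y] j' t by simp
  then have "biproduct X A Y i p j' g"
    using assms(1-3) t j' unfolding biproduct_def by (simp add: d_def algebra_simps)
  then show ?thesis by (rule that)
qed

text \<open>The cone of a split monomorphism is a complement, so retracts and direct summands
  coincide.\<close>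

lemma split_mono_complement:
  assumes "i \<in> Hom C A X" "p \<in> Hom C X A" "p \<cdot> i = ident C A"
  obtains Y j q where "biproduct X A Y i p j q"
  using tri_complete[OF assms(1)] split_mono_biproduct[OF assms] by metis

text \<open>In the triangle on \<open>f\<close> the second map vanishes because \<open>f\<close> is
  epi, and the third because \<open>f\<close> is mono; then \<open>f\<close> has a right and a left
  inverse.\<close>

lemma is_iso_of_mono_epi:
  assumes f: "f \<in> Hom C X Y"
    and mono: "\<And>W x. \<lbrakk>x \<in> Hom C W X; f \<cdot> x = 0\<rbrakk> \<Longrightarrow> x = 0"
    and epi: "\<And>W y. \<lbrakk>y \<in> Hom C Y W; y \<cdot> f = 0\<rbrakk> \<Longrightarrow> y = 0"
  shows "is_iso C X Y f"
proof -
  obtain Z g h where T: "tri C X Y Z f g h" using tri_complete[OF f] by blast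
  note t = tri_Hom[OF T] and z = tri_Comp_zero[OF T]
  have g0: "g = 0" using epi[of g Z] t z by blast
  obtain Z' where Z': "Z = shO C Z'" by (rule shO_obtains)
  obtain k where k: "k \<in> Hom C Z' X" "h = shM C k" using t shM_Hom_obtains[of h Z' X] Z' by blast
  have "shM C (f \<cdot> k) = 0" using shM_Comp[OF k(1) f] z(3) k by simp
  then have "k = 0" using mono[OF k(1)] by (simp add: shM_eq_zero_iff)
  then have h0: "h = 0" using k by simp
  obtain a where a: "a \<in> Hom C Y X" "ident C Y = f \<cdot> a"
    using tri_factor_through_first[OF T ident_in_Hom] g0 by (metis Comp_zero_left ident_in_Hom)
  obtain b where b: "b \<in> Hom C Y X" "ident C X = b \<cdot> f"
    using tri_extend_first[OF T ident_in_Hom] h0 shM_ident Comp_zero_right[OF ident_in_Hom] by metis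
  show ?thesis using is_iso_of_left_right[OF f b(1) a(1)] a b by simp
qed

text \<open>The difference \<open>n = e - 1\<close> satisfies \<open>n g = 0\<close>, so it factors
  as \<open>y h\<close>, and \<open>n n = y h n = 0\<close> because \<open>h n = 0\<close>.\<close>

lemma tri_endo_iso:
  assumes "tri C X Y Z f g h" "e \<in> Hom C Z Z" "e \<cdot> g = g" "h \<cdot> e = h"
  shows "is_iso C Z Z e"
proof -
  note t = tri_Hom[OF assms(1)]
  define n where "n = e - ident C Z"
  have n: "n \<in> Hom C Z Z" using assms by (auto simp: n_def intro: Hom_intros)
  have "n \<cdot> g = 0" "h \<cdot> n = 0" using assms t ident_in_Hom[of Z]
    by (simp_all add: n_def Comp_diff_left[of _ Y Z] Comp_diff_right[of _ Z Z] Comp_ident_left Comp_ident_right)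
  then obtain y where y: "y \<in> Hom C (shO C X) Z" "n = y \<cdot> h"
    using tri_extend_third[OF assms(1) n] by blast
  have "n \<cdot> n = y \<cdot> (h \<cdot> n)" using Comp_assoc[of n Z Z h _ y Z] n y t by auto
  then have "n \<cdot> n = 0" using \<open>h \<cdot> n = 0\<close> y by simp
  then show ?thesis using is_iso_ident_plus_nilpotent[OF assms(2)] by (simp add: n_def)
qed

text \<open>The inverses of \<open>a\<close> and \<open>b\<close> extend to a morphism of triangles
  in the other direction. Both composites on the third objects commute with the identity elsewhere,
  so \<open>tri_endo_iso\<close> makes them invertible.\<close>

lemma tri_five:
  assumes T: "tri C X Y Z f g h" and T': "tri C X' Y' Z' f' g' h'"
    and iso: "is_iso C X X' a" "is_iso C Y Y' b" and c: "c \<in> Hom C Z Z'"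
    and comm: "b \<cdot> f = f' \<cdot> a" "c \<cdot> g = g' \<cdot> b" "shM C a \<cdot> h = h' \<cdot> c"
  shows "is_iso C Z Z' c"
proof -
  note t = tri_Hom[OF T] and t' = tri_Hom[OF T']
  obtain a' where a: "a \<in> Hom C X X'" "a' \<in> Hom C X' X" "a' \<cdot> a = ident C X" "a \<cdot> a' = ident C X'"
    using iso(1) by (rule is_isoE)
  obtain b' where b: "b \<in> Hom C Y Y'" "b' \<in> Hom C Y' Y" "b' \<cdot> b = ident C Y" "b \<cdot> b' = ident C Y'"
    using iso(2) by (rule is_isoE)
  note sa = shM_in_Hom[OF a(1)] shM_in_Hom[OF a(2)]
  have saa: "shM C a' \<cdot> shM C a = ident C (shO C X)" "shM C a \<cdot> shM C a' = ident C (shO C X')"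
    using a by (simp_all add: shM_ident flip: shM_Comp)
  have "b' \<cdot> f' = (b' \<cdot> f') \<cdot> (a \<cdot> a')" using a b t' Comp_ident_right[of "b' \<cdot> f'"] Comp_in_Hom by metis
  also have "\<dots> = b' \<cdot> (f' \<cdot> a \<cdot> a')"
    using a b t' Comp_in_Hom[OF a(2,1)] by (simp add: Comp_assoc)
  also have "\<dots> = b' \<cdot> (b \<cdot> (f \<cdot> a'))"
    using comm(1) Comp_assoc[OF a(2) t(1) b(1)] by simp
  also have "\<dots> = f \<cdot> a'"
    using Comp_assoc[OF Comp_in_Hom[OF a(2) t(1)] b(1,2)] b(3) Comp_ident_left Comp_in_Hom[OF a(2) t(1)]
    by metis
  finally obtain c' where c': "c' \<in> Hom C Z' Z" "c' \<cdot> g' = g \<cdot> b'" "shM C a' \<cdot> h' = h \<cdot> c'"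
    using tri_morphism[OF T' T a(2) b(2)] by blast
  have "is_iso C Z Z (c' \<cdot> c)"
  proof (rule tri_endo_iso[OF T])
    show "c' \<cdot> c \<cdot> g = g"
      using Comp_assoc[OF _ c c'(1), of g] Comp_assoc[OF b(1) _ c'(1), of g'] Comp_assoc[OF b(1,2), of g] t t' comm(2) c'(2) b(3)
        Comp_ident_right[of g] by metis
    show "h \<cdot> (c' \<cdot> c) = h"
      using Comp_assoc[OF c c'(1), of h] Comp_assoc[OF c _ sa(2), of h'] Comp_assoc[OF _ sa, of h] t t' comm(3) c'(3) saa
        Comp_ident_left[of h] by metis
  qed (use c c' in \<open>auto intro: Comp_in_Hom\<close>)
  moreover have "is_iso C Z' Z' (c \<cdot> c')"
  proof (rule tri_endo_iso[OF T'])
    show "c \<cdot> c' \<cdot> g' = g'"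
      using Comp_assoc[OF _ c'(1) c, of g'] Comp_assoc[OF b(2) _ c, of g] Comp_assoc[OF b(2,1), of g'] t t' comm(2) c'(2) b(4)
        Comp_ident_right[of g'] by metis
    show "h' \<cdot> (c \<cdot> c') = h'"
      using Comp_assoc[OF c'(1) c, of h'] Comp_assoc[OF c'(1) _ sa(1), of h] Comp_assoc[OF _ sa(2,1), of h'] t t' comm(3) c'(3) saa
        Comp_ident_left[of h'] by metis
  qed (use c c' in \<open>auto intro: Comp_in_Hom\<close>)
  ultimately show ?thesis by (rule is_iso_of_Comps[OF c c'(1)])
qed

lemma tri_five_first:
  assumes T: "tri C X Y Z f g h" and T': "tri C X' Y' Z' f' g' h'"
    and iso: "is_iso C Y Y' b" "is_iso C Z Z' c" and a: "a \<in> Hom C X X'"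
    and comm: "b \<cdot> f = f' \<cdot> a" "c \<cdot> g = g' \<cdot> b" "shM C a \<cdot> h = h' \<cdot> c"
  shows "is_iso C X X' a"
proof -
  note t = tri_Hom[OF T] and t' = tri_Hom[OF T']
  have b: "b \<in> Hom C Y Y'" using iso(1) by (auto simp: is_iso_def)
  have "shM C b \<cdot> (- shM C f) = - (shM C (b \<cdot> f))"
    using b t shM_Comp[of f X Y b Y'] Comp_minus_right[OF shM_in_Hom shM_in_Hom[OF b], of f] by simp
  moreover have "(- shM C f') \<cdot> shM C a = - (shM C (f' \<cdot> a))"
    using a t' shM_Comp[of a X X' f' Y'] Comp_minus_left[OF shM_in_Hom[OF a] shM_in_Hom, of f'] by simp
  ultimately have "is_iso C (shO C X) (shO C X') (shM C a)"
    using comm tri_five[OF rotate[OF T] rotate[OF T'] iso shM_in_Hom[OF a]] by simp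
  then show ?thesis using is_iso_shM_iff[OF a] by simp
qed

end

section \<open>Direct sums\<close>

context linear_category
begin

lemma biproduct_eqI_to:
  assumes "biproduct X A B i p j q" "x \<in> Hom C W X" "y \<in> Hom C W X" "p \<cdot> x = p \<cdot> y" "q \<cdot> x = q \<cdot> y"
  shows "x = y"
  using biproduct_elements(5)[OF assms(1,2)] biproduct_elements(5)[OF assms(1,3)] assms(4,5) by metis

lemma biproduct_eqI_from:
  assumes "biproduct X A B i p j q" "x \<in> Hom C X W" "y \<in> Hom C X W" "x \<cdot> i = y \<cdot> i" "x \<cdot> j = y \<cdot> j"
  shows "x = y"
  using biproduct_elements(6)[OF assms(1,2)] biproduct_elements(6)[OF assms(1,3)] assms(4,5) by metis

lemma biproduct_pair:
  assumes X: "biproduct X A B i p j q" and f: "f \<in> Hom C W A" "g \<in> Hom C W B"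
  shows "i \<cdot> f + j \<cdot> g \<in> Hom C W X" "p \<cdot> (i \<cdot> f + j \<cdot> g) = f" "q \<cdot> (i \<cdot> f + j \<cdot> g) = g"
proof -
  note b = biproductD[OF X] and t = Comp_in_Hom[OF f(1) biproductD(1)[OF X]] Comp_in_Hom[OF f(2) biproductD(3)[OF X]]
  show "i \<cdot> f + j \<cdot> g \<in> Hom C W X" using t by (rule add_in_Hom)
  show "p \<cdot> (i \<cdot> f + j \<cdot> g) = f" "q \<cdot> (i \<cdot> f + j \<cdot> g) = g"
    using Comp_add_right[OF t b(2)] Comp_add_right[OF t b(4)] biproduct_elements[OF X] f by simp_all
qed

lemma biproduct_copair:
  assumes X: "biproduct X A B i p j q" and f: "f \<in> Hom C A W" "g \<in> Hom C B W"
  shows "f \<cdot> p + g \<cdot> q \<in> Hom C X W" "(f \<cdot> p + g \<cdot> q) \<cdot> i = f" "(f \<cdot> p + g \<cdot> q) \<cdot> j = g"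
proof -
  note b = biproductD[OF X] and t = Comp_in_Hom[OF biproductD(2)[OF X] f(1)] Comp_in_Hom[OF biproductD(4)[OF X] f(2)]
  show "f \<cdot> p + g \<cdot> q \<in> Hom C X W" using t by (rule add_in_Hom)
  show "(f \<cdot> p + g \<cdot> q) \<cdot> i = f" "(f \<cdot> p + g \<cdot> q) \<cdot> j = g"
    using Comp_add_left[OF b(1) t] Comp_add_left[OF b(3) t] b f by (simp_all add: Comp_assoc Comp_ident_right)
qed

lemma biproduct_map:
  assumes X: "biproduct X X1 X2 iX pX jX qX" and Y: "biproduct Y Y1 Y2 iY pY jY qY"
    and f: "f \<in> Hom C X1 Y1" "g \<in> Hom C X2 Y2"
  obtains F where "F \<in> Hom C X Y" "pY \<cdot> F = f \<cdot> pX" "qY \<cdot> F = g \<cdot> qX" "F \<cdot> iX = iY \<cdot> f" "F \<cdot> jX = jY \<cdot> g"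
proof -
  note bX = biproductD[OF X] and bY = biproductD[OF Y]
  note t = Comp_in_Hom[OF bX(2) f(1)] Comp_in_Hom[OF bX(4) f(2)]
  note t' = Comp_in_Hom[OF f(1) bY(1)] Comp_in_Hom[OF f(2) bY(3)]
  have "iY \<cdot> (f \<cdot> pX) = iY \<cdot> f \<cdot> pX" "jY \<cdot> (g \<cdot> qX) = jY \<cdot> g \<cdot> qX"
    using bX bY f by (simp_all add: Comp_assoc)
  then show ?thesis
    using biproduct_pair[OF Y t] biproduct_copair[OF X t'] by (intro that[of "iY \<cdot> (f \<cdot> pX) + jY \<cdot> (g \<cdot> qX)"]) simp_all
qed

lemma zero_object_summand:
  assumes "zero_object C A" "biproduct X A B i p j q"
  shows "isomorphic C B X" "is_iso C B X j"
proof -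
  note b = biproductD[OF assms(2)]
  have "i = 0" using zero_object_Hom_from[OF assms(1) b(1)] .
  then have "j \<cdot> q = ident C X" using b by simp
  then show "is_iso C B X j" using b by (intro is_isoI[of _ _ _ q]) auto
  then show "isomorphic C B X" unfolding isomorphic_def by blast
qed

lemma is_direct_sum_isomorphic:
  assumes "is_direct_sum C X Xs" "isomorphic C X X'"
  shows "is_direct_sum C X' Xs"
proof -
  obtain inj prj where
    t: "\<And>i. i < length Xs \<Longrightarrow> inj i \<in> Hom C (Xs ! i) X" "\<And>i. i < length Xs \<Longrightarrow> prj i \<in> Hom C X (Xs ! i)" and
    d: "\<And>i j. \<lbrakk>i < length Xs; j < length Xs\<rbrakk> \<Longrightarrow> prj i \<cdot> inj j = (if i = j then ident C (Xs ! i) else 0)" and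
    s: "(\<Sum>i < length Xs. inj i \<cdot> prj i) = ident C X"
    using assms(1) unfolding is_direct_sum_def by blast
  obtain u v where u: "u \<in> Hom C X X'" "v \<in> Hom C X' X" "v \<cdot> u = ident C X" "u \<cdot> v = ident C X'"
    using assms(2) unfolding isomorphic_def is_iso_def by blast
  have e: "prj i \<cdot> v \<cdot> (u \<cdot> inj j) = prj i \<cdot> inj j" if "i < length Xs" "j < length Xs" for i j
    using Comp_assoc[OF Comp_in_Hom[OF t(1)[OF that(2)] u(1)] u(2) t(2)[OF that(1)]]
      Comp_assoc[OF t(1)[OF that(2)] u(1,2)] u(3) Comp_ident_left[OF t(1)[OF that(2)]] by simp
  have "(\<Sum>i < length Xs. u \<cdot> inj i \<cdot> (prj i \<cdot> v)) = (\<Sum>i < length Xs. u \<cdot> ((inj i \<cdot> prj i) \<cdot> v))"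
  proof (rule sum.cong)
    fix i assume "i \<in> {..<length Xs}"
    then have i: "inj i \<in> Hom C (Xs ! i) X" "prj i \<in> Hom C X (Xs ! i)" using t by auto
    show "u \<cdot> inj i \<cdot> (prj i \<cdot> v) = u \<cdot> ((inj i \<cdot> prj i) \<cdot> v)"
      using i u(1,2) Comp_in_Hom[OF u(2) i(2)] by (simp add: Comp_assoc)
  qed simp
  also have "\<dots> = u \<cdot> (\<Sum>i < length Xs. (inj i \<cdot> prj i) \<cdot> v)"
    by (rule Comp_sum_right[symmetric, OF _ u(1)]) (auto intro!: Comp_in_Hom[OF u(2) Comp_in_Hom[OF t(2) t(1)]])
  also have "(\<Sum>i < length Xs. (inj i \<cdot> prj i) \<cdot> v) = (\<Sum>i < length Xs. inj i \<cdot> prj i) \<cdot> v"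
    by (rule Comp_sum_left[symmetric, OF _ u(2)]) (auto intro!: Comp_in_Hom[OF t(2) t(1)])
  finally have sum: "(\<Sum>i < length Xs. u \<cdot> inj i \<cdot> (prj i \<cdot> v)) = ident C X'"
    using s u by (simp add: Comp_ident_left)
  show ?thesis
    unfolding is_direct_sum_def
  proof (rule exI[of _ "\<lambda>i. u \<cdot> inj i"], rule exI[of _ "\<lambda>i. prj i \<cdot> v"], intro conjI allI impI)
    fix i j assume i: "i < length Xs"
    show "u \<cdot> inj i \<in> Hom C (Xs ! i) X'" "prj i \<cdot> v \<in> Hom C X' (Xs ! i)"
      using t[OF i] u by (auto intro: Comp_in_Hom)
    assume "j < length Xs"
    then show "prj i \<cdot> v \<cdot> (u \<cdot> inj j) = (if i = j then ident C (Xs ! i) else 0)"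
      using e d i by simp
  qed (rule sum)
qed

end

section \<open>Direct sums of lists as iterated biproducts\<close>

context triangulated_category
begin

text \<open>Makes direct sums accessible to induction on lists. From left to right the complement of
  the first summand is not part of the given data; it is obtained as a cone, and the remaining
  injections and projections are transported to it.\<close>

lemma is_direct_sum_Cons:
  "is_direct_sum C X (A # As) \<longleftrightarrow> (\<exists>Y i p j q. biproduct X A Y i p j q \<and> is_direct_sum C Y As)"
proof
  assume "is_direct_sum C X (A # As)"
  then obtain inj prj where
    t: "\<forall>i < length (A # As). inj i \<in> Hom C ((A # As) ! i) X \<and> prj i \<in> Hom C X ((A # As) ! i)" and
    d: "\<forall>i < length (A # As). \<forall>j < length (A # As). prj i \<cdot> inj j = (if i = j then ident C ((A # As) ! i) else 0)" and
    s: "(\<Sum>i < length (A # As). inj i \<cdot> prj i) = ident C X"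
    unfolding is_direct_sum_def by blast
  have t0: "inj 0 \<in> Hom C A X" "prj 0 \<in> Hom C X A" and d0: "prj 0 \<cdot> inj 0 = ident C A"
    using t d by force+
  have tS: "inj (Suc k) \<in> Hom C (As ! k) X" "prj (Suc k) \<in> Hom C X (As ! k)" if "k < length As" for k
    using t[rule_format, of "Suc k"] that by auto
  have dS: "prj (Suc k) \<cdot> inj (Suc l) = (if k = l then ident C (As ! k) else 0)" if "k < length As" "l < length As" for k l
    using d[rule_format, of "Suc k" "Suc l"] that by auto
  have d0S: "prj (Suc k) \<cdot> inj 0 = 0" if "k < length As" for k
    using d[rule_format, of "Suc k" 0] that by auto
  obtain Y j q where Y: "biproduct X A Y (inj 0) (prj 0) j q"
    using split_mono_complement[OF t0 d0] .
  note b = biproductD[OF Y]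
  \<comment> \<open>The later projections vanish on \<open>inj 0\<close>, so they see only the part
    of \<open>x\<close> in the complement.\<close>
  have jq: "prj (Suc k) \<cdot> (j \<cdot> (q \<cdot> x)) = prj (Suc k) \<cdot> x" if "k < length As" "x \<in> Hom C W X" for k x W
  proof -
    have "prj (Suc k) \<cdot> x = prj (Suc k) \<cdot> (inj 0 \<cdot> (prj 0 \<cdot> x) + j \<cdot> (q \<cdot> x))"
      using biproduct_elements(5)[OF Y that(2)] by simp
    also have "\<dots> = prj (Suc k) \<cdot> (inj 0 \<cdot> (prj 0 \<cdot> x)) + prj (Suc k) \<cdot> (j \<cdot> (q \<cdot> x))"
      by (rule Comp_add_right[OF _ _ tS(2)[OF that(1)]]) (use b that in \<open>blast intro: Comp_in_Hom\<close>)+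
    also have "prj (Suc k) \<cdot> (inj 0 \<cdot> (prj 0 \<cdot> x)) = 0"
      using Comp_assoc[OF Comp_in_Hom[OF that(2) t0(2)] t0(1) tS(2)[OF that(1)]] d0S[OF that(1)] that t0 by (metis Comp_in_Hom Comp_zero_left)
    finally show ?thesis by simp
  qed
  have "is_direct_sum C Y As"
    unfolding is_direct_sum_def
  proof (rule exI[of _ "\<lambda>k. q \<cdot> inj (Suc k)"], rule exI[of _ "\<lambda>k. prj (Suc k) \<cdot> j"], intro conjI allI impI)
    fix k assume k: "k < length As"
    show "q \<cdot> inj (Suc k) \<in> Hom C (As ! k) Y" "prj (Suc k) \<cdot> j \<in> Hom C Y (As ! k)"
      using tS[OF k] b by (auto intro: Comp_in_Hom)
    fix l assume l: "l < length As"
    show "prj (Suc k) \<cdot> j \<cdot> (q \<cdot> inj (Suc l)) = (if k = l then ident C (As ! k) else 0)"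
      using Comp_assoc[OF Comp_in_Hom[OF tS(1)[OF l] b(4)] b(3) tS(2)[OF k]] jq[OF k tS(1)[OF l]] dS[OF k l] by simp
  next
    have ts: "inj (Suc k) \<cdot> prj (Suc k) \<in> Hom C X X" if "k < length As" for k
      using tS[OF that] by (auto intro: Comp_in_Hom)
    have "ident C X = inj 0 \<cdot> prj 0 + (\<Sum>k < length As. inj (Suc k) \<cdot> prj (Suc k))"
      using s by (simp add: sum.lessThan_Suc_shift del: sum.lessThan_Suc)
    then have "j \<cdot> q = (\<Sum>k < length As. inj (Suc k) \<cdot> prj (Suc k))" using b(7) by (metis add_left_cancel)
    moreover have "q \<cdot> ((j \<cdot> q) \<cdot> j) = ident C Y"
      using b by (simp add: Comp_assoc Comp_ident_right)
    ultimately have "ident C Y = q \<cdot> ((\<Sum>k < length As. inj (Suc k) \<cdot> prj (Suc k)) \<cdot> j)" by simp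
    also have "(\<Sum>k < length As. inj (Suc k) \<cdot> prj (Suc k)) \<cdot> j = (\<Sum>k < length As. inj (Suc k) \<cdot> prj (Suc k) \<cdot> j)"
      by (rule Comp_sum_left[OF _ b(3)]) (use ts in auto)
    also have "q \<cdot> \<dots> = (\<Sum>k < length As. q \<cdot> (inj (Suc k) \<cdot> prj (Suc k) \<cdot> j))"
      by (rule Comp_sum_right[OF _ b(4)]) (use ts b(3) in \<open>auto intro: Comp_in_Hom\<close>)
    also have "\<dots> = (\<Sum>k < length As. q \<cdot> inj (Suc k) \<cdot> (prj (Suc k) \<cdot> j))"
    proof (rule sum.cong)
      fix k assume "k \<in> {..<length As}"
      then have k: "inj (Suc k) \<in> Hom C (As ! k) X" "prj (Suc k) \<in> Hom C X (As ! k)" using tS by auto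
      show "q \<cdot> (inj (Suc k) \<cdot> prj (Suc k) \<cdot> j) = q \<cdot> inj (Suc k) \<cdot> (prj (Suc k) \<cdot> j)"
        using k b(3,4) Comp_in_Hom[OF b(3) k(2)] by (simp add: Comp_assoc)
    qed simp
    finally show "(\<Sum>k < length As. q \<cdot> inj (Suc k) \<cdot> (prj (Suc k) \<cdot> j)) = ident C Y" by simp
  qed
  with Y show "\<exists>Y i p j q. biproduct X A Y i p j q \<and> is_direct_sum C Y As" by blast
next
  assume "\<exists>Y i p j q. biproduct X A Y i p j q \<and> is_direct_sum C Y As"
  then obtain Y i p j q where Y: "biproduct X A Y i p j q" and "is_direct_sum C Y As" by blast
  then obtain inj prj where
    t: "\<And>k. k < length As \<Longrightarrow> inj k \<in> Hom C (As ! k) Y" "\<And>k. k < length As \<Longrightarrow> prj k \<in> Hom C Y (As ! k)" and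
    d: "\<And>k l. \<lbrakk>k < length As; l < length As\<rbrakk> \<Longrightarrow> prj k \<cdot> inj l = (if k = l then ident C (As ! k) else 0)" and
    s: "(\<Sum>k < length As. inj k \<cdot> prj k) = ident C Y"
    unfolding is_direct_sum_def by blast
  note b = biproductD[OF Y]
  let ?inj = "case_nat i (\<lambda>k. j \<cdot> inj k)" and ?prj = "case_nat p (\<lambda>k. prj k \<cdot> q)"
  have d': "?prj m \<cdot> ?inj n = (if m = n then ident C ((A # As) ! m) else 0)"
    if "m < length (A # As)" "n < length (A # As)" for m n
  proof -
    have 1: "p \<cdot> (j \<cdot> inj k) = 0" if "k < length As" for k
      using biproduct_elements(3)[OF Y t(1)[OF that]] .
    have 2: "prj k \<cdot> q \<cdot> i = 0" if "k < length As" for k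
      using Comp_assoc[OF b(1,4) t(2)[OF that]] b(9) t(2)[OF that] by simp
    have 3: "prj k \<cdot> q \<cdot> (j \<cdot> inj l) = prj k \<cdot> inj l" if "k < length As" "l < length As" for k l
      using Comp_assoc[OF Comp_in_Hom[OF t(1)[OF that(2)] b(3)] b(4) t(2)[OF that(1)]]
        biproduct_elements(2)[OF Y t(1)[OF that(2)]] by simp
    show ?thesis using 1 2 3 d b that by (auto split: nat.split)
  qed
  have "(\<Sum>k < length As. j \<cdot> inj k \<cdot> (prj k \<cdot> q)) = (\<Sum>k < length As. j \<cdot> (inj k \<cdot> prj k \<cdot> q))"
  proof (rule sum.cong)
    fix k assume "k \<in> {..<length As}"
    then have k: "inj k \<in> Hom C (As ! k) Y" "prj k \<in> Hom C Y (As ! k)" using t by auto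
    show "j \<cdot> inj k \<cdot> (prj k \<cdot> q) = j \<cdot> (inj k \<cdot> prj k \<cdot> q)"
      using k b(3,4) Comp_in_Hom[OF b(4) k(2)] by (simp add: Comp_assoc)
  qed simp
  also have "\<dots> = j \<cdot> (\<Sum>k < length As. inj k \<cdot> prj k \<cdot> q)"
    by (rule Comp_sum_right[symmetric, OF _ b(3)]) (auto intro!: Comp_in_Hom[OF b(4) Comp_in_Hom[OF t(2) t(1)]])
  also have "(\<Sum>k < length As. inj k \<cdot> prj k \<cdot> q) = (\<Sum>k < length As. inj k \<cdot> prj k) \<cdot> q"
    by (rule Comp_sum_left[symmetric, OF _ b(4)]) (auto intro!: Comp_in_Hom[OF t(2) t(1)])
  finally have "(\<Sum>k < length As. j \<cdot> inj k \<cdot> (prj k \<cdot> q)) = j \<cdot> q"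
    using s b by (simp add: Comp_ident_left)
  then have s': "(\<Sum>m < length (A # As). ?inj m \<cdot> ?prj m) = ident C X"
    using b(7) by (simp add: sum.lessThan_Suc_shift del: sum.lessThan_Suc)
  have t': "?inj m \<in> Hom C ((A # As) ! m) X \<and> ?prj m \<in> Hom C X ((A # As) ! m)" if "m < length (A # As)" for m
    using that b t by (auto split: nat.split intro: Comp_in_Hom)
  show "is_direct_sum C X (A # As)"
    unfolding is_direct_sum_def
    by (rule exI[of _ ?inj], rule exI[of _ ?prj]) (use t' d' s' in blast)
qed

lemma biproduct_exists: obtains X i p j q where "biproduct X A B i p j q"
  using ex_direct_sum is_direct_sum_biproduct by metis

lemma direct_sum_exists: "\<exists>X. is_direct_sum C X As"
proof (induction As)
  case Nil
  then show ?case using ex_zero_object is_direct_sum_Nil by blast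
next
  case (Cons A As)
  then show ?case using biproduct_exists is_direct_sum_Cons by metis
qed

text \<open>Moves an inner summand to the front. \<open>R'\<close> is the complement of the
  composite injection of \<open>B\<close>; the maps from \<open>A\<close> and \<open>S\<close> into
  \<open>X\<close> have no component in \<open>B\<close> and therefore decompose \<open>R'\<close>.
  The injection and projection of \<open>B\<close> stay explicit because \<open>exchange\<close>
  cancels along them.\<close>

lemma biproduct_assoc:
  assumes X: "biproduct X A R i p j q" and R: "biproduct R B S i' p' j' q'"
  obtains R' v v' where "biproduct X B R' (j \<cdot> i') (p' \<cdot> q) v v'" "\<exists>i p j q. biproduct R' A S i p j q"
proof -
  note b = biproductD[OF X] and b' = biproductD[OF R]
  note t = Comp_in_Hom[OF b'(1) b(3)] Comp_in_Hom[OF b(4) b'(2)]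
  have "(p' \<cdot> q) \<cdot> (j \<cdot> i') = ident C B"
    using Comp_assoc[OF t(1) b(4) b'(2)] biproduct_elements(2)[OF X b'(1)] b'(5) by simp
  then obtain R' v v' where R': "biproduct X B R' (j \<cdot> i') (p' \<cdot> q) v v'"
    using split_mono_complement[OF t] by blast
  note c = biproductD[OF R']
  have vv: "v \<cdot> (v' \<cdot> x) = x" if "x \<in> Hom C W X" "p' \<cdot> (q \<cdot> x) = 0" for x W
    using biproduct_elements(5)[OF R' that(1)] Comp_assoc[OF that(1) b(4) b'(2)] that(2) c(1) by simp
  have 1: "v \<cdot> (v' \<cdot> i) = i" using vv[OF b(1)] b(9) b'(2) by simp
  have 2: "v \<cdot> (v' \<cdot> (j \<cdot> j')) = j \<cdot> j'"
    using vv[OF Comp_in_Hom[OF b'(3) b(3)]] biproduct_elements(2)[OF X b'(3)] b'(8) by simp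
  note tv = Comp_in_Hom[OF b(1) c(4)] Comp_in_Hom[OF c(3) b(2)] Comp_in_Hom[OF Comp_in_Hom[OF b'(3) b(3)] c(4)]
    Comp_in_Hom[OF c(3) b(4)]
  have "biproduct R' A S (v' \<cdot> i) (p \<cdot> v) (v' \<cdot> (j \<cdot> j')) (q' \<cdot> (q \<cdot> v))"
    unfolding biproduct_def
  proof (intro conjI)
    show "p \<cdot> v \<cdot> (v' \<cdot> i) = ident C A"
      using Comp_assoc[OF tv(1) c(3) b(2)] 1 b(5) by simp
    show "q' \<cdot> (q \<cdot> v) \<cdot> (v' \<cdot> (j \<cdot> j')) = ident C S"
      using Comp_assoc[OF tv(3,4) b'(4)] Comp_assoc[OF tv(3) c(3) b(4)] 2 biproduct_elements(2)[OF X b'(3)] b'(6) by simp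
    have "v = i \<cdot> (p \<cdot> v) + j \<cdot> (q \<cdot> v)" using biproduct_elements(5)[OF X c(3)] by simp
    also have "q \<cdot> v = i' \<cdot> (p' \<cdot> (q \<cdot> v)) + j' \<cdot> (q' \<cdot> (q \<cdot> v))" using biproduct_elements(5)[OF R tv(4)] by simp
    also have "p' \<cdot> (q \<cdot> v) = 0" using Comp_assoc[OF c(3) b(4) b'(2)] c(8) by simp
    finally have "v = i \<cdot> (p \<cdot> v) + j \<cdot> (j' \<cdot> (q' \<cdot> (q \<cdot> v)))" using b'(1) by simp
    then have "v' \<cdot> v = v' \<cdot> (i \<cdot> (p \<cdot> v)) + v' \<cdot> (j \<cdot> (j' \<cdot> (q' \<cdot> (q \<cdot> v))))"
      using Comp_add_right[OF Comp_in_Hom[OF tv(2) b(1)]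
          Comp_in_Hom[OF Comp_in_Hom[OF Comp_in_Hom[OF tv(4) b'(4)] b'(3)] b(3)] c(4)] by simp
    also have "v' \<cdot> (i \<cdot> (p \<cdot> v)) = v' \<cdot> i \<cdot> (p \<cdot> v)" using Comp_assoc[OF tv(2) b(1) c(4)] by simp
    also have "v' \<cdot> (j \<cdot> (j' \<cdot> (q' \<cdot> (q \<cdot> v)))) = v' \<cdot> (j \<cdot> j') \<cdot> (q' \<cdot> (q \<cdot> v))"
      using Comp_assoc[OF Comp_in_Hom[OF tv(4) b'(4)] Comp_in_Hom[OF b'(3) b(3)] c(4)]
        Comp_assoc[OF Comp_in_Hom[OF tv(4) b'(4)] b'(3) b(3)] by simp
    finally show "v' \<cdot> i \<cdot> (p \<cdot> v) + v' \<cdot> (j \<cdot> j') \<cdot> (q' \<cdot> (q \<cdot> v)) = ident C R'" using c(6) by simp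
  qed (use tv b b' in \<open>auto intro: Comp_in_Hom\<close>)
  with R' show ?thesis using that by blast
qed

lemma is_direct_sum_append:
  assumes "is_direct_sum C A As" "is_direct_sum C B Bs" "biproduct X A B i p j q"
  shows "is_direct_sum C X (As @ Bs)"
  using assms
proof (induction As arbitrary: X A i p j q)
  case Nil
  then show ?case using zero_object_summand(1) is_direct_sum_isomorphic is_direct_sum_Nil by fastforce
next
  case (Cons A1 As)
  obtain A' i' p' j' q' where A': "biproduct A A1 A' i' p' j' q'" "is_direct_sum C A' As"
    using Cons.prems(1) is_direct_sum_Cons by blast
  obtain R' v v' where R': "biproduct X A1 R' (i \<cdot> i') (p' \<cdot> p) v v'" "\<exists>i p j q. biproduct R' B A' i p j q"
    using biproduct_assoc[OF biproduct_commute[OF Cons.prems(3)] A'(1)] .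
  then obtain a b c d where "biproduct R' A' B a b c d" using biproduct_commute by blast
  then have "is_direct_sum C R' (As @ Bs)" using Cons.IH A'(2) Cons.prems(2) by blast
  then show ?case using R'(1) unfolding append_Cons is_direct_sum_Cons by blast
qed

lemma biproduct_shift:
  assumes "biproduct X A B i p j q"
  shows "biproduct (shO C X) (shO C A) (shO C B) (shM C i) (shM C p) (shM C j) (shM C q)"
proof -
  note b = biproductD[OF assms]
  show ?thesis
    unfolding biproduct_def
    using b by (auto simp: shM_in_Hom shM_ident simp flip: shM_Comp shM_add[OF Comp_in_Hom[OF b(2,1)] Comp_in_Hom[OF b(4,3)]])
qed

lemma biproduct_unshift:
  assumes "biproduct (shO C X) (shO C A) (shO C B) i p j q"
  shows "\<exists>i p j q. biproduct X A B i p j q"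
proof -
  note b = biproductD[OF assms]
  obtain i' where i: "i' \<in> Hom C A X" "i = shM C i'" using b(1) by (rule shM_Hom_obtains)
  obtain p' where p: "p' \<in> Hom C X A" "p = shM C p'" using b(2) by (rule shM_Hom_obtains)
  obtain j' where j: "j' \<in> Hom C B X" "j = shM C j'" using b(3) by (rule shM_Hom_obtains)
  obtain q' where q: "q' \<in> Hom C X B" "q = shM C q'" using b(4) by (rule shM_Hom_obtains)
  have "shM C (p' \<cdot> i') = shM C (ident C A)" "shM C (q' \<cdot> j') = shM C (ident C B)"
    "shM C (i' \<cdot> p' + j' \<cdot> q') = shM C (ident C X)"
    using b i p j q by (simp_all add: shM_Comp shM_ident shM_add[OF Comp_in_Hom[OF p(1) i(1)] Comp_in_Hom[OF q(1) j(1)]])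
  then have "biproduct X A B i' p' j' q'"
    unfolding biproduct_def using i p j q by (simp add: shM_inject)
  then show ?thesis by blast
qed

text \<open>\<open>F\<close> is completed to a triangle with third object \<open>Q\<close>, and
  \<open>Q\<close> is compared with \<open>Z\<close> in both directions, one summand at a time. The
  composite on \<open>Q\<close> is invertible by \<open>tri_endo_iso\<close>. On \<open>Z\<close> no
  triangle is known yet, so the square of \<open>c d - 1\<close> is computed: on the two summands it
  factors through \<open>h1\<close> and \<open>h2\<close>, since each given triangle is exact, while
  \<open>H (c d - 1) = 0\<close>.\<close>

lemma tri_biproduct:
  assumes T1: "tri C X1 Y1 Z1 f1 g1 h1" and T2: "tri C X2 Y2 Z2 f2 g2 h2"
    and X: "biproduct X X1 X2 iX pX jX qX" and Y: "biproduct Y Y1 Y2 iY pY jY qY" and Z: "biproduct Z Z1 Z2 iZ pZ jZ qZ"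
  shows "\<exists>F G H. tri C X Y Z F G H"
proof -
  note t1 = tri_Hom[OF T1] and t2 = tri_Hom[OF T2]
  note bX = biproductD[OF X] and bY = biproductD[OF Y] and bZ = biproductD[OF Z]
  note sX = biproduct_shift[OF X]
  note bsX = biproductD[OF sX]
  obtain F where F: "F \<in> Hom C X Y" "pY \<cdot> F = f1 \<cdot> pX" "qY \<cdot> F = f2 \<cdot> qX" "F \<cdot> iX = iY \<cdot> f1" "F \<cdot> jX = jY \<cdot> f2"
    using biproduct_map[OF X Y t1(1) t2(1)] .
  obtain G where G: "G \<in> Hom C Y Z" "pZ \<cdot> G = g1 \<cdot> pY" "qZ \<cdot> G = g2 \<cdot> qY" "G \<cdot> iY = iZ \<cdot> g1" "G \<cdot> jY = jZ \<cdot> g2"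
    using biproduct_map[OF Y Z t1(2) t2(2)] .
  obtain H where H: "H \<in> Hom C Z (shO C X)" "shM C pX \<cdot> H = h1 \<cdot> pZ" "shM C qX \<cdot> H = h2 \<cdot> qZ"
    "H \<cdot> iZ = shM C iX \<cdot> h1" "H \<cdot> jZ = shM C jX \<cdot> h2"
    using biproduct_map[OF Z sX t1(3) t2(3)] .
  obtain Q g h where T: "tri C X Y Q F g h" using tri_complete[OF F(1)] by blast
  note t = tri_Hom[OF T]
  obtain c1 where c1: "c1 \<in> Hom C Q Z1" "c1 \<cdot> g = g1 \<cdot> pY" "shM C pX \<cdot> h = h1 \<cdot> c1"
    using tri_morphism[OF T T1 bX(2) bY(2) F(2)] by blast
  obtain c2 where c2: "c2 \<in> Hom C Q Z2" "c2 \<cdot> g = g2 \<cdot> qY" "shM C qX \<cdot> h = h2 \<cdot> c2"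
    using tri_morphism[OF T T2 bX(4) bY(4) F(3)] by blast
  obtain d1 where d1: "d1 \<in> Hom C Z1 Q" "d1 \<cdot> g1 = g \<cdot> iY" "shM C iX \<cdot> h1 = h \<cdot> d1"
    using tri_morphism[OF T1 T bX(1) bY(1) F(4)[symmetric]] by blast
  obtain d2 where d2: "d2 \<in> Hom C Z2 Q" "d2 \<cdot> g2 = g \<cdot> jY" "shM C jX \<cdot> h2 = h \<cdot> d2"
    using tri_morphism[OF T2 T bX(3) bY(3) F(5)[symmetric]] by blast
  obtain c where c: "c \<in> Hom C Q Z" "pZ \<cdot> c = c1" "qZ \<cdot> c = c2" using biproduct_pair[OF Z c1(1) c2(1)] by blast
  obtain d where d: "d \<in> Hom C Z Q" "d \<cdot> iZ = d1" "d \<cdot> jZ = d2" using biproduct_copair[OF Z d1(1) d2(1)] by blast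
  have cg: "c \<cdot> g = G"
    by (rule biproduct_eqI_to[OF Z Comp_in_Hom[OF t(2) c(1)] G(1)])
      (use c c1 c2 G Comp_assoc[OF t(2) c(1) bZ(2)] Comp_assoc[OF t(2) c(1) bZ(4)] in simp_all)
  have Hc: "H \<cdot> c = h"
    by (rule biproduct_eqI_to[OF sX Comp_in_Hom[OF c(1) H(1)] t(3)])
      (use c c1 c2 H Comp_assoc[OF c(1) H(1) bsX(2)] Comp_assoc[OF c(1) H(1) bsX(4)]
        Comp_assoc[OF c(1) bZ(2) t1(3)] Comp_assoc[OF c(1) bZ(4) t2(3)] in simp_all)
  have dG: "d \<cdot> G = g"
    by (rule biproduct_eqI_from[OF Y Comp_in_Hom[OF G(1) d(1)] t(2)])
      (use d d1 d2 G Comp_assoc[OF bY(1) G(1) d(1)] Comp_assoc[OF bY(3) G(1) d(1)]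
        Comp_assoc[OF t1(2) bZ(1) d(1)] Comp_assoc[OF t2(2) bZ(3) d(1)] in simp_all)
  have hd: "h \<cdot> d = H"
    by (rule biproduct_eqI_from[OF Z Comp_in_Hom[OF d(1) t(3)] H(1)])
      (use d d1 d2 H Comp_assoc[OF bZ(1) d(1) t(3)] Comp_assoc[OF bZ(3) d(1) t(3)] in simp_all)
  have "is_iso C Q Q (d \<cdot> c)"
    by (rule tri_endo_iso[OF T Comp_in_Hom[OF c(1) d(1)]])
      (use cg Hc dG hd Comp_assoc[OF t(2) c(1) d(1)] Comp_assoc[OF c(1) d(1) t(3)] in simp_all)
  moreover have "is_iso C Z Z (c \<cdot> d)"
  proof (rule is_iso_ident_plus_nilpotent[OF Comp_in_Hom[OF d(1) c(1)]])
    define n where "n = c \<cdot> d - ident C Z"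
    have cd: "c \<cdot> d \<in> Hom C Z Z" using c d by (auto intro: Comp_in_Hom)
    have n: "n \<in> Hom C Z Z" using cd by (auto simp: n_def intro: Hom_intros)
    have nG: "n \<cdot> G = 0" using Comp_assoc[OF G(1) d(1) c(1)] cg dG Comp_diff_left[OF G(1) cd ident_in_Hom]
        Comp_ident_left[OF G(1)] by (simp add: n_def)
    have Hn: "H \<cdot> n = 0" using Comp_assoc[OF d(1) c(1) H(1)] Hc hd Comp_diff_right[OF cd ident_in_Hom H(1)]
        Comp_ident_right[OF H(1)] by (simp add: n_def)
    have "(n \<cdot> iZ) \<cdot> g1 = 0" using Comp_assoc[OF t1(2) bZ(1) n] Comp_assoc[OF bY(1) G(1) n] G(4) nG bY(1) by simp
    then obtain y1 where y1: "y1 \<in> Hom C (shO C X1) Z" "n \<cdot> iZ = y1 \<cdot> h1"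
      using tri_extend_third[OF T1 Comp_in_Hom[OF bZ(1) n]] by blast
    have "(n \<cdot> jZ) \<cdot> g2 = 0" using Comp_assoc[OF t2(2) bZ(3) n] Comp_assoc[OF bY(3) G(1) n] G(5) nG bY(3) by simp
    then obtain y2 where y2: "y2 \<in> Hom C (shO C X2) Z" "n \<cdot> jZ = y2 \<cdot> h2"
      using tri_extend_third[OF T2 Comp_in_Hom[OF bZ(3) n]] by blast
    have 1: "h1 \<cdot> (pZ \<cdot> n) = 0"
      using Comp_assoc[OF n bZ(2) t1(3)] Comp_assoc[OF n H(1) bsX(2)] H(2) Hn bsX(2) by simp
    have 2: "h2 \<cdot> (qZ \<cdot> n) = 0"
      using Comp_assoc[OF n bZ(4) t2(3)] Comp_assoc[OF n H(1) bsX(4)] H(3) Hn bsX(4) by simp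
    note tp = Comp_in_Hom[OF n bZ(2)] Comp_in_Hom[OF n bZ(4)]
    have "n \<cdot> n = n \<cdot> (iZ \<cdot> (pZ \<cdot> n) + jZ \<cdot> (qZ \<cdot> n))" using biproduct_elements(5)[OF Z n] by simp
    also have "\<dots> = n \<cdot> (iZ \<cdot> (pZ \<cdot> n)) + n \<cdot> (jZ \<cdot> (qZ \<cdot> n))"
      by (rule Comp_add_right[OF Comp_in_Hom[OF tp(1) bZ(1)] Comp_in_Hom[OF tp(2) bZ(3)] n])
    also have "n \<cdot> (iZ \<cdot> (pZ \<cdot> n)) = 0"
      using Comp_assoc[OF tp(1) bZ(1) n] Comp_assoc[OF tp(1) t1(3) y1(1)] y1 1 by simp
    also have "n \<cdot> (jZ \<cdot> (qZ \<cdot> n)) = 0"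
      using Comp_assoc[OF tp(2) bZ(3) n] Comp_assoc[OF tp(2) t2(3) y2(1)] y2 2 by simp
    finally show "(c \<cdot> d - ident C Z) \<cdot> (c \<cdot> d - ident C Z) = 0" by (simp add: n_def)
  qed
  ultimately have "is_iso C Q Z c" using is_iso_of_Comps[OF c(1) d(1)] by blast
  then have "tri C X Y Z F G H"
    using tri_iso[OF T is_iso_ident is_iso_ident _ F(1) G(1) H(1)] F(1) G(1) t cg Hc
    by (simp add: Comp_ident_left Comp_ident_right shM_ident)
  then show ?thesis by blast
qed

end

section \<open>Krull-Schmidt decompositions\<close>

context linear_category
begin

lemma local_End_Hom_cases:
  assumes "local_End C B" "f \<in> Hom C B B" "g \<in> Hom C B B" "is_iso C B B (f + g)"
  shows "is_iso C B B f \<or> is_iso C B B g"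
  using assms unfolding local_End_def by blast

lemma local_End_isomorphic:
  assumes "local_End C A" "isomorphic C A A'"
  shows "local_End C A'"
proof -
  obtain u v where u: "u \<in> Hom C A A'" "v \<in> Hom C A' A" "is_iso C A A' u" "is_iso C A' A v"
    using assms(2) unfolding isomorphic_def is_iso_def by blast
  have iff: "is_iso C A A (v \<cdot> (f \<cdot> u)) \<longleftrightarrow> is_iso C A' A' f" if "f \<in> Hom C A' A'" for f
    using is_iso_Comp[OF is_iso_Comp[OF u(3)] u(4)] is_iso_cancel_right[OF that u(3)] 
      is_iso_cancel_left[OF Comp_in_Hom[OF u(1) that] u(4)] by blast
  show ?thesis
    unfolding local_End_def
  proof (intro conjI ballI impI notI)
    show False if "zero_object C A'"
      using assms zero_object_isomorphic[OF isomorphic_sym that] unfolding local_End_def by blast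
  next
    fix f g assume f: "f \<in> Hom C A' A'" and g: "g \<in> Hom C A' A'"
      and n: "\<not> is_iso C A' A' f" "\<not> is_iso C A' A' g" "is_iso C A' A' (f + g)"
    have "v \<cdot> ((f + g) \<cdot> u) = v \<cdot> (f \<cdot> u) + v \<cdot> (g \<cdot> u)"
      using Comp_add_left[OF u(1) f g] Comp_add_right[OF Comp_in_Hom[OF u(1) f] Comp_in_Hom[OF u(1) g] u(2)] by simp
    then show False
      using local_End_Hom_cases[OF assms(1) Comp_in_Hom[OF Comp_in_Hom[OF u(1) f] u(2)] Comp_in_Hom[OF Comp_in_Hom[OF u(1) g] u(2)]]
        iff[OF f] iff[OF g] iff[OF add_in_Hom[OF f g]] n by simp
  qed
qed

text \<open>\<open>t s\<close> is idempotent, so by locality it or \<open>1 - t s\<close> is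
  invertible. An invertible idempotent is the identity; in the other case
  \<open>(1 - t s) t = 0\<close> forces \<open>t = 0\<close>.\<close>

lemma local_End_retract_iso:
  assumes "local_End C N" "t \<in> Hom C B N" "s \<in> Hom C N B" "s \<cdot> t = ident C B" "\<not> zero_object C B"
  shows "is_iso C B N t"
proof -
  define e where "e = t \<cdot> s"
  have e: "e \<in> Hom C N N" unfolding e_def using assms by (auto intro: Comp_in_Hom)
  have et: "e \<cdot> t = t" using Comp_assoc[OF assms(2,3,2)] assms(4) Comp_ident_right[OF assms(2)] by (simp add: e_def)
  have ee: "e \<cdot> e = e" using Comp_assoc[OF assms(3,2) e] et by (simp add: e_def)
  have "is_iso C N N (e + (ident C N - e))" using is_iso_ident by simp
  then consider "is_iso C N N e" | "is_iso C N N (ident C N - e)"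
    using local_End_Hom_cases[OF assms(1) e diff_in_Hom[OF ident_in_Hom e]] by blast
  then show ?thesis
  proof cases
    case 1
    then obtain w where "w \<in> Hom C N N" "w \<cdot> e = ident C N" by (rule is_isoE)
    then have "e = ident C N" using Comp_assoc[OF e e, of w N] ee Comp_ident_left[OF e] by simp
    then show ?thesis using assms is_isoI[of t B N s] by (simp add: e_def)
  next
    case 2
    then obtain w where w: "w \<in> Hom C N N" "w \<cdot> (ident C N - e) = ident C N" by (rule is_isoE)
    have "(ident C N - e) \<cdot> t = 0"
      using Comp_diff_left[OF assms(2) ident_in_Hom e] et Comp_ident_left[OF assms(2)] by simp
    then have "t = 0" using Comp_assoc[OF assms(2) diff_in_Hom[OF ident_in_Hom e] w(1)] w
      Comp_ident_left[OF assms(2)] by simp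
    then show ?thesis using assms unfolding zero_object_def by simp
  qed
qed

lemma retraction_of_iso:
  assumes "a \<in> Hom C B X" "b \<in> Hom C X B" "is_iso C B B (b \<cdot> a)"
  obtains a' b' w where "w \<in> Hom C B B" "a' = a \<cdot> w" "b' = w \<cdot> b" "a' \<in> Hom C B X" "b' \<in> Hom C X B"
    "b \<cdot> a' = ident C B" "b' \<cdot> a = ident C B"
proof -
  obtain w where w: "w \<in> Hom C B B" "w \<cdot> (b \<cdot> a) = ident C B" "(b \<cdot> a) \<cdot> w = ident C B"
    using assms(3) by (rule is_isoE)
  show ?thesis
    by (rule that[of w "a \<cdot> w" "w \<cdot> b"]) (use w assms Comp_assoc[OF w(1) assms(1,2)] Comp_assoc[OF assms(1,2) w(1)] in
        \<open>auto intro: Comp_in_Hom\<close>)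
qed

lemma direct_sum_member_retract:
  assumes "is_direct_sum C X Xs" "Z \<in> set Xs"
  shows "\<exists>i \<in> Hom C Z X. \<exists>p \<in> Hom C X Z. p \<cdot> i = ident C Z"
proof -
  obtain k where k: "k < length Xs" "Z = Xs ! k" using assms(2) by (metis in_set_conv_nth)
  then show ?thesis using assms(1) unfolding is_direct_sum_def by fastforce
qed

end

section \<open>The exchange property, uniqueness of decompositions, and radical
  endomorphisms\<close>

context triangulated_category
begin

lemma summand_iff_retract: "summand C A X \<longleftrightarrow> (\<exists>i \<in> Hom C A X. \<exists>p \<in> Hom C X A. p \<cdot> i = ident C A)"
  unfolding summand_iff using biproductD split_mono_complement by metis

lemma local_End_biproduct_cases:
  assumes B: "local_End C B" and X: "biproduct X Z R i p j q"
    and s: "s \<in> Hom C B X" "t \<in> Hom C X B" "is_iso C B B (t \<cdot> s)"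
  shows "is_iso C B B ((t \<cdot> i) \<cdot> (p \<cdot> s)) \<or> is_iso C B B ((t \<cdot> j) \<cdot> (q \<cdot> s))"
proof -
  note b = biproductD[OF X]
  note ts = Comp_in_Hom[OF s(1) b(2)] Comp_in_Hom[OF s(1) b(4)] Comp_in_Hom[OF b(1) s(2)] Comp_in_Hom[OF b(3) s(2)]
  have "t \<cdot> s = t \<cdot> (i \<cdot> (p \<cdot> s) + j \<cdot> (q \<cdot> s))" using biproduct_elements(5)[OF X s(1)] by simp
  also have "\<dots> = t \<cdot> (i \<cdot> (p \<cdot> s)) + t \<cdot> (j \<cdot> (q \<cdot> s))"
    by (rule Comp_add_right[OF Comp_in_Hom[OF ts(1) b(1)] Comp_in_Hom[OF ts(2) b(3)] s(2)])
  also have "\<dots> = (t \<cdot> i) \<cdot> (p \<cdot> s) + (t \<cdot> j) \<cdot> (q \<cdot> s)"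
    using Comp_assoc[OF ts(1) b(1) s(2)] Comp_assoc[OF ts(2) b(3) s(2)] by simp
  finally show ?thesis
    using local_End_Hom_cases[OF B Comp_in_Hom[OF ts(1,3)] Comp_in_Hom[OF ts(2,4)]] s(3) by simp
qed

text \<open>The identity of \<open>B\<close> is the sum of its parts through \<open>Z\<close> and
  through the rest \<open>R\<close>, and locality makes one of them invertible. If it is the part
  through \<open>Z\<close>, then \<open>B\<close> is isomorphic to \<open>Z\<close>, and
  cancellation identifies the complements. Otherwise \<open>B\<close> splits off \<open>R\<close>,
  with a projection corrected by \<open>w\<close>; the induction runs in \<open>R\<close>, and
  \<open>Z\<close> is added back.\<close>

lemma exchange:
  assumes "local_End C B" "biproduct X B Y i p j q" "is_direct_sum C X Zs" "\<forall>Z \<in> set Zs. local_End C Z"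
  shows "\<exists>Zs1 Z Zs2. Zs = Zs1 @ Z # Zs2 \<and> isomorphic C B Z \<and> is_direct_sum C Y (Zs1 @ Zs2)"
  using assms(2-4)
proof (induction Zs arbitrary: X Y i p j q)
  case Nil
  then have "zero_object C X" using is_direct_sum_Nil by blast
  then have "i = 0" using zero_object_Hom_to biproductD(1)[OF Nil.prems(1)] by blast
  then have "zero_object C B" unfolding zero_object_def using biproductD(2,5)[OF Nil.prems(1)] by simp
  then show ?case using assms(1) unfolding local_End_def by blast
next
  case (Cons Z Zs)
  obtain R iz pz jr qr where X: "biproduct X Z R iz pz jr qr" and R: "is_direct_sum C R Zs"
    using Cons.prems(2) unfolding is_direct_sum_Cons by blast
  note Y = Cons.prems(1)
  note b = biproductD[OF Y] and c = biproductD[OF X]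
  have ti: "pz \<cdot> i \<in> Hom C B Z" "qr \<cdot> i \<in> Hom C B R" "p \<cdot> iz \<in> Hom C Z B" "p \<cdot> jr \<in> Hom C R B"
    using b c by (auto intro: Comp_in_Hom)
  consider "is_iso C B B ((p \<cdot> iz) \<cdot> (pz \<cdot> i))" | "is_iso C B B ((p \<cdot> jr) \<cdot> (qr \<cdot> i))"
    using local_End_biproduct_cases[OF assms(1) X b(1,2)] b(5) is_iso_ident by auto
  then show ?case
  proof cases
    case 1
    obtain b' where "b' \<in> Hom C Z B" "b' \<cdot> (pz \<cdot> i) = ident C B"
      using retraction_of_iso[OF ti(1,3) 1] by blast
    then have iso: "is_iso C B Z (pz \<cdot> i)"
      using local_End_retract_iso[OF _ ti(1)] Cons.prems(3) assms(1) unfolding local_End_def by fastforce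
    then have "is_direct_sum C Y Zs"
      using is_direct_sum_isomorphic[OF R] biproduct_cancel[OF Y X] isomorphic_sym by blast
    then show ?thesis using iso by (intro exI[of _ "[]"] exI[of _ Z] exI[of _ Zs]) (auto simp: isomorphic_def)
  next
    case 2
    obtain w where w: "w \<in> Hom C B B" "(w \<cdot> (p \<cdot> jr)) \<cdot> (qr \<cdot> i) = ident C B" 
      using retraction_of_iso[OF ti(2,4) 2] by metis
    obtain R1 j' q' where R1: "biproduct R B R1 (qr \<cdot> i) (w \<cdot> (p \<cdot> jr)) j' q'"
      using split_mono_complement[OF ti(2) Comp_in_Hom[OF ti(4) w(1)] w(2)] .
    obtain Zs1 Z' Zs2 where Zs: "Zs = Zs1 @ Z' # Zs2" "isomorphic C B Z'" "is_direct_sum C R1 (Zs1 @ Zs2)"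
      using Cons.IH[OF R1 R] Cons.prems(3) by auto
    obtain R' v v' where R': "biproduct X B R' (jr \<cdot> (qr \<cdot> i)) (w \<cdot> (p \<cdot> jr) \<cdot> qr) v v'"
      "\<exists>i p j q. biproduct R' Z R1 i p j q" using biproduct_assoc[OF X R1] .
    have "w \<cdot> (p \<cdot> jr) \<cdot> qr \<cdot> i = ident C B"
      using Comp_assoc[OF b(1) c(4) Comp_in_Hom[OF ti(4) w(1)]] w(2) by simp
    then have "isomorphic C Y R'"
      using biproduct_cancel[OF Y R'(1)] is_iso_ident by simp
    moreover have "is_direct_sum C R' (Z # Zs1 @ Zs2)" using R'(2) Zs(3) is_direct_sum_Cons by blast
    ultimately have "is_direct_sum C Y (Z # Zs1 @ Zs2)" using is_direct_sum_isomorphic isomorphic_sym by blast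
    then show ?thesis using Zs by (intro exI[of _ "Z # Zs1"] exI[of _ Z'] exI[of _ Zs2]) auto
  qed
qed

text \<open>Krull-Schmidt uniqueness in the form that makes \<open>multiplicity_in\<close> well
  defined: \<open>exchange\<close> strikes out one pair of isomorphic members of the two lists at a
  time.\<close>

lemma direct_sum_count_unique:
  assumes "is_direct_sum C X Ys" "is_direct_sum C X Zs" "\<forall>Y \<in> set Ys. local_End C Y" "\<forall>Z \<in> set Zs. local_End C Z"
  shows "length (filter (isomorphic C B) Ys) = length (filter (isomorphic C B) Zs)"
  using assms
proof (induction Ys arbitrary: X Zs)
  case Nil
  have "zero_object C X" using Nil.prems(1) is_direct_sum_Nil by blast
  then have "zero_object C Z" if Z: "Z \<in> set Zs" for Z
  proof -
    obtain i p where "i \<in> Hom C Z X" "p \<in> Hom C X Z" "p \<cdot> i = ident C Z"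
      using direct_sum_member_retract[OF Nil.prems(2) Z] by blast
    then show ?thesis using zero_object_Hom_to[OF \<open>zero_object C X\<close>, of i Z] unfolding zero_object_def by simp
  qed
  then have "Zs = []" using Nil.prems(4) unfolding local_End_def by (cases Zs) auto
  then show ?case by simp
next
  case (Cons A Ys)
  obtain Y i p j q where Y: "biproduct X A Y i p j q" "is_direct_sum C Y Ys"
    using Cons.prems(1) unfolding is_direct_sum_Cons by blast
  obtain Zs1 Z Zs2 where Z: "Zs = Zs1 @ Z # Zs2" "isomorphic C A Z" "is_direct_sum C Y (Zs1 @ Zs2)"
    using exchange[OF _ Y(1) Cons.prems(2,4)] Cons.prems(3) by auto
  have "isomorphic C B A \<longleftrightarrow> isomorphic C B Z" using Z(2) isomorphic_trans isomorphic_sym by blast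
  then show ?case using Cons.IH[OF Y(2) Z(3)] Cons.prems(3,4) Z(1) by auto
qed

text \<open>Block elimination: once \<open>\<alpha>\<close> inverts the \<open>A\<close>-block
  \<open>1 - P\<close>, the complement \<open>1 - (S + R \<alpha> Q)\<close> decides. The fixed
  point equations \<open>\<psi> x = x\<close> and \<open>x \<psi> = x\<close> are solved block by
  block and have only the zero solution, so \<open>1 - \<psi>\<close> is mono and epi.\<close>

lemma is_iso_of_Schur_complement:
  assumes X: "biproduct X A Y i p j q" and psi: "\<psi> \<in> Hom C X X"
    and \<alpha>: "\<alpha> \<in> Hom C A A" "\<alpha> \<cdot> (ident C A - p \<cdot> (\<psi> \<cdot> i)) = ident C A" "(ident C A - p \<cdot> (\<psi> \<cdot> i)) \<cdot> \<alpha> = ident C A"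
    and Schur: "is_iso C Y Y (ident C Y - (q \<cdot> (\<psi> \<cdot> j) + (q \<cdot> (\<psi> \<cdot> i)) \<cdot> (\<alpha> \<cdot> (p \<cdot> (\<psi> \<cdot> j)))))"
  shows "is_iso C X X (ident C X - \<psi>)"
proof -
  note b = biproductD[OF X]
  define P where "P = p \<cdot> (\<psi> \<cdot> i)"
  define Q where "Q = p \<cdot> (\<psi> \<cdot> j)"
  define R where "R = q \<cdot> (\<psi> \<cdot> i)"
  define S where "S = q \<cdot> (\<psi> \<cdot> j)"
  have tm: "P \<in> Hom C A A" "Q \<in> Hom C Y A" "R \<in> Hom C A Y" "S \<in> Hom C Y Y" "\<psi> \<cdot> i \<in> Hom C A X" "\<psi> \<cdot> j \<in> Hom C Y X"
    unfolding P_def Q_def R_def S_def using b psi by (auto intro: Comp_in_Hom)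
  note \<alpha>' = \<alpha>[folded P_def]
  obtain \<sigma> where \<sigma>: "\<sigma> \<in> Hom C Y Y" "\<sigma> \<cdot> (ident C Y - (S + R \<cdot> (\<alpha> \<cdot> Q))) = ident C Y"
    "(ident C Y - (S + R \<cdot> (\<alpha> \<cdot> Q))) \<cdot> \<sigma> = ident C Y"
    using Schur unfolding S_def R_def Q_def by (rule is_isoE)
  have tS: "S + R \<cdot> (\<alpha> \<cdot> Q) \<in> Hom C Y Y" "R \<cdot> (\<alpha> \<cdot> Q) \<in> Hom C Y Y" "\<alpha> \<cdot> Q \<in> Hom C Y A" "R \<cdot> \<alpha> \<in> Hom C A Y"
    using tm \<alpha>(1) by (auto intro: Comp_in_Hom add_in_Hom)
  show ?thesis
  proof (rule is_iso_of_mono_epi)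
    show "ident C X - \<psi> \<in> Hom C X X" using psi by (auto intro: Hom_intros)
  next
    fix W x assume x: "x \<in> Hom C W X" and "(ident C X - \<psi>) \<cdot> x = 0"
    then have fx: "\<psi> \<cdot> x = x" using Comp_diff_left[OF x ident_in_Hom psi] Comp_ident_left[OF x] by simp
    define a where "a = p \<cdot> x"
    define y where "y = q \<cdot> x"
    have t: "a \<in> Hom C W A" "y \<in> Hom C W Y" unfolding a_def y_def using b x by (auto intro: Comp_in_Hom)
    have xe: "x = i \<cdot> a + j \<cdot> y" using biproduct_elements(5)[OF X x] by (simp add: a_def y_def)
    have "\<psi> \<cdot> x = (\<psi> \<cdot> i) \<cdot> a + (\<psi> \<cdot> j) \<cdot> y"
      unfolding xe using Comp_add_right[OF Comp_in_Hom[OF t(1) b(1)] Comp_in_Hom[OF t(2) b(3)] psi]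
        Comp_assoc[OF t(1) b(1) psi] Comp_assoc[OF t(2) b(3) psi] by simp
    then have x2: "x = (\<psi> \<cdot> i) \<cdot> a + (\<psi> \<cdot> j) \<cdot> y" using fx by simp
    have ta: "(\<psi> \<cdot> i) \<cdot> a \<in> Hom C W X" "(\<psi> \<cdot> j) \<cdot> y \<in> Hom C W X" using tm t by (auto intro: Comp_in_Hom)
    have ae: "a = P \<cdot> a + Q \<cdot> y"
      using arg_cong[OF x2, of "\<lambda>x. p \<cdot> x"] Comp_add_right[OF ta b(2)] Comp_assoc[OF t(1) tm(5) b(2)]
        Comp_assoc[OF t(2) tm(6) b(2)] by (simp add: a_def P_def Q_def)
    have ye: "y = R \<cdot> a + S \<cdot> y"
      using arg_cong[OF x2, of "\<lambda>x. q \<cdot> x"] Comp_add_right[OF ta b(4)] Comp_assoc[OF t(1) tm(5) b(4)]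
        Comp_assoc[OF t(2) tm(6) b(4)] by (simp add: y_def R_def S_def)
    have "(ident C A - P) \<cdot> a = Q \<cdot> y"
      using ae Comp_diff_left[OF t(1) ident_in_Hom tm(1)] Comp_ident_left[OF t(1)] by (metis add_diff_cancel_left')
    then have a2: "a = \<alpha> \<cdot> (Q \<cdot> y)"
      using Comp_assoc[OF t(1) diff_in_Hom[OF ident_in_Hom tm(1)] \<alpha>(1)] \<alpha>'(2) Comp_ident_left[OF t(1)] by simp
    have "R \<cdot> a = (R \<cdot> (\<alpha> \<cdot> Q)) \<cdot> y"
      using a2 Comp_assoc[OF t(2) tm(2) \<alpha>(1)] Comp_assoc[OF t(2) tS(3) tm(3)] by simp
    then have "(S + R \<cdot> (\<alpha> \<cdot> Q)) \<cdot> y = y"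
      using ye Comp_add_left[OF t(2) tm(4) tS(2)] by (metis add.commute)
    then have "(ident C Y - (S + R \<cdot> (\<alpha> \<cdot> Q))) \<cdot> y = 0"
      using Comp_diff_left[OF t(2) ident_in_Hom tS(1)] Comp_ident_left[OF t(2)] by simp
    then have y0: "y = 0"
      using Comp_assoc[OF t(2) diff_in_Hom[OF ident_in_Hom tS(1)] \<sigma>(1)] \<sigma> Comp_ident_left[OF t(2)] by simp
    then have "a = 0" using a2 tm \<alpha>(1) by simp
    then show "x = 0" using xe y0 b by simp
  next
    fix W x assume x: "x \<in> Hom C X W" and "x \<cdot> (ident C X - \<psi>) = 0"
    then have fx: "x \<cdot> \<psi> = x" using Comp_diff_right[OF ident_in_Hom psi x] Comp_ident_right[OF x] by simp
    define a where "a = x \<cdot> i"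
    define y where "y = x \<cdot> j"
    have t: "a \<in> Hom C A W" "y \<in> Hom C Y W" unfolding a_def y_def using b x by (auto intro: Comp_in_Hom)
    have xe: "x = a \<cdot> p + y \<cdot> q" using biproduct_elements(6)[OF X x] by (simp add: a_def y_def)
    have e: "x \<cdot> v = a \<cdot> (p \<cdot> v) + y \<cdot> (q \<cdot> v)" if "v \<in> Hom C V X" for v V
      using xe Comp_add_left[OF that Comp_in_Hom[OF b(2) t(1)] Comp_in_Hom[OF b(4) t(2)]]
        Comp_assoc[OF that b(2) t(1)] Comp_assoc[OF that b(4) t(2)] by simp
    have ae: "a = a \<cdot> P + y \<cdot> R"
      using e[OF tm(5)] Comp_assoc[OF b(1) psi x] fx by (simp add: a_def P_def R_def)
    have ye: "y = a \<cdot> Q + y \<cdot> S"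
      using e[OF tm(6)] Comp_assoc[OF b(3) psi x] fx by (simp add: y_def Q_def S_def)
    have "a \<cdot> (ident C A - P) = y \<cdot> R"
      using ae Comp_diff_right[OF ident_in_Hom tm(1) t(1)] Comp_ident_right[OF t(1)] by (metis add_diff_cancel_left')
    then have a2: "a = y \<cdot> R \<cdot> \<alpha>"
      using Comp_assoc[OF \<alpha>(1) diff_in_Hom[OF ident_in_Hom tm(1)] t(1)] \<alpha>'(3) Comp_ident_right[OF t(1)] by simp
    have "a \<cdot> Q = y \<cdot> (R \<cdot> (\<alpha> \<cdot> Q))"
      using a2 Comp_assoc[OF tm(2) \<alpha>(1) Comp_in_Hom[OF tm(3) t(2)]] Comp_assoc[OF tS(3) tm(3) t(2)] by simp
    then have "y \<cdot> (S + R \<cdot> (\<alpha> \<cdot> Q)) = y"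
      using ye Comp_add_right[OF tm(4) tS(2) t(2)] by (metis add.commute)
    then have "y \<cdot> (ident C Y - (S + R \<cdot> (\<alpha> \<cdot> Q))) = 0"
      using Comp_diff_right[OF ident_in_Hom tS(1) t(2)] Comp_ident_right[OF t(2)] by simp
    then have y0: "y = 0"
      using Comp_assoc[OF \<sigma>(1) diff_in_Hom[OF ident_in_Hom tS(1)] t(2)] \<sigma> Comp_ident_right[OF t(2)] by simp
    then have "a = 0" using a2 tm \<alpha>(1) by simp
    then show "x = 0" using xe y0 b by simp
  qed
qed

text \<open>Shows that \<open>\<psi>\<close> lies outside the radical if \<open>1 - \<psi>\<close>
  is not invertible. One summand \<open>A\<close> is eliminated at a time: either the
  \<open>A\<close>-block \<open>P\<close> of \<open>\<psi>\<close> is invertible and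
  \<open>B = A\<close> works, or locality inverts \<open>1 - P\<close> and the failure passes to the
  Schur complement on the rest. There \<open>\<psi>\<close> is replaced by a sum of two terms, and
  locality of \<open>B\<close> selects one of them.\<close>

lemma non_iso_retract_direct_sum:
  assumes "is_direct_sum C X Xs" "\<forall>Y \<in> set Xs. local_End C Y" "\<psi> \<in> Hom C X X" "\<not> is_iso C X X (ident C X - \<psi>)"
  shows "\<exists>B. local_End C B \<and> (\<exists>a \<in> Hom C B X. \<exists>b \<in> Hom C X B. is_iso C B B (b \<cdot> (\<psi> \<cdot> a)))"
  using assms
proof (induction Xs arbitrary: X \<psi>)
  case Nil
  then have z: "zero_object C X" using is_direct_sum_Nil by blast
  then have "ident C X - \<psi> = ident C X"
    using zero_object_Hom_to[OF z, of \<psi> X] Nil.prems by simp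
  then show ?case using Nil.prems is_iso_ident by simp
next
  case (Cons A Xs)
  note psi = Cons.prems(3)
  have A: "local_End C A" using Cons.prems by simp
  obtain Y i p j q where X: "biproduct X A Y i p j q" and Y: "is_direct_sum C Y Xs"
    using Cons.prems(1) unfolding is_direct_sum_Cons by blast
  note b = biproductD[OF X]
  define P where "P = p \<cdot> (\<psi> \<cdot> i)"
  define Q where "Q = p \<cdot> (\<psi> \<cdot> j)"
  define R where "R = q \<cdot> (\<psi> \<cdot> i)"
  define S where "S = q \<cdot> (\<psi> \<cdot> j)"
  have tm: "P \<in> Hom C A A" "Q \<in> Hom C Y A" "R \<in> Hom C A Y" "S \<in> Hom C Y Y" "\<psi> \<cdot> i \<in> Hom C A X" "\<psi> \<cdot> j \<in> Hom C Y X"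
    unfolding P_def Q_def R_def S_def using b psi by (auto intro: Comp_in_Hom)
  show ?case
  proof (cases "is_iso C A A P")
    case True
    then show ?thesis unfolding P_def using A b by blast
  next
    case False
    have "is_iso C A A (P + (ident C A - P))" using is_iso_ident by simp
    then have "is_iso C A A (ident C A - P)"
      using local_End_Hom_cases[OF A tm(1) diff_in_Hom[OF ident_in_Hom tm(1)]] False by blast
    then obtain \<alpha> where \<alpha>: "\<alpha> \<in> Hom C A A" "\<alpha> \<cdot> (ident C A - P) = ident C A" "(ident C A - P) \<cdot> \<alpha> = ident C A"
      by (rule is_isoE)
    have tS: "S + R \<cdot> (\<alpha> \<cdot> Q) \<in> Hom C Y Y" "R \<cdot> (\<alpha> \<cdot> Q) \<in> Hom C Y Y" "\<alpha> \<cdot> Q \<in> Hom C Y A"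
      using tm \<alpha>(1) by (auto intro: Comp_in_Hom add_in_Hom)
    have "\<not> is_iso C Y Y (ident C Y - (S + R \<cdot> (\<alpha> \<cdot> Q)))"
      using is_iso_of_Schur_complement[OF X psi, of \<alpha>] \<alpha> Cons.prems(4) unfolding P_def Q_def R_def S_def by blast
    then obtain B x y where B: "local_End C B" and t: "x \<in> Hom C B Y" "y \<in> Hom C Y B"
      and iso: "is_iso C B B (y \<cdot> ((S + R \<cdot> (\<alpha> \<cdot> Q)) \<cdot> x))"
      using Cons.IH[OF Y _ tS(1)] Cons.prems(2) by auto
    have tx: "S \<cdot> x \<in> Hom C B Y" "(R \<cdot> (\<alpha> \<cdot> Q)) \<cdot> x \<in> Hom C B Y" "j \<cdot> x \<in> Hom C B X" "y \<cdot> q \<in> Hom C X B"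
      "(\<alpha> \<cdot> Q) \<cdot> x \<in> Hom C B A" "i \<cdot> ((\<alpha> \<cdot> Q) \<cdot> x) \<in> Hom C B X"
      using tm tS t b by (auto intro: Comp_in_Hom)
    have "y \<cdot> ((S + R \<cdot> (\<alpha> \<cdot> Q)) \<cdot> x) = y \<cdot> (S \<cdot> x) + y \<cdot> ((R \<cdot> (\<alpha> \<cdot> Q)) \<cdot> x)"
      using Comp_add_left[OF t(1) tm(4) tS(2)] Comp_add_right[OF tx(1,2) t(2)] by simp
    then consider "is_iso C B B (y \<cdot> (S \<cdot> x))" | "is_iso C B B (y \<cdot> ((R \<cdot> (\<alpha> \<cdot> Q)) \<cdot> x))"
      using local_End_Hom_cases[OF B Comp_in_Hom[OF tx(1) t(2)] Comp_in_Hom[OF tx(2) t(2)]] iso by auto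
    then show ?thesis
    proof cases
      case 1
      have "y \<cdot> (S \<cdot> x) = (y \<cdot> q) \<cdot> (\<psi> \<cdot> (j \<cdot> x))"
        using Comp_assoc[OF t(1) tm(6) b(4)] Comp_assoc[OF t(1) b(3) psi] Comp_assoc[OF Comp_in_Hom[OF tx(3) psi] b(4) t(2)]
        by (simp add: S_def)
      then show ?thesis using 1 B tx by metis
    next
      case 2
      have "y \<cdot> ((R \<cdot> (\<alpha> \<cdot> Q)) \<cdot> x) = (y \<cdot> q) \<cdot> (\<psi> \<cdot> (i \<cdot> ((\<alpha> \<cdot> Q) \<cdot> x)))"
        using Comp_assoc[OF t(1) tS(3) tm(3)] Comp_assoc[OF tx(5) tm(5) b(4)] Comp_assoc[OF tx(5) b(1) psi]
          Comp_assoc[OF Comp_in_Hom[OF tx(6) psi] b(4) t(2)] by (simp add: R_def)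
      then show ?thesis using 2 B tx by metis
    qed
  qed
qed

lemma is_direct_sum_map:
  assumes "is_direct_sum C X Xs" "\<And>Z. Z \<in> set Xs \<Longrightarrow> isomorphic C Z (h Z)"
  shows "is_direct_sum C X (map h Xs)"
  using assms
proof (induction Xs arbitrary: X)
  case Nil
  then show ?case by simp
next
  case (Cons A Xs)
  then obtain Y i p j q where X: "biproduct X A Y i p j q" and Y: "is_direct_sum C Y Xs"
    unfolding is_direct_sum_Cons by blast
  have "\<exists>i p j q. biproduct X (h A) Y i p j q" using biproduct_isomorphic_left[OF X] Cons.prems(2) by simp
  moreover have "is_direct_sum C Y (map h Xs)" using Cons.IH[OF Y] Cons.prems(2) by simp
  ultimately show ?case unfolding list.map is_direct_sum_Cons by blast
qed

end

section \<open>Multiplicities of indecomposable summands\<close>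

locale krull_schmidt_triangulated = triangulated_category C
  for C :: "('k::field, 'o, 'm::ab_group_add) tricat" (structure) +
  assumes KS: "Krull_Schmidt C"
begin

lemma KS_decomposition:
  obtains Xs where "is_direct_sum C X Xs" "\<forall>Y \<in> set Xs. local_End C Y"
  using KS unfolding Krull_Schmidt_def by blast

text \<open>In a decomposition of an indecomposable object everything beyond the first member
  vanishes. Conversely a nonzero summand of an object with local endomorphism ring is the whole
  object.\<close>

lemma indecomposable_iff_local_End: "indecomposable C X \<longleftrightarrow> local_End C X"
proof
  assume ind: "indecomposable C X"
  obtain Xs where Xs: "is_direct_sum C X Xs" "\<forall>Y \<in> set Xs. local_End C Y" by (rule KS_decomposition)
  have "Xs \<noteq> []" using Xs(1) ind is_direct_sum_Nil unfolding indecomposable_def by blast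
  then obtain A As where A: "Xs = A # As" by (cases Xs) auto
  then obtain Y i p j q where X: "biproduct X A Y i p j q"
    using Xs(1) unfolding A is_direct_sum_Cons by blast
  then have "is_direct_sum C X [A, Y]" using is_direct_sum_biproduct by blast
  then have "zero_object C Y" using ind Xs(2) A unfolding indecomposable_def local_End_def by auto
  then show "local_End C X"
    using zero_object_summand(1)[OF _ biproduct_commute[OF X]] local_End_isomorphic Xs(2) A by auto
next
  assume loc: "local_End C X"
  show "indecomposable C X"
    unfolding indecomposable_def
  proof (intro conjI allI impI)
    show "\<not> zero_object C X" using loc unfolding local_End_def by blast
    fix Y Z assume "is_direct_sum C X [Y, Z]"
    then obtain i p j q where X: "biproduct X Y Z i p j q" using is_direct_sum_biproduct by blast
    note b = biproductD[OF X]
    have "zero_object C Z" if nz: "\<not> zero_object C Y"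
    proof -
      obtain w where "w \<in> Hom C X Y" "w \<cdot> i = ident C Y" "i \<cdot> w = ident C X"
        using local_End_retract_iso[OF loc b(1,2,5) nz] by (rule is_isoE)
      then have "q = 0" using Comp_assoc[of w X Y i X q Z] b Comp_ident_right[OF b(4)] by simp
      then show ?thesis unfolding zero_object_def using b by simp
    qed
    then show "zero_object C Y \<or> zero_object C Z" by blast
  qed
qed

lemma non_iso_retract:
  assumes "\<psi> \<in> Hom C X X" "\<not> is_iso C X X (ident C X - \<psi>)"
  obtains B a b where "local_End C B" "a \<in> Hom C B X" "b \<in> Hom C X B" "b \<cdot> (\<psi> \<cdot> a) = ident C B"
proof -
  obtain Xs where "is_direct_sum C X Xs" "\<forall>Y \<in> set Xs. local_End C Y" by (rule KS_decomposition)
  then obtain B a b where B: "local_End C B" "a \<in> Hom C B X" "b \<in> Hom C X B" "is_iso C B B (b \<cdot> (\<psi> \<cdot> a))"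
    using non_iso_retract_direct_sum assms by blast
  then obtain b' where "b' \<in> Hom C X B" "b' \<cdot> (\<psi> \<cdot> a) = ident C B"
    using retraction_of_iso[OF Comp_in_Hom[OF B(2) assms(1)] B(3,4)] by blast
  then show ?thesis using that B by blast
qed

abbreviation mult :: "'o \<Rightarrow> 'o \<Rightarrow> nat" where "mult \<equiv> multiplicity_in C"

lemma mult_eq:
  assumes "is_direct_sum C Y Ys" "\<forall>Z \<in> set Ys. local_End C Z"
  shows "mult Y X = length (filter (isomorphic C X) Ys)"
  unfolding multiplicity_in_def indecomposable_iff_local_End
  by (rule the_equality) (use assms direct_sum_count_unique in blast)+

lemma mult_biproduct:
  assumes "biproduct X A B i p j q"
  shows "mult X L = mult A L + mult B L"
proof -
  obtain As where As: "is_direct_sum C A As" "\<forall>Y \<in> set As. local_End C Y" by (rule KS_decomposition)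
  obtain Bs where Bs: "is_direct_sum C B Bs" "\<forall>Y \<in> set Bs. local_End C Y" by (rule KS_decomposition)
  have "\<forall>Z \<in> set (As @ Bs). local_End C Z" using As(2) Bs(2) by auto
  then show ?thesis
    using mult_eq[OF is_direct_sum_append[OF As(1) Bs(1) assms]] mult_eq[OF As] mult_eq[OF Bs] by simp
qed

lemma mult_isomorphic:
  assumes "isomorphic C X X'"
  shows "mult X L = mult X' L"
proof -
  obtain Xs where Xs: "is_direct_sum C X Xs" "\<forall>Y \<in> set Xs. local_End C Y" by (rule KS_decomposition)
  show ?thesis using mult_eq[OF Xs] mult_eq[OF is_direct_sum_isomorphic[OF Xs(1) assms] Xs(2)] by simp
qed

lemma mult_isomorphic_right:
  assumes "isomorphic C L L'"
  shows "mult X L = mult X L'"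
proof -
  obtain Xs where Xs: "is_direct_sum C X Xs" "\<forall>Y \<in> set Xs. local_End C Y" by (rule KS_decomposition)
  have "isomorphic C L = isomorphic C L'" using assms isomorphic_trans isomorphic_sym by blast
  then show ?thesis using mult_eq[OF Xs] by simp
qed

lemma mult_zero_object: "zero_object C X \<Longrightarrow> mult X L = 0"
  using mult_eq[of X "[]"] is_direct_sum_Nil by simp

lemma is_direct_sum_single: "is_direct_sum C X [X]"
proof -
  obtain Z where "zero_object C Z" using ex_zero_object by blast
  then have "biproduct X X Z (ident C X) (ident C X) 0 0"
    unfolding biproduct_def zero_object_def by (auto simp: ident_in_Hom Comp_ident_left[OF ident_in_Hom])
  then show ?thesis unfolding is_direct_sum_Cons is_direct_sum_Nil using \<open>zero_object C Z\<close> by blast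
qed

lemma mult_local_End:
  assumes "local_End C B"
  shows "mult B L = (if isomorphic C L B then 1 else 0)"
  using mult_eq[OF is_direct_sum_single] assms by simp

lemma mult_pos_iff:
  assumes "local_End C L"
  shows "0 < mult X L \<longleftrightarrow> (\<exists>i \<in> Hom C L X. \<exists>p \<in> Hom C X L. p \<cdot> i = ident C L)"
proof
  assume pos: "0 < mult X L"
  obtain Xs where Xs: "is_direct_sum C X Xs" "\<forall>Y \<in> set Xs. local_End C Y" by (rule KS_decomposition)
  have "filter (isomorphic C L) Xs \<noteq> []" using mult_eq[OF Xs] pos by auto
  then obtain Z where Z: "Z \<in> set Xs" "isomorphic C L Z" by (auto simp: filter_empty_conv)
  obtain i p where ip: "i \<in> Hom C Z X" "p \<in> Hom C X Z" "p \<cdot> i = ident C Z"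
    using direct_sum_member_retract[OF Xs(1) Z(1)] by blast
  obtain Y j q where "biproduct X Z Y i p j q" using split_mono_complement[OF ip] by blast
  then obtain i' p' j' q' where "biproduct X L Y i' p' j' q'"
    using biproduct_isomorphic_left isomorphic_sym[OF Z(2)] by blast
  then show "\<exists>i \<in> Hom C L X. \<exists>p \<in> Hom C X L. p \<cdot> i = ident C L" unfolding biproduct_def by blast
next
  assume "\<exists>i \<in> Hom C L X. \<exists>p \<in> Hom C X L. p \<cdot> i = ident C L"
  then obtain Y i p j q where "biproduct X L Y i p j q" using split_mono_complement by metis
  then show "0 < mult X L" using mult_biproduct mult_local_End[OF assms] by fastforce
qed

lemma mult_pos_iff_summand: "local_End C L \<Longrightarrow> 0 < mult X L \<longleftrightarrow> summand C L X"
  using mult_pos_iff summand_iff_retract by simp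

lemma summand_refl: "summand C X X"
  unfolding summand_iff_retract using ident_in_Hom[of X] Comp_ident_left[OF ident_in_Hom] by blast

lemma direct_sum_in_add_of: "\<lbrakk>is_direct_sum C X Xs; set Xs \<subseteq> S\<rbrakk> \<Longrightarrow> X \<in> add_of C S"
  unfolding add_of_def using summand_refl by blast

lemma decomposition_of_mult:
  assumes "\<And>L. \<lbrakk>local_End C L; 0 < mult X L\<rbrakk> \<Longrightarrow> \<exists>B \<in> S. isomorphic C L B"
  obtains Xs where "is_direct_sum C X Xs" "set Xs \<subseteq> S"
proof -
  obtain Xs where Xs: "is_direct_sum C X Xs" "\<forall>Y \<in> set Xs. local_End C Y" by (rule KS_decomposition)
  have "\<exists>B \<in> S. isomorphic C Z B" if Z: "Z \<in> set Xs" for Z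
    using assms Xs(2) Z direct_sum_member_retract[OF Xs(1) Z] mult_pos_iff by blast
  then obtain h where h: "\<And>Z. Z \<in> set Xs \<Longrightarrow> h Z \<in> S \<and> isomorphic C Z (h Z)" by metis
  then have "is_direct_sum C X (map h Xs)" using is_direct_sum_map[OF Xs(1)] by blast
  then show ?thesis by (rule that) (use h in auto)
qed

text \<open>Turns membership in \<open>add S\<close> into a condition on multiplicities, so that
  sums, summands and isomorphic copies are handled by arithmetic.\<close>

lemma add_of_iff_mult:
  assumes "\<forall>B \<in> S. local_End C B"
  shows "X \<in> add_of C S \<longleftrightarrow> (\<forall>L. local_End C L \<longrightarrow> 0 < mult X L \<longrightarrow> (\<exists>B \<in> S. isomorphic C L B))"
proof
  assume "X \<in> add_of C S"
  then obtain Y Ys where Y: "set Ys \<subseteq> S" "is_direct_sum C Y Ys" "summand C X Y" unfolding add_of_def by blast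
  have loc: "\<forall>Y \<in> set Ys. local_End C Y" using Y(1) assms by blast
  obtain Z i p j q where Z: "biproduct Y X Z i p j q" using Y(3) summand_iff by blast
  show "\<forall>L. local_End C L \<longrightarrow> 0 < mult X L \<longrightarrow> (\<exists>B \<in> S. isomorphic C L B)"
  proof (intro allI impI)
    fix L assume "0 < mult X L"
    then have "filter (isomorphic C L) Ys \<noteq> []"
      using mult_biproduct[OF Z, of L] mult_eq[OF Y(2) loc, of L] by force
    then show "\<exists>B \<in> S. isomorphic C L B" using Y(1) by (auto simp: filter_empty_conv)
  qed
next
  assume "\<forall>L. local_End C L \<longrightarrow> 0 < mult X L \<longrightarrow> (\<exists>B \<in> S. isomorphic C L B)"
  then show "X \<in> add_of C S" using decomposition_of_mult direct_sum_in_add_of by metis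
qed

lemma add_of_decomposition:
  assumes "\<forall>B \<in> S. local_End C B" "X \<in> add_of C S"
  obtains Xs where "is_direct_sum C X Xs" "set Xs \<subseteq> S"
  using decomposition_of_mult[of X S] assms add_of_iff_mult by metis

end

section \<open>Minimal approximations\<close>

context triangulated_category
begin

lemma shM_diff: "\<lbrakk>f \<in> Hom C X Y; g \<in> Hom C X Y\<rbrakk> \<Longrightarrow> shM C (f - g) = shM C f - shM C g"
  using shM_add[of f X Y "- g"] shM_minus[of g X Y] minus_in_Hom[of g X Y] by simp

text \<open>\<open>1 - s p\<close> does not change \<open>g\<close>, so it is invertible by
  minimality; but it kills \<open>s\<close>.\<close>

lemma right_minimal_kernel_summand:
  assumes g: "g \<in> Hom C U M" and min: "\<forall>\<phi> \<in> Hom C U U. g \<cdot> \<phi> = g \<longrightarrow> is_iso C U U \<phi>"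
    and s: "s \<in> Hom C B U" "p \<in> Hom C U B" "p \<cdot> s = ident C B" "g \<cdot> s = 0"
  shows "zero_object C B"
proof -
  note sp = Comp_in_Hom[OF s(2,1)]
  have 1: "g \<cdot> (ident C U - s \<cdot> p) = g"
    using Comp_diff_right[OF ident_in_Hom sp g] Comp_assoc[OF s(2,1) g] s g Comp_ident_right[OF g] by simp
  have 2: "(ident C U - s \<cdot> p) \<cdot> s = 0"
    using Comp_diff_left[OF s(1) ident_in_Hom sp] Comp_assoc[OF s(1,2,1)] s Comp_ident_left[OF s(1)]
      Comp_ident_right[OF s(1)] by simp
  obtain w where w: "w \<in> Hom C U U" "w \<cdot> (ident C U - s \<cdot> p) = ident C U"
    using min 1 diff_in_Hom[OF ident_in_Hom sp] unfolding is_iso_def by blast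
  have "s = 0"
    using Comp_assoc[OF s(1) diff_in_Hom[OF ident_in_Hom sp] w(1)] w 2 Comp_ident_left[OF s(1)] by simp
  then show ?thesis using s unfolding zero_object_def by simp
qed

lemma left_minimal_cokernel_summand:
  assumes f: "f \<in> Hom C M U" and min: "\<forall>\<phi> \<in> Hom C U U. \<phi> \<cdot> f = f \<longrightarrow> is_iso C U U \<phi>"
    and s: "s \<in> Hom C B U" "p \<in> Hom C U B" "p \<cdot> s = ident C B" "p \<cdot> f = 0"
  shows "zero_object C B"
proof -
  note sp = Comp_in_Hom[OF s(2,1)]
  have 1: "(ident C U - s \<cdot> p) \<cdot> f = f"
    using Comp_diff_left[OF f ident_in_Hom sp] Comp_assoc[OF f s(2,1)] s f Comp_ident_left[OF f] by simp
  have 2: "p \<cdot> (ident C U - s \<cdot> p) = 0"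
    using Comp_diff_right[OF ident_in_Hom sp s(2)] Comp_assoc[OF s(2,1,2)] s Comp_ident_left[OF s(2)]
      Comp_ident_right[OF s(2)] by simp
  obtain w where w: "w \<in> Hom C U U" "(ident C U - s \<cdot> p) \<cdot> w = ident C U"
    using min 1 diff_in_Hom[OF ident_in_Hom sp] unfolding is_iso_def by blast
  have "p = 0"
    using Comp_assoc[OF w(1) diff_in_Hom[OF ident_in_Hom sp] s(2)] w 2 Comp_ident_right[OF s(2)] by simp
  then show ?thesis using s unfolding zero_object_def by simp
qed

text \<open>Locality need only be tested on pairs \<open>\<theta>\<close>,
  \<open>1 - \<theta>\<close>: if \<open>w\<close> inverts \<open>f + g\<close>, then
  \<open>w g = 1 - w f\<close>.\<close>

lemma local_EndI:
  assumes "\<not> zero_object C N" "\<And>\<theta>. \<theta> \<in> Hom C N N \<Longrightarrow> is_iso C N N \<theta> \<or> is_iso C N N (ident C N - \<theta>)"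
  shows "local_End C N"
  unfolding local_End_def
proof (intro conjI ballI impI notI)
  fix f g assume f: "f \<in> Hom C N N" and g: "g \<in> Hom C N N"
    and n: "\<not> is_iso C N N f" "\<not> is_iso C N N g" "is_iso C N N (f + g)"
  obtain w where w: "w \<in> Hom C N N" "w \<cdot> (f + g) = ident C N" "is_iso C N N w"
    using n(3) by (rule is_isoE)
  have "w \<cdot> g = ident C N - w \<cdot> f" using Comp_add_right[OF f g w(1)] w(2) by (simp add: algebra_simps)
  then have "is_iso C N N (w \<cdot> f) \<or> is_iso C N N (w \<cdot> g)" using assms(2) Comp_in_Hom[OF f w(1)] by metis
  then show False using n is_iso_cancel_left[OF f w(3)] is_iso_cancel_left[OF g w(3)] by blast
qed (use assms in blast)

text \<open>
  An endomorphism \<open>\<theta>\<close> of \<open>N\<close> extends to an endomorphism \<open>(\<theta>, \<phi>, \<psi>)\<close> of the triangle, and minimality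
  of \<open>g\<close> makes \<open>\<theta>\<close> invertible whenever \<open>\<psi>\<close> is.
\<close>

lemma local_End_cocone:
  assumes T: "tri C N U M f g h" and M: "local_End C M" and N: "\<not> zero_object C N"
    and ext: "\<And>h. h \<in> Hom C N U \<Longrightarrow> \<exists>h' \<in> Hom C U U. h = h' \<cdot> f"
    and lift: "\<And>h. h \<in> Hom C U M \<Longrightarrow> \<exists>h' \<in> Hom C U U. h = g \<cdot> h'"
    and min: "\<forall>\<phi> \<in> Hom C U U. g \<cdot> \<phi> = g \<longrightarrow> is_iso C U U \<phi>"
  shows "local_End C N"
proof (rule local_EndI[OF N])
  note t = tri_Hom[OF T]
  have key: "is_iso C N N \<theta>" if \<theta>: "\<theta> \<in> Hom C N N" and \<phi>: "\<phi> \<in> Hom C U U" and iso: "is_iso C M M \<psi>"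
    and c: "\<phi> \<cdot> f = f \<cdot> \<theta>" "\<psi> \<cdot> g = g \<cdot> \<phi>" "shM C \<theta> \<cdot> h = h \<cdot> \<psi>" for \<theta> \<phi> \<psi>
  proof -
    obtain \<psi>' where \<psi>: "\<psi> \<in> Hom C M M" "\<psi>' \<in> Hom C M M" "\<psi>' \<cdot> \<psi> = ident C M" "\<psi> \<cdot> \<psi>' = ident C M"
      using iso by (rule is_isoE)
    obtain \<phi>' where \<phi>': "\<phi>' \<in> Hom C U U" "\<psi>' \<cdot> g = g \<cdot> \<phi>'" using lift[OF Comp_in_Hom[OF t(2) \<psi>(2)]] by blast
    have "g \<cdot> (\<phi> \<cdot> \<phi>') = g"
      using Comp_assoc[OF \<phi>'(1) \<phi> t(2)] Comp_assoc[OF \<phi>'(1) t(2) \<psi>(1)] Comp_assoc[OF t(2) \<psi>(2,1)] c \<phi>' \<psi>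
        Comp_ident_left[OF t(2)] by simp
    moreover have "g \<cdot> (\<phi>' \<cdot> \<phi>) = g"
      using Comp_assoc[OF \<phi> \<phi>'(1) t(2)] Comp_assoc[OF \<phi> t(2) \<psi>(2)] Comp_assoc[OF t(2) \<psi>(1,2)] c \<phi>' \<psi>
        Comp_ident_left[OF t(2)] by simp
    ultimately have "is_iso C U U \<phi>"
      using min \<phi> \<phi>'(1) by (intro is_iso_of_Comps[OF \<phi> \<phi>'(1)]) (auto intro: Comp_in_Hom)
    then show ?thesis using tri_five_first[OF T T _ iso \<theta> c] by blast
  qed
  fix \<theta> assume \<theta>: "\<theta> \<in> Hom C N N"
  obtain \<phi> where \<phi>: "\<phi> \<in> Hom C U U" "\<phi> \<cdot> f = f \<cdot> \<theta>" using ext[OF Comp_in_Hom[OF \<theta> t(1)]] by metis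
  obtain \<psi> where \<psi>: "\<psi> \<in> Hom C M M" "\<psi> \<cdot> g = g \<cdot> \<phi>" "shM C \<theta> \<cdot> h = h \<cdot> \<psi>"
    using tri_morphism[OF T T \<theta> \<phi>] by blast
  have "is_iso C M M (\<psi> + (ident C M - \<psi>))" using is_iso_ident by simp
  then consider "is_iso C M M \<psi>" | "is_iso C M M (ident C M - \<psi>)"
    using local_End_Hom_cases[OF M \<psi>(1) diff_in_Hom[OF ident_in_Hom \<psi>(1)]] by blast
  then show "is_iso C N N \<theta> \<or> is_iso C N N (ident C N - \<theta>)"
  proof cases
    case 1
    then show ?thesis using key[OF \<theta> \<phi>(1) 1 \<phi>(2) \<psi>(2,3)] by blast
  next
    case 2
    have "(ident C U - \<phi>) \<cdot> f = f \<cdot> (ident C N - \<theta>)"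
      using Comp_diff_left[OF t(1) ident_in_Hom \<phi>(1)] Comp_diff_right[OF ident_in_Hom \<theta> t(1)] \<phi>(2)
        Comp_ident_left[OF t(1)] Comp_ident_right[OF t(1)] by simp
    moreover have "(ident C M - \<psi>) \<cdot> g = g \<cdot> (ident C U - \<phi>)"
      using Comp_diff_left[OF t(2) ident_in_Hom \<psi>(1)] Comp_diff_right[OF ident_in_Hom \<phi>(1) t(2)] \<psi>(2)
        Comp_ident_left[OF t(2)] Comp_ident_right[OF t(2)] by simp
    moreover have "shM C (ident C N - \<theta>) \<cdot> h = h \<cdot> (ident C M - \<psi>)"
      using Comp_diff_left[OF t(3) ident_in_Hom shM_in_Hom[OF \<theta>]] Comp_diff_right[OF ident_in_Hom \<psi>(1) t(3)] \<psi>(3)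
        Comp_ident_left[OF t(3)] Comp_ident_right[OF t(3)] shM_diff[OF ident_in_Hom \<theta>] by (simp add: shM_ident)
    ultimately show ?thesis
      using key[OF diff_in_Hom[OF ident_in_Hom \<theta>] diff_in_Hom[OF ident_in_Hom \<phi>(1)] 2] by blast
  qed
qed

text \<open>Minimality makes \<open>b a\<close> invertible. Correcting \<open>b\<close> by the
  inverse \<open>w\<close> keeps it a map over \<open>M\<close>, because \<open>g0 b a = g0\<close>
  implies \<open>g0 w = g0\<close>.\<close>

lemma retraction_of_minimal_right:
  assumes a: "a \<in> Hom C U E" and b: "b \<in> Hom C E U" and g0: "g0 \<in> Hom C U M"
    and e: "g0 = g \<cdot> a" "g = g0 \<cdot> b" and min: "\<forall>\<phi> \<in> Hom C U U. g0 \<cdot> \<phi> = g0 \<longrightarrow> is_iso C U U \<phi>"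
  obtains b' where "b' \<in> Hom C E U" "b' \<cdot> a = ident C U" "g = g0 \<cdot> b'"
proof -
  have ba: "g0 \<cdot> (b \<cdot> a) = g0" using Comp_assoc[OF a b g0] e by metis
  then obtain w where w: "w \<in> Hom C U U" "w \<cdot> (b \<cdot> a) = ident C U" "(b \<cdot> a) \<cdot> w = ident C U"
    using min Comp_in_Hom[OF a b] unfolding is_iso_def by blast
  have "g0 \<cdot> w = g0" using Comp_assoc[OF w(1) Comp_in_Hom[OF a b] g0] ba w(3) Comp_ident_right[OF g0] by simp
  then have "g = g0 \<cdot> (w \<cdot> b)" using Comp_assoc[OF b w(1) g0] e(2) by metis
  then show ?thesis using that[OF Comp_in_Hom[OF b w(1)]] Comp_assoc[OF a b w(1)] w(2) by simp
qed

text \<open>A triangle on a non-minimal approximation exceeds the minimal one by the same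
  \<open>V\<close> in both of its other terms. The octahedron on \<open>U -> E -> M\<close> gives a
  triangle \<open>V -> N[1] -> X[1]\<close>. Its first map \<open>u\<close> satisfies
  \<open>u q = h0 g = 0\<close>, since \<open>g\<close> factors through \<open>g0\<close>, and
  \<open>q\<close> is a split epimorphism; so \<open>u = 0\<close> and the triangle splits.\<close>

lemma right_approx_split:
  assumes T0: "tri C N U M f0 g0 h0" and T: "tri C X E M f g h"
    and min: "minimal_right_approx C A U M g0"
    and E: "E \<in> A" "\<And>k. k \<in> Hom C U M \<Longrightarrow> \<exists>k' \<in> Hom C U E. k = g \<cdot> k'"
  shows "\<exists>V. (\<exists>i p j q. biproduct E U V i p j q) \<and> (\<exists>i p j q. biproduct X N V i p j q)"
proof -
  note t0 = tri_Hom[OF T0] and t = tri_Hom[OF T]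
  obtain a where a: "a \<in> Hom C U E" "g0 = g \<cdot> a" using E(2)[OF t0(2)] by blast
  obtain b0 where b0: "b0 \<in> Hom C E U" "g = g0 \<cdot> b0"
    using min E(1) t(2) unfolding minimal_right_approx_def by blast
  obtain b where b: "b \<in> Hom C E U" "b \<cdot> a = ident C U" "g = g0 \<cdot> b"
    using retraction_of_minimal_right[OF a(1) b0(1) t0(2) a(2) b0(2)] min unfolding minimal_right_approx_def by blast
  obtain V q k where V: "tri C U E V a q k" using tri_complete[OF a(1)] by blast
  note tV = tri_Hom[OF V]
  obtain j where E': "biproduct E U V a b j q" using split_mono_biproduct[OF a(1) b(1,2) V] .
  note c = biproductD[OF E']
  have "tri C U M (shO C N) (g \<cdot> a) h0 (- shM C f0)" using rotate[OF T0] a(2) by simp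
  from octahedral[OF V rotate[OF T] this] obtain u v where
    uv: "tri C V (shO C N) (shO C X) u v (shM C q \<cdot> (- shM C f))" "u \<cdot> q = h0 \<cdot> g"
    by blast
  note tu = tri_Hom[OF uv(1)]
  have "u \<cdot> q = 0" using uv(2) b(3) Comp_assoc[OF b(1) t0(2,3)] tri_Comp_zero(2)[OF T0] b(1) by simp
  then have u0: "u = 0" using Comp_assoc[OF c(3,4) tu(1)] c(3,6) Comp_ident_right[OF tu(1)] by simp
  obtain z where z: "z \<in> Hom C (shO C X) (shO C N)" "ident C (shO C N) = z \<cdot> v"
    using tri_factor_through_second[OF uv(1) ident_in_Hom] u0 Comp_zero_right[OF ident_in_Hom] by metis
  obtain l where "biproduct (shO C X) (shO C N) (shO C V) v z l (shM C q \<cdot> (- shM C f))"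
    using split_mono_biproduct[OF tu(2) z(1) z(2)[symmetric] rotate[OF uv(1)]] .
  then show ?thesis using E' biproduct_unshift by blast
qed

text \<open>The counterpart for left approximations: the octahedron on \<open>M -> U -> W\<close>
  gives \<open>N -> X -> V\<close> with third map \<open>g0[1] k\<close>. Here
  \<open>k q = 0\<close> with \<open>q\<close> a split epimorphism, so \<open>k = 0\<close> and the
  triangle splits.\<close>

lemma left_approx_split:
  assumes T0: "tri C M U N f0 g0 h0" and T: "tri C M W X f g h"
    and min: "minimal_left_approx C A M U f0"
    and W: "W \<in> A" "\<And>k. k \<in> Hom C M U \<Longrightarrow> \<exists>k' \<in> Hom C W U. k = k' \<cdot> f"
  shows "\<exists>V. (\<exists>i p j q. biproduct W U V i p j q) \<and> (\<exists>i p j q. biproduct X N V i p j q)"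
proof -
  note t0 = tri_Hom[OF T0] and t = tri_Hom[OF T]
  obtain b where b: "b \<in> Hom C W U" "f0 = b \<cdot> f" using W(2)[OF t0(1)] by blast
  obtain a where a: "a \<in> Hom C U W" "f = a \<cdot> f0"
    using min W(1) t(1) unfolding minimal_left_approx_def by blast
  have "(b \<cdot> a) \<cdot> f0 = f0" using Comp_assoc[OF t0(1) a(1) b(1)] a(2) b(2) by metis
  then have "is_iso C U U (b \<cdot> a)" using min Comp_in_Hom[OF a(1) b(1)] unfolding minimal_left_approx_def by blast
  then obtain b' where b': "b' \<in> Hom C W U" "b' \<cdot> a = ident C U" using retraction_of_iso[OF a(1) b(1)] by blast
  obtain V q k where V: "tri C U W V a q k" using tri_complete[OF a(1)] by blast
  note tV = tri_Hom[OF V]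
  obtain j where W': "biproduct W U V a b' j q" using split_mono_biproduct[OF a(1) b' V] .
  note c = biproductD[OF W']
  have k0: "k = 0" using tri_Comp_zero(2)[OF V] Comp_assoc[OF c(3,4) tV(3)] c(3,6) Comp_ident_right[OF tV(3)] by simp
  have "tri C M W X (a \<cdot> f0) g h" using T a(2) by simp
  from octahedral[OF T0 V this] obtain u v where uv: "tri C N X V u v (shM C g0 \<cdot> k)" by blast
  note tu = tri_Hom[OF uv(1)]
  have "shM C g0 \<cdot> k = 0" using k0 shM_in_Hom[OF t0(2)] by simp
  then obtain z where z: "z \<in> Hom C X N" "ident C N = z \<cdot> u"
    using tri_extend_first[OF uv(1) ident_in_Hom] shM_ident Comp_zero_right[OF ident_in_Hom] by metis
  obtain l where "biproduct X N V u z l v"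
    using split_mono_biproduct[OF tu(1) z(1) z(2)[symmetric] uv(1)] .
  then show ?thesis using W' by blast
qed

lemma minimal_right_approx_unique:
  assumes "minimal_right_approx C A U M g" "minimal_right_approx C A U' M g'"
  shows "isomorphic C U U'"
proof -
  have g: "g \<in> Hom C U M" "g' \<in> Hom C U' M" using assms unfolding minimal_right_approx_def by auto
  obtain a where a: "a \<in> Hom C U U'" "g = g' \<cdot> a" using assms unfolding minimal_right_approx_def by blast
  obtain b where b: "b \<in> Hom C U' U" "g' = g \<cdot> b" using assms unfolding minimal_right_approx_def by blast
  have "g \<cdot> (b \<cdot> a) = g" "g' \<cdot> (a \<cdot> b) = g'"
    using Comp_assoc[OF a(1) b(1) g(1)] Comp_assoc[OF b(1) a(1) g(2)] a(2) b(2) by metis+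
  then have "is_iso C U U' a"
    using assms Comp_in_Hom[OF a(1) b(1)] Comp_in_Hom[OF b(1) a(1)] unfolding minimal_right_approx_def
    by (intro is_iso_of_Comps[OF a(1) b(1)]) blast+
  then show ?thesis unfolding isomorphic_def by blast
qed

lemma minimal_left_approx_unique:
  assumes "minimal_left_approx C A M U f" "minimal_left_approx C A M U' f'"
  shows "\<exists>a. is_iso C U U' a \<and> a \<cdot> f = f'"
proof -
  have f: "f \<in> Hom C M U" "f' \<in> Hom C M U'" using assms unfolding minimal_left_approx_def by auto
  obtain b where b: "b \<in> Hom C U' U" "f = b \<cdot> f'" using assms unfolding minimal_left_approx_def by blast
  obtain a where a: "a \<in> Hom C U U'" "f' = a \<cdot> f" using assms unfolding minimal_left_approx_def by blast
  have "(b \<cdot> a) \<cdot> f = f" "(a \<cdot> b) \<cdot> f' = f'"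
    using Comp_assoc[OF f(1) a(1) b(1)] Comp_assoc[OF f(2) b(1) a(1)] a(2) b(2) by metis+
  then have "is_iso C U U' a"
    using assms Comp_in_Hom[OF a(1) b(1)] Comp_in_Hom[OF b(1) a(1)] unfolding minimal_left_approx_def
    by (intro is_iso_of_Comps[OF a(1) b(1)]) blast+
  then show ?thesis using a(2) by blast
qed

lemma minimal_right_approx_isomorphic:
  assumes "minimal_right_approx C A U M g" "is_iso C M M' m"
  shows "minimal_right_approx C A U M' (m \<cdot> g)"
proof -
  obtain w where w: "m \<in> Hom C M M'" "w \<in> Hom C M' M" "w \<cdot> m = ident C M" "m \<cdot> w = ident C M'"
    using assms(2) by (rule is_isoE)
  have g: "U \<in> A" "g \<in> Hom C U M" using assms(1) unfolding minimal_right_approx_def by auto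
  have wx: "w \<cdot> (m \<cdot> x) = x" if "x \<in> Hom C V M" for x V
    using Comp_assoc[OF that w(1,2)] w(3) Comp_ident_left[OF that] by simp
  have mx: "m \<cdot> (w \<cdot> x) = x" if "x \<in> Hom C V M'" for x V
    using Comp_assoc[OF that w(2,1)] w(4) Comp_ident_left[OF that] by simp
  show ?thesis
    unfolding minimal_right_approx_def
  proof (intro conjI ballI impI)
    fix V h assume V: "V \<in> A" "h \<in> Hom C V M'"
    then obtain h' where h': "h' \<in> Hom C V U" "w \<cdot> h = g \<cdot> h'"
      using assms(1) Comp_in_Hom[OF V(2) w(2)] unfolding minimal_right_approx_def by blast
    then have "h = m \<cdot> g \<cdot> h'" using mx[OF V(2)] Comp_assoc[OF h'(1) g(2) w(1)] by simp
    then show "\<exists>h' \<in> Hom C V U. h = m \<cdot> g \<cdot> h'" using h' by blast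
  next
    fix \<phi> assume \<phi>: "\<phi> \<in> Hom C U U" "m \<cdot> g \<cdot> \<phi> = m \<cdot> g"
    then have "g \<cdot> \<phi> = g"
      using Comp_assoc[OF \<phi>(1) g(2) w(1)] wx[OF Comp_in_Hom[OF \<phi>(1) g(2)]] wx[OF g(2)] by simp
    then show "is_iso C U U \<phi>" using assms(1) \<phi> unfolding minimal_right_approx_def by blast
  qed (use g Comp_in_Hom[OF g(2) w(1)] in auto)
qed

lemma minimal_left_approx_isomorphic:
  assumes "minimal_left_approx C A M U f" "is_iso C M' M m"
  shows "minimal_left_approx C A M' U (f \<cdot> m)"
proof -
  obtain w where w: "m \<in> Hom C M' M" "w \<in> Hom C M M'" "w \<cdot> m = ident C M'" "m \<cdot> w = ident C M"
    using assms(2) by (rule is_isoE)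
  have f: "U \<in> A" "f \<in> Hom C M U" using assms(1) unfolding minimal_left_approx_def by auto
  have wx: "x \<cdot> w \<cdot> m = x" if "x \<in> Hom C M' V" for x V
    using Comp_assoc[OF w(1,2) that] w(3) Comp_ident_right[OF that] by simp
  have mx: "x \<cdot> m \<cdot> w = x" if "x \<in> Hom C M V" for x V
    using Comp_assoc[OF w(2,1) that] w(4) Comp_ident_right[OF that] by simp
  show ?thesis
    unfolding minimal_left_approx_def
  proof (intro conjI ballI impI)
    fix V h assume V: "V \<in> A" "h \<in> Hom C M' V"
    then obtain h' where h': "h' \<in> Hom C U V" "h \<cdot> w = h' \<cdot> f"
      using assms(1) Comp_in_Hom[OF w(2) V(2)] unfolding minimal_left_approx_def by blast
    then have "h = h' \<cdot> (f \<cdot> m)" using wx[OF V(2)] Comp_assoc[OF w(1) f(2) h'(1)] by simp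
    then show "\<exists>h' \<in> Hom C U V. h = h' \<cdot> (f \<cdot> m)" using h' by blast
  next
    fix \<phi> assume \<phi>: "\<phi> \<in> Hom C U U" "\<phi> \<cdot> (f \<cdot> m) = f \<cdot> m"
    then have "\<phi> \<cdot> f = f"
      using Comp_assoc[OF w(1) f(2) \<phi>(1)] mx[OF Comp_in_Hom[OF f(2) \<phi>(1)]] mx[OF f(2)] by simp
    then show "is_iso C U U \<phi>" using assms(1) \<phi> unfolding minimal_left_approx_def by blast
  qed (use f Comp_in_Hom[OF w(1) f(2)] in auto)
qed

text \<open>Minimal left approximations of \<open>M\<close> are isomorphic under \<open>M\<close>;
  the five lemma carries the isomorphism to the cones.\<close>

lemma minimal_left_approx_cone_unique:
  assumes "minimal_left_approx C A M U f" "minimal_left_approx C A M U' f'"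
    and T: "tri C M U N f g h" and T': "tri C M U' N' f' g' h'"
  shows "isomorphic C N N'"
proof -
  note t = tri_Hom[OF T] and t' = tri_Hom[OF T']
  obtain a where a: "is_iso C U U' a" "a \<cdot> f = f'" using minimal_left_approx_unique[OF assms(1,2)] by blast
  have "a \<in> Hom C U U'" using a by (auto simp: is_iso_def)
  then obtain c where c: "c \<in> Hom C N N'" "c \<cdot> g = g' \<cdot> a" "shM C (ident C M) \<cdot> h = h' \<cdot> c"
    using tri_morphism[OF T T' ident_in_Hom] a(2) Comp_ident_right[OF t'(1)] by metis
  then have "is_iso C N N' c"
    using tri_five[OF T T' is_iso_ident a(1)] a(2) Comp_ident_right[OF t'(1)] by metis
  then show ?thesis unfolding isomorphic_def by blast
qed

text \<open>Induction over the summands reduces lifting from sums of members of \<open>S\<close> to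
  lifting from the members themselves.\<close>

lemma factor_through_right:
  assumes g: "g \<in> Hom C U M" and S: "\<And>B h. \<lbrakk>B \<in> S; h \<in> Hom C B M\<rbrakk> \<Longrightarrow> \<exists>h' \<in> Hom C B U. h = g \<cdot> h'"
    and V: "is_direct_sum C V Vs" "set Vs \<subseteq> S" "h \<in> Hom C V M"
  shows "\<exists>h' \<in> Hom C V U. h = g \<cdot> h'"
  using V
proof (induction Vs arbitrary: V h)
  case Nil
  then have "h = 0" using zero_object_Hom_from is_direct_sum_Nil by blast
  then show ?case using g by (intro bexI[of _ 0]) auto
next
  case (Cons B Vs)
  obtain Y i p j q where Y: "biproduct V B Y i p j q" "is_direct_sum C Y Vs"
    using Cons.prems(1) unfolding is_direct_sum_Cons by blast
  note b = biproductD[OF Y(1)] and h = Cons.prems(3)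
  obtain x where x: "x \<in> Hom C B U" "h \<cdot> i = g \<cdot> x" using S[OF _ Comp_in_Hom[OF b(1) h]] Cons.prems(2) by auto
  obtain y where y: "y \<in> Hom C Y U" "h \<cdot> j = g \<cdot> y" using Cons.IH[OF Y(2) _ Comp_in_Hom[OF b(3) h]] Cons.prems(2) by auto
  note c = biproduct_copair[OF Y(1) x(1) y(1)]
  have "h = g \<cdot> (x \<cdot> p + y \<cdot> q)"
    by (rule biproduct_eqI_from[OF Y(1) h Comp_in_Hom[OF c(1) g]])
      (use c x y Comp_assoc[OF b(1) c(1) g] Comp_assoc[OF b(3) c(1) g] in simp_all)
  then show ?case using c by blast
qed

lemma factor_through_left:
  assumes f: "f \<in> Hom C M U" and S: "\<And>B h. \<lbrakk>B \<in> S; h \<in> Hom C M B\<rbrakk> \<Longrightarrow> \<exists>h' \<in> Hom C U B. h = h' \<cdot> f"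
    and V: "is_direct_sum C V Vs" "set Vs \<subseteq> S" "h \<in> Hom C M V"
  shows "\<exists>h' \<in> Hom C U V. h = h' \<cdot> f"
  using V
proof (induction Vs arbitrary: V h)
  case Nil
  then have "h = 0" using zero_object_Hom_to is_direct_sum_Nil by blast
  then show ?case using f by (intro bexI[of _ 0]) auto
next
  case (Cons B Vs)
  obtain Y i p j q where Y: "biproduct V B Y i p j q" "is_direct_sum C Y Vs"
    using Cons.prems(1) unfolding is_direct_sum_Cons by blast
  note b = biproductD[OF Y(1)] and h = Cons.prems(3)
  obtain x where x: "x \<in> Hom C U B" "p \<cdot> h = x \<cdot> f" using S[OF _ Comp_in_Hom[OF h b(2)]] Cons.prems(2) by auto
  obtain y where y: "y \<in> Hom C U Y" "q \<cdot> h = y \<cdot> f" using Cons.IH[OF Y(2) _ Comp_in_Hom[OF h b(4)]] Cons.prems(2) by auto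
  note c = biproduct_pair[OF Y(1) x(1) y(1)]
  have "h = (i \<cdot> x + j \<cdot> y) \<cdot> f"
    by (rule biproduct_eqI_to[OF Y(1) h Comp_in_Hom[OF f c(1)]])
      (use c x y Comp_assoc[OF f c(1) b(2)] Comp_assoc[OF f c(1) b(4)] in simp_all)
  then show ?case using c by blast
qed

lemma right_approx_of_list:
  assumes "\<forall>(B, e) \<in> set L. e \<in> Hom C B M"
  shows "\<exists>U g. is_direct_sum C U (map fst L) \<and> g \<in> Hom C U M \<and> (\<forall>(B, e) \<in> set L. \<exists>h \<in> Hom C B U. e = g \<cdot> h)"
  using assms
proof (induction L)
  case Nil
  then show ?case using ex_zero_object is_direct_sum_Nil zero_in_Hom by fastforce
next
  case (Cons Be L)
  obtain B e where Be: "Be = (B, e)" by (cases Be)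
  obtain U g where U: "is_direct_sum C U (map fst L)" "g \<in> Hom C U M" "\<forall>(B, e) \<in> set L. \<exists>h \<in> Hom C B U. e = g \<cdot> h"
    using Cons by auto
  obtain X i p j q where X: "biproduct X B U i p j q" using biproduct_exists .
  note b = biproductD[OF X]
  have e: "e \<in> Hom C B M" using Cons.prems Be by auto
  note c = biproduct_copair[OF X e U(2)]
  have "\<exists>h \<in> Hom C B' X. e' = (e \<cdot> p + g \<cdot> q) \<cdot> h" if "(B', e') \<in> set (Be # L)" for B' e'
  proof (cases "(B', e') = (B, e)")
    case True
    then show ?thesis using c b by force
  next
    case False
    then obtain h where "h \<in> Hom C B' U" "e' = g \<cdot> h" using U(3) Be \<open>(B', e') \<in> set (Be # L)\<close> by auto
    then have "j \<cdot> h \<in> Hom C B' X" "e' = (e \<cdot> p + g \<cdot> q) \<cdot> (j \<cdot> h)"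
      using Comp_in_Hom[OF _ b(3)] Comp_assoc[OF _ b(3) c(1)] c(3) by auto
    then show ?thesis by blast
  qed
  moreover have "is_direct_sum C X (map fst (Be # L))" using X U(1) unfolding Be list.map fst_conv is_direct_sum_Cons by blast
  ultimately show ?case using c(1) by blast
qed

lemma left_approx_of_list:
  assumes "\<forall>(B, e) \<in> set L. e \<in> Hom C M B"
  shows "\<exists>U g. is_direct_sum C U (map fst L) \<and> g \<in> Hom C M U \<and> (\<forall>(B, e) \<in> set L. \<exists>h \<in> Hom C U B. e = h \<cdot> g)"
  using assms
proof (induction L)
  case Nil
  then show ?case using ex_zero_object is_direct_sum_Nil zero_in_Hom by fastforce
next
  case (Cons Be L)
  obtain B e where Be: "Be = (B, e)" by (cases Be)
  obtain U g where U: "is_direct_sum C U (map fst L)" "g \<in> Hom C M U" "\<forall>(B, e) \<in> set L. \<exists>h \<in> Hom C U B. e = h \<cdot> g"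
    using Cons by auto
  obtain X i p j q where X: "biproduct X B U i p j q" using biproduct_exists .
  note b = biproductD[OF X]
  have e: "e \<in> Hom C M B" using Cons.prems Be by auto
  note c = biproduct_pair[OF X e U(2)]
  have "\<exists>h \<in> Hom C X B'. e' = h \<cdot> (i \<cdot> e + j \<cdot> g)" if "(B', e') \<in> set (Be # L)" for B' e'
  proof (cases "(B', e') = (B, e)")
    case True
    then show ?thesis using c b by force
  next
    case False
    then obtain h where "h \<in> Hom C U B'" "e' = h \<cdot> g" using U(3) Be \<open>(B', e') \<in> set (Be # L)\<close> by auto
    then have "h \<cdot> q \<in> Hom C X B'" "e' = (h \<cdot> q) \<cdot> (i \<cdot> e + j \<cdot> g)"
      using Comp_in_Hom[OF b(4)] Comp_assoc[OF c(1) b(4)] c(3) by auto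
    then show ?thesis by blast
  qed
  moreover have "is_direct_sum C X (map fst (Be # L))" using X U(1) unfolding Be list.map fst_conv is_direct_sum_Cons by blast
  ultimately show ?case using c(1) by blast
qed

end

section \<open>Minimality detected on indecomposable summands\<close>

context krull_schmidt_triangulated
begin

text \<open>A converse to \<open>right_minimal_kernel_summand\<close>:
  \<open>\<psi> = 1 - \<phi>\<close> satisfies \<open>g \<psi> = 0\<close>, and
  \<open>non_iso_retract\<close> provides a \<open>B\<close> that \<open>\<psi> a\<close> embeds as
  a summand.\<close>

lemma not_right_minimal_summand:
  assumes "g \<in> Hom C U M" "\<phi> \<in> Hom C U U" "g \<cdot> \<phi> = g" "\<not> is_iso C U U \<phi>"
  obtains B s p where "local_End C B" "s \<in> Hom C B U" "p \<in> Hom C U B" "p \<cdot> s = ident C B" "g \<cdot> s = 0"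
proof -
  define \<psi> where "\<psi> = ident C U - \<phi>"
  have \<psi>: "\<psi> \<in> Hom C U U" unfolding \<psi>_def using assms(2) by (auto intro: Hom_intros)
  obtain B a b where B: "local_End C B" "a \<in> Hom C B U" "b \<in> Hom C U B" "b \<cdot> (\<psi> \<cdot> a) = ident C B"
    using non_iso_retract[OF \<psi>] assms(4) unfolding \<psi>_def by auto
  have "g \<cdot> \<psi> = 0"
    using Comp_diff_right[OF ident_in_Hom assms(2,1)] assms(3) Comp_ident_right[OF assms(1)] by (simp add: \<psi>_def)
  then have "g \<cdot> (\<psi> \<cdot> a) = 0" using Comp_assoc[OF B(2) \<psi> assms(1)] B(2) by simp
  then show ?thesis using that B Comp_in_Hom[OF B(2) \<psi>] by blast
qed

lemma not_left_minimal_summand: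
  assumes "f \<in> Hom C M U" "\<phi> \<in> Hom C U U" "\<phi> \<cdot> f = f" "\<not> is_iso C U U \<phi>"
  obtains B s p where "local_End C B" "s \<in> Hom C B U" "p \<in> Hom C U B" "p \<cdot> s = ident C B" "p \<cdot> f = 0"
proof -
  define \<psi> where "\<psi> = ident C U - \<phi>"
  have \<psi>: "\<psi> \<in> Hom C U U" unfolding \<psi>_def using assms(2) by (auto intro: Hom_intros)
  obtain B a b where B: "local_End C B" "a \<in> Hom C B U" "b \<in> Hom C U B" "b \<cdot> (\<psi> \<cdot> a) = ident C B"
    using non_iso_retract[OF \<psi>] assms(4) unfolding \<psi>_def by auto
  have "\<psi> \<cdot> f = 0"
    using Comp_diff_left[OF assms(1) ident_in_Hom assms(2)] assms(3) Comp_ident_left[OF assms(1)] by (simp add: \<psi>_def)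
  then have "(b \<cdot> \<psi>) \<cdot> f = 0" using Comp_assoc[OF assms(1) \<psi> B(3)] B(3) by simp
  then show ?thesis using that B Comp_in_Hom[OF \<psi> B(3)] Comp_assoc[OF B(2) \<psi> B(3)] by simp
qed

text \<open>A summand \<open>B\<close> of \<open>U\<close> killed by \<open>g\<close> factors
  through \<open>f\<close> and so splits off \<open>N\<close>. Locality makes it all of
  \<open>N\<close>, and then \<open>f\<close> would be a split monomorphism.\<close>

lemma right_minimal_of_local_cocone:
  assumes T: "tri C N U M f g h" and N: "local_End C N" and nsplit: "\<And>c. c \<in> Hom C U N \<Longrightarrow> c \<cdot> f \<noteq> ident C N"
  shows "\<forall>\<phi> \<in> Hom C U U. g \<cdot> \<phi> = g \<longrightarrow> is_iso C U U \<phi>"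
proof (intro ballI impI, rule ccontr)
  fix \<phi> assume "\<phi> \<in> Hom C U U" "g \<cdot> \<phi> = g" "\<not> is_iso C U U \<phi>"
  note t = tri_Hom[OF T]
  obtain B s p where B: "local_End C B" "s \<in> Hom C B U" "p \<in> Hom C U B" "p \<cdot> s = ident C B" "g \<cdot> s = 0"
    using not_right_minimal_summand[OF t(2)] \<open>\<phi> \<in> Hom C U U\<close> \<open>g \<cdot> \<phi> = g\<close> \<open>\<not> is_iso C U U \<phi>\<close> by metis
  obtain u where u: "u \<in> Hom C B N" "s = f \<cdot> u" using tri_factor_through_first[OF T B(2,5)] .
  have pf: "(p \<cdot> f) \<cdot> u = ident C B" using Comp_assoc[OF u(1) t(1) B(3)] u(2) B(4) by simp
  have iso: "is_iso C B N u"
    using local_End_retract_iso[OF N u(1) Comp_in_Hom[OF t(1) B(3)] pf] B(1) unfolding local_End_def by blast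
  then obtain w where w: "w \<in> Hom C N B" "w \<cdot> u = ident C B" "u \<cdot> w = ident C N" by (rule is_isoE)
  have "w = p \<cdot> f" using inverse_unique[OF u(1) Comp_in_Hom[OF t(1) B(3)] w(1) pf w(3)] by simp
  then have "(u \<cdot> p) \<cdot> f = ident C N" using w(3) Comp_assoc[OF t(1) B(3) u(1)] by simp
  then show False using nsplit Comp_in_Hom[OF B(3) u(1)] by blast
qed

text \<open>Dually, a projection of \<open>U\<close> that kills \<open>f\<close> factors through
  \<open>g\<close>. Its image splits off \<open>M\<close>, hence is all of \<open>M\<close>, and
  then \<open>g\<close> would be a split epimorphism.\<close>

lemma left_minimal_of_local_cone:
  assumes T: "tri C N U M f g h" and M: "local_End C M" and nsplit: "\<And>d. d \<in> Hom C M U \<Longrightarrow> g \<cdot> d \<noteq> ident C M"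
  shows "\<forall>\<phi> \<in> Hom C U U. \<phi> \<cdot> f = f \<longrightarrow> is_iso C U U \<phi>"
proof (intro ballI impI, rule ccontr)
  fix \<phi> assume "\<phi> \<in> Hom C U U" "\<phi> \<cdot> f = f" "\<not> is_iso C U U \<phi>"
  note t = tri_Hom[OF T]
  obtain B s p where B: "local_End C B" "s \<in> Hom C B U" "p \<in> Hom C U B" "p \<cdot> s = ident C B" "p \<cdot> f = 0"
    using not_left_minimal_summand[OF t(1)] \<open>\<phi> \<in> Hom C U U\<close> \<open>\<phi> \<cdot> f = f\<close> \<open>\<not> is_iso C U U \<phi>\<close> by metis
  obtain u where u: "u \<in> Hom C M B" "p = u \<cdot> g" using tri_factor_through_second[OF T B(3,5)] .
  have gs: "g \<cdot> s \<in> Hom C B M" using Comp_in_Hom[OF B(2) t(2)] .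
  have ug: "u \<cdot> (g \<cdot> s) = ident C B" using Comp_assoc[OF B(2) t(2) u(1)] u(2) B(4) by simp
  have iso: "is_iso C B M (g \<cdot> s)"
    using local_End_retract_iso[OF M gs u(1) ug] B(1) unfolding local_End_def by blast
  then obtain w where w: "w \<in> Hom C M B" "w \<cdot> (g \<cdot> s) = ident C B" "(g \<cdot> s) \<cdot> w = ident C M" by (rule is_isoE)
  then have "g \<cdot> (s \<cdot> w) = ident C M" using Comp_assoc[OF w(1) B(2) t(2)] by simp
  then show False using nsplit Comp_in_Hom[OF w(1) B(2)] by blast
qed

end

section \<open>Existence of minimal approximations\<close>

locale hom_finite_krull_schmidt = krull_schmidt_triangulated C
  for C :: "('k::field, 'o, 'm::ab_group_add) tricat" (structure) +
  assumes HF: "Hom_finite C"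
begin

text \<open>Take one copy of \<open>B\<close> for each member of a finite generating set of
  \<open>Hom B M\<close>. The maps that factor through \<open>g\<close> form a subspace containing
  these generators, hence all of \<open>Hom B M\<close>.\<close>

lemma right_approx_exists:
  assumes "finite S"
  shows "\<exists>U Us g. is_direct_sum C U Us \<and> set Us \<subseteq> S \<and> g \<in> Hom C U M \<and>
    (\<forall>B \<in> S. \<forall>h \<in> Hom C B M. \<exists>h' \<in> Hom C B U. h = g \<cdot> h')"
proof -
  have "\<forall>B. \<exists>E. finite E \<and> E \<subseteq> Hom C B M \<and> Hom C B M = span E" using HF unfolding Hom_finite_def by blast
  from choice[OF this] obtain E where E: "\<And>B. finite (E B) \<and> E B \<subseteq> Hom C B M \<and> Hom C B M = span (E B)" by blast
  obtain L where L: "set L = (SIGMA B:S. E B)" using finite_list[of "SIGMA B:S. E B"] assms E by blast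
  have "\<forall>(B, e) \<in> set L. e \<in> Hom C B M" using L E by blast
  then obtain U g where U: "is_direct_sum C U (map fst L)" "g \<in> Hom C U M"
    "\<forall>(B, e) \<in> set L. \<exists>h \<in> Hom C B U. e = g \<cdot> h" using right_approx_of_list by blast
  have "\<exists>h' \<in> Hom C B U. h = g \<cdot> h'" if B: "B \<in> S" "h \<in> Hom C B M" for B h
  proof -
    have "subspace {h. \<exists>h' \<in> Hom C B U. h = g \<cdot> h'}"
    proof (rule subspaceI)
      show "0 \<in> {h. \<exists>h' \<in> Hom C B U. h = g \<cdot> h'}" using U(2) by (auto intro!: bexI[of _ 0])
      show "x + y \<in> {h. \<exists>h' \<in> Hom C B U. h = g \<cdot> h'}"
        if "x \<in> {h. \<exists>h' \<in> Hom C B U. h = g \<cdot> h'}" "y \<in> {h. \<exists>h' \<in> Hom C B U. h = g \<cdot> h'}" for x y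
      proof -
        from that obtain x' y' where x': "x' \<in> Hom C B U" "x = g \<cdot> x'" and y': "y' \<in> Hom C B U" "y = g \<cdot> y'" by blast
        show ?thesis using x' y' Comp_add_right[OF x'(1) y'(1) U(2)] add_in_Hom[OF x'(1) y'(1)] by (auto intro!: bexI[of _ "x' + y'"])
      qed
      show "smul C c x \<in> {h. \<exists>h' \<in> Hom C B U. h = g \<cdot> h'}"
        if "x \<in> {h. \<exists>h' \<in> Hom C B U. h = g \<cdot> h'}" for c x
      proof -
        from that obtain x' where x': "x' \<in> Hom C B U" "x = g \<cdot> x'" by blast
        show ?thesis using x' Comp_smul_right[OF x'(1) U(2), of c] subspace_scale[OF Hom_subspace x'(1), of c] by (auto intro!: bexI[of _ "smul C c x'"])
      qed
    qed
    moreover have "E B \<subseteq> {h. \<exists>h' \<in> Hom C B U. h = g \<cdot> h'}" using U(3) L B(1) by auto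
    ultimately have "span (E B) \<subseteq> {h. \<exists>h' \<in> Hom C B U. h = g \<cdot> h'}" by (rule span_minimal[rotated])
    then show ?thesis using B(2) E by blast
  qed
  moreover have "set (map fst L) \<subseteq> S" using L by auto
  ultimately show ?thesis using U by blast
qed

lemma left_approx_exists:
  assumes "finite S"
  shows "\<exists>U Us g. is_direct_sum C U Us \<and> set Us \<subseteq> S \<and> g \<in> Hom C M U \<and>
    (\<forall>B \<in> S. \<forall>h \<in> Hom C M B. \<exists>h' \<in> Hom C U B. h = h' \<cdot> g)"
proof -
  have "\<forall>B. \<exists>E. finite E \<and> E \<subseteq> Hom C M B \<and> Hom C M B = span E" using HF unfolding Hom_finite_def by blast
  from choice[OF this] obtain E where E: "\<And>B. finite (E B) \<and> E B \<subseteq> Hom C M B \<and> Hom C M B = span (E B)" by blast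
  obtain L where L: "set L = (SIGMA B:S. E B)" using finite_list[of "SIGMA B:S. E B"] assms E by blast
  have "\<forall>(B, e) \<in> set L. e \<in> Hom C M B" using L E by blast
  then obtain U g where U: "is_direct_sum C U (map fst L)" "g \<in> Hom C M U"
    "\<forall>(B, e) \<in> set L. \<exists>h \<in> Hom C U B. e = h \<cdot> g" using left_approx_of_list by blast
  have "\<exists>h' \<in> Hom C U B. h = h' \<cdot> g" if B: "B \<in> S" "h \<in> Hom C M B" for B h
  proof -
    have "subspace {h. \<exists>h' \<in> Hom C U B. h = h' \<cdot> g}"
    proof (rule subspaceI)
      show "0 \<in> {h. \<exists>h' \<in> Hom C U B. h = h' \<cdot> g}" using U(2) by (auto intro!: bexI[of _ 0])
      show "x + y \<in> {h. \<exists>h' \<in> Hom C U B. h = h' \<cdot> g}"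
        if "x \<in> {h. \<exists>h' \<in> Hom C U B. h = h' \<cdot> g}" "y \<in> {h. \<exists>h' \<in> Hom C U B. h = h' \<cdot> g}" for x y
      proof -
        from that obtain x' y' where x': "x' \<in> Hom C U B" "x = x' \<cdot> g" and y': "y' \<in> Hom C U B" "y = y' \<cdot> g" by blast
        show ?thesis using x' y' Comp_add_left[OF U(2) x'(1) y'(1)] add_in_Hom[OF x'(1) y'(1)] by (auto intro!: bexI[of _ "x' + y'"])
      qed
      show "smul C c x \<in> {h. \<exists>h' \<in> Hom C U B. h = h' \<cdot> g}"
        if "x \<in> {h. \<exists>h' \<in> Hom C U B. h = h' \<cdot> g}" for c x
      proof -
        from that obtain x' where x': "x' \<in> Hom C U B" "x = x' \<cdot> g" by blast
        show ?thesis using x' Comp_smul_left[OF U(2) x'(1), of c] subspace_scale[OF Hom_subspace x'(1), of c] by (auto intro!: bexI[of _ "smul C c x'"])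
      qed
    qed
    moreover have "E B \<subseteq> {h. \<exists>h' \<in> Hom C U B. h = h' \<cdot> g}" using U(3) L B(1) by auto
    ultimately have "span (E B) \<subseteq> {h. \<exists>h' \<in> Hom C U B. h = h' \<cdot> g}" by (rule span_minimal[rotated])
    then show ?thesis using B(2) E by blast
  qed
  moreover have "set (map fst L) \<subseteq> S" using L by auto
  ultimately show ?thesis using U by blast
qed

text \<open>An approximation with the fewest summands from \<open>S\<close> is right minimal:
  otherwise \<open>g\<close> kills a summand \<open>B\<close>, and by \<open>exchange\<close> the
  complement of \<open>B\<close> is an approximation with a shorter list.\<close>

lemma minimal_right_approx_exists:
  assumes "finite S" "\<forall>B \<in> S. local_End C B"
  obtains U g where "minimal_right_approx C (add_of C S) U M g"
proof -
  define P where "P n \<longleftrightarrow> (\<exists>U Us g. length Us = n \<and> is_direct_sum C U Us \<and> set Us \<subseteq> S \<and> g \<in> Hom C U M \<and>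
    (\<forall>B \<in> S. \<forall>h \<in> Hom C B M. \<exists>h' \<in> Hom C B U. h = g \<cdot> h'))" for n
  have "\<exists>n. P n" using right_approx_exists[OF assms(1), of M] unfolding P_def by blast
  then have "P (LEAST n. P n)" by (rule LeastI_ex)
  then obtain U Us g where U: "length Us = (LEAST n. P n)" "is_direct_sum C U Us" "set Us \<subseteq> S" "g \<in> Hom C U M"
    and approx: "\<forall>B \<in> S. \<forall>h \<in> Hom C B M. \<exists>h' \<in> Hom C B U. h = g \<cdot> h'" unfolding P_def by blast
  have "is_iso C U U \<phi>" if phi: "\<phi> \<in> Hom C U U" "g \<cdot> \<phi> = g" for \<phi>
  proof (rule ccontr)
    assume "\<not> is_iso C U U \<phi>"
    then obtain B s p where B: "local_End C B" "s \<in> Hom C B U" "p \<in> Hom C U B" "p \<cdot> s = ident C B" "g \<cdot> s = 0"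
      using not_right_minimal_summand[OF U(4) phi] by blast
    obtain U2 j q where U2: "biproduct U B U2 s p j q" using split_mono_complement[OF B(2-4)] .
    note b = biproductD[OF U2]
    obtain Us1 Z Us2 where Us: "Us = Us1 @ Z # Us2" "is_direct_sum C U2 (Us1 @ Us2)"
      using exchange[OF B(1) U2 U(2)] U(3) assms(2) by blast
    have gj: "g \<cdot> j \<in> Hom C U2 M" using Comp_in_Hom[OF b(3) U(4)] .
    have "\<exists>h' \<in> Hom C B' U2. h = (g \<cdot> j) \<cdot> h'" if B': "B' \<in> S" "h \<in> Hom C B' M" for B' h
    proof -
      obtain h' where h': "h' \<in> Hom C B' U" "h = g \<cdot> h'" using approx B' by blast
      note th = Comp_in_Hom[OF h'(1) b(2)] Comp_in_Hom[OF h'(1) b(4)]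
      have "h = g \<cdot> (s \<cdot> (p \<cdot> h') + j \<cdot> (q \<cdot> h'))" using biproduct_elements(5)[OF U2 h'(1)] h'(2) by simp
      also have "\<dots> = (g \<cdot> j) \<cdot> (q \<cdot> h')"
        using Comp_add_right[OF Comp_in_Hom[OF th(1) b(1)] Comp_in_Hom[OF th(2) b(3)] U(4)]
          Comp_assoc[OF th(1) b(1) U(4)] Comp_assoc[OF th(2) b(3) U(4)] B(5) th(1) by simp
      finally show ?thesis using th by blast
    qed
    moreover have "set (Us1 @ Us2) \<subseteq> S" using Us(1) U(3) by auto
    ultimately have "P (length (Us1 @ Us2))" unfolding P_def using Us(2) gj by blast
    then have "length Us \<le> length (Us1 @ Us2)" unfolding U(1) by (rule Least_le)
    then show False using Us(1) by simp
  qed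
  moreover have "\<exists>h' \<in> Hom C V U. h = g \<cdot> h'" if V: "V \<in> add_of C S" "h \<in> Hom C V M" for V h
  proof -
    obtain Vs where "is_direct_sum C V Vs" "set Vs \<subseteq> S" using add_of_decomposition[OF assms(2) V(1)] .
    then show ?thesis using factor_through_right[OF U(4)] approx V(2) by blast
  qed
  ultimately have "minimal_right_approx C (add_of C S) U M g"
    unfolding minimal_right_approx_def using U direct_sum_in_add_of by blast
  then show ?thesis by (rule that)
qed

lemma minimal_left_approx_exists:
  assumes "finite S" "\<forall>B \<in> S. local_End C B"
  obtains U g where "minimal_left_approx C (add_of C S) M U g"
proof -
  define P where "P n \<longleftrightarrow> (\<exists>U Us g. length Us = n \<and> is_direct_sum C U Us \<and> set Us \<subseteq> S \<and> g \<in> Hom C M U \<and>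
    (\<forall>B \<in> S. \<forall>h \<in> Hom C M B. \<exists>h' \<in> Hom C U B. h = h' \<cdot> g))" for n
  have "\<exists>n. P n" using left_approx_exists[OF assms(1), of M] unfolding P_def by blast
  then have "P (LEAST n. P n)" by (rule LeastI_ex)
  then obtain U Us g where U: "length Us = (LEAST n. P n)" "is_direct_sum C U Us" "set Us \<subseteq> S" "g \<in> Hom C M U"
    and approx: "\<forall>B \<in> S. \<forall>h \<in> Hom C M B. \<exists>h' \<in> Hom C U B. h = h' \<cdot> g" unfolding P_def by blast
  have "is_iso C U U \<phi>" if phi: "\<phi> \<in> Hom C U U" "\<phi> \<cdot> g = g" for \<phi>
  proof (rule ccontr)
    assume "\<not> is_iso C U U \<phi>"
    then obtain B s p where B: "local_End C B" "s \<in> Hom C B U" "p \<in> Hom C U B" "p \<cdot> s = ident C B" "p \<cdot> g = 0"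
      using not_left_minimal_summand[OF U(4) phi] by blast
    obtain U2 j q where U2: "biproduct U B U2 s p j q" using split_mono_complement[OF B(2-4)] .
    note b = biproductD[OF U2]
    obtain Us1 Z Us2 where Us: "Us = Us1 @ Z # Us2" "is_direct_sum C U2 (Us1 @ Us2)"
      using exchange[OF B(1) U2 U(2)] U(3) assms(2) by blast
    have qg: "q \<cdot> g \<in> Hom C M U2" using Comp_in_Hom[OF U(4) b(4)] .
    have "j \<cdot> (q \<cdot> g) = g" using biproduct_elements(5)[OF U2 U(4)] B(5) b(1) by simp
    then have "\<exists>h' \<in> Hom C U2 B'. h = h' \<cdot> (q \<cdot> g)" if B': "B' \<in> S" "h \<in> Hom C M B'" for B' h
    proof -
      obtain h' where h': "h' \<in> Hom C U B'" "h = h' \<cdot> g" using approx B' by blast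
      then have "h = (h' \<cdot> j) \<cdot> (q \<cdot> g)" using Comp_assoc[OF qg b(3) h'(1)] \<open>j \<cdot> (q \<cdot> g) = g\<close> by simp
      then show ?thesis using Comp_in_Hom[OF b(3) h'(1)] by blast
    qed
    moreover have "set (Us1 @ Us2) \<subseteq> S" using Us(1) U(3) by auto
    ultimately have "P (length (Us1 @ Us2))" unfolding P_def using Us(2) qg by blast
    then have "length Us \<le> length (Us1 @ Us2)" unfolding U(1) by (rule Least_le)
    then show False using Us(1) by simp
  qed
  moreover have "\<exists>h' \<in> Hom C U V. h = h' \<cdot> g" if V: "V \<in> add_of C S" "h \<in> Hom C M V" for V h
  proof -
    obtain Vs where "is_direct_sum C V Vs" "set Vs \<subseteq> S" using add_of_decomposition[OF assms(2) V(1)] .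
    then show ?thesis using factor_through_left[OF U(4)] approx V(2) by blast
  qed
  ultimately have "minimal_left_approx C (add_of C S) M U g"
    unfolding minimal_left_approx_def using U direct_sum_in_add_of by blast
  then show ?thesis by (rule that)
qed

end

section \<open>Consequences of the 2-Calabi-Yau property\<close>

lemma int_iterate_0 [simp]: "int_iterate 0 f x = x"
  by (simp add: int_iterate_def)

lemma int_iterate_1 [simp]: "int_iterate 1 f x = f x"
  by (simp add: int_iterate_def)

lemma int_iterate_2 [simp]: "int_iterate 2 f x = f (f x)"
  by (simp add: int_iterate_def numeral_2_eq_2)

section \<open>Dual spaces and vanishing of Ext^1\<close>

context triangulated_category
begin

lemma Ext_simps: "Ext C 0 X Y = Hom C X Y" "Ext C 1 X Y = Hom C X (shO C Y)" "Ext C 2 X Y = Hom C X (shO C (shO C Y))"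
  by (simp_all add: Ext_def)

lemma dual_zero: "\<xi> \<in> dual C V \<Longrightarrow> 0 \<in> V \<Longrightarrow> \<xi> 0 = 0"
proof -
  assume "\<xi> \<in> dual C V" "0 \<in> V"
  then have "\<xi> (smul C 0 0) = 0 * \<xi> 0" unfolding dual_def by blast
  then show ?thesis by simp
qed

lemma dual_eq_zeroI: "\<lbrakk>\<xi> \<in> dual C V; \<And>x. x \<in> V \<Longrightarrow> \<xi> x = 0\<rbrakk> \<Longrightarrow> \<xi> = (\<lambda>_. 0)"
  unfolding dual_def by (rule ext) blast

lemma zero_in_dual: "(\<lambda>_. 0) \<in> dual C V"
  unfolding dual_def by simp

lemma pullback_in_dual:
  assumes "\<xi> \<in> dual C (Hom C M V)" "f \<in> Hom C M W"
  shows "pullback (Hom C W V) (\<lambda>x. x \<cdot> f) \<xi> \<in> dual C (Hom C W V)"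
proof -
  have \<xi>: "\<And>x y. \<lbrakk>x \<in> Hom C M V; y \<in> Hom C M V\<rbrakk> \<Longrightarrow> \<xi> (x + y) = \<xi> x + \<xi> y"
    "\<And>c x. x \<in> Hom C M V \<Longrightarrow> \<xi> (smul C c x) = c * \<xi> x"
    using assms(1) unfolding dual_def by auto
  show ?thesis
    unfolding dual_def pullback_def
    using \<xi> assms(2) add_in_Hom subspace_scale[OF Hom_subspace]
    by (auto simp: Comp_add_left[OF assms(2)] Comp_smul_left[OF assms(2)] Comp_in_Hom)
qed

text \<open>Vanishing of \<open>Ext\<^sup>1\<close>.\<close>

definition orth :: "'o \<Rightarrow> 'o \<Rightarrow> bool" where
  "orth X Y \<longleftrightarrow> (\<forall>x \<in> Hom C X (shO C Y). x = 0)"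

lemma orthD: "\<lbrakk>orth X Y; x \<in> Hom C X (shO C Y)\<rbrakk> \<Longrightarrow> x = 0"
  unfolding orth_def by blast

lemma rigid_iff_orth: "rigid C T \<longleftrightarrow> orth T T"
  unfolding rigid_def orth_def Ext_simps using zero_in_Hom by blast

lemma orth_retract:
  assumes "orth X Z" "i \<in> Hom C A X" "p \<in> Hom C X A" "p \<cdot> i = ident C A"
  shows "orth A Z"
  unfolding orth_def
proof
  fix x assume x: "x \<in> Hom C A (shO C Z)"
  have "x \<cdot> p = 0" using orthD[OF assms(1)] Comp_in_Hom[OF assms(3) x] by blast
  then show "x = 0" using Comp_assoc[OF assms(2,3) x] assms(2,4) Comp_ident_right[OF x] by simp
qed

lemma orth_isomorphic: "\<lbrakk>orth X Z; isomorphic C X A\<rbrakk> \<Longrightarrow> orth A Z"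
  using orth_retract unfolding isomorphic_def is_iso_def by metis

lemma orth_direct_sum:
  assumes "\<And>B. B \<in> S \<Longrightarrow> orth B Z" "is_direct_sum C V Vs" "set Vs \<subseteq> S"
  shows "orth V Z"
  unfolding orth_def
proof
  fix x assume x: "x \<in> Hom C V (shO C Z)"
  \<comment> \<open>A map that factors through zero is zero, so the factorization lemma applies with
    the zero map in the role of the approximation.\<close>
  have "\<exists>h' \<in> Hom C V V. x = 0 \<cdot> h'"
  proof (rule factor_through_right[OF zero_in_Hom _ assms(2,3) x])
    fix B h assume "B \<in> S" "h \<in> Hom C B (shO C Z)"
    then have "h = 0" using orthD assms(1) by blast
    then show "\<exists>h' \<in> Hom C B V. h = 0 \<cdot> h'" by (intro bexI[of _ 0]) (auto intro: Comp_zero_left[symmetric])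
  qed
  then show "x = 0" by auto
qed

end

section \<open>Duality, and maximal rigid preclusters in terms of \<open>orth\<close>\<close>

locale two_Calabi_Yau_triangulated = hom_finite_krull_schmidt C
  for C :: "('k::field, 'o, 'm::ab_group_add) tricat" (structure) +
  assumes CY: "two_Calabi_Yau C"
begin

text \<open>If Ext^1(X, Y) vanishes, its dual has one element, and so has Ext^1(Y, X), which is in
  bijection with it because \<open>2 - 1 = 1\<close>.\<close>

lemma orth_sym: "orth X Y \<Longrightarrow> orth Y X"
proof -
  assume o: "orth X Y"
  obtain \<Phi> where "\<forall>i X Y. bij_betw (\<Phi> i X Y) (dual C (Ext C i X Y)) (Ext C (2 - i) Y X)"
    using CY unfolding two_Calabi_Yau_def by (elim exE conjE) (rule that)
  from this[rule_format, of 1 X Y] have bij: "bij_betw (\<Phi> 1 X Y) (dual C (Hom C X (shO C Y))) (Hom C Y (shO C X))"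
    by (simp add: Ext_simps)
  have "\<xi> = (\<lambda>_. 0)" if xi: "\<xi> \<in> dual C (Hom C X (shO C Y))" for \<xi>
  proof (rule dual_eq_zeroI[OF xi])
    fix x assume "x \<in> Hom C X (shO C Y)"
    then have "x = 0" using orthD[OF o] by blast
    then show "\<xi> x = 0" using dual_zero[OF xi] by simp
  qed
  then have "x = \<Phi> 1 X Y (\<lambda>_. 0)" if "x \<in> Hom C Y (shO C X)" for x
    using bij that unfolding bij_betw_def by force
  then show "orth Y X" unfolding orth_def using zero_in_Hom by metis
qed

text \<open>In the exact sequence Ext^1(V, W) -> Ext^1(V, X) -> Ext^2(V, M) -> Ext^2(V, W) the last
  map is dual to Hom(W, V) -> Hom(M, V). The latter is surjective by \<open>ext\<close>, so the
  former is injective, and Ext^1(V, W) = 0 leaves nothing for Ext^1(V, X).\<close>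

lemma orth_cone:
  assumes T: "tri C M W X f g h" and ext: "\<And>x. x \<in> Hom C M V \<Longrightarrow> \<exists>y \<in> Hom C W V. x = y \<cdot> f" and W: "orth V W"
  shows "orth V X"
  unfolding orth_def
proof
  note t = tri_Hom[OF T]
  fix x assume x: "x \<in> Hom C V (shO C X)"
  obtain \<Phi> where bij: "\<forall>i X Y. bij_betw (\<Phi> i X Y) (dual C (Ext C i X Y)) (Ext C (2 - i) Y X)"
    and add: "\<forall>i X Y. \<forall>\<xi> \<in> dual C (Ext C i X Y). \<forall>\<eta> \<in> dual C (Ext C i X Y).
        \<Phi> i X Y (\<lambda>x. \<xi> x + \<eta> x) = \<Phi> i X Y \<xi> + \<Phi> i X Y \<eta>"
    and nat: "\<forall>i X X' Y. \<forall>a \<in> Hom C X' X. \<forall>\<xi> \<in> dual C (Ext C i X' Y).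
        \<Phi> i X Y (pullback (Ext C i X Y) (\<lambda>x. x \<cdot> a) \<xi>) = int_iterate (2 - i) (shM C) a \<cdot> \<Phi> i X' Y \<xi>"
    using CY unfolding two_Calabi_Yau_def by (elim exE conjE) (rule that)
  have bM: "bij_betw (\<Phi> 0 M V) (dual C (Hom C M V)) (Hom C V (shO C (shO C M)))"
    and bW: "bij_betw (\<Phi> 0 W V) (dual C (Hom C W V)) (Hom C V (shO C (shO C W)))"
    using bij[rule_format, of 0 M V] bij[rule_format, of 0 W V] by (simp_all add: Ext_simps)
  have zero: "\<Phi> 0 Y V (\<lambda>_. 0) = 0" for Y
    using add[rule_format, of "\<lambda>_. 0" 0 Y V "\<lambda>_. 0"] zero_in_dual by simp
  define y where "y = shM C h \<cdot> x"
  note sh = shM_in_Hom[OF t(3)] and ssf = shM_in_Hom[OF shM_in_Hom[OF t(1)]]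
  have y: "y \<in> Hom C V (shO C (shO C M))" unfolding y_def using Comp_in_Hom[OF x sh] .
  have "shM C (shM C f) \<cdot> y = shM C (shM C f \<cdot> h) \<cdot> x"
    using Comp_assoc[OF x sh ssf] shM_Comp[OF t(3) shM_in_Hom[OF t(1)]] by (simp add: y_def)
  then have fy: "shM C (shM C f) \<cdot> y = 0" using tri_Comp_zero(3)[OF T] x by simp
  \<comment> \<open>\<open>\<xi>\<close> is the functional on Hom(M, V) that corresponds to
    \<open>y\<close>. Naturality turns \<open>f[2] y = 0\<close> into the vanishing of
    \<open>\<xi>\<close> on all maps \<open>z f\<close>, and by \<open>ext\<close> these are all
    maps from \<open>M\<close> to \<open>V\<close>.\<close>
  obtain \<xi> where \<xi>: "\<xi> \<in> dual C (Hom C M V)" "y = \<Phi> 0 M V \<xi>"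
    using bM y unfolding bij_betw_def by blast
  let ?p = "pullback (Hom C W V) (\<lambda>x. x \<cdot> f) \<xi>"
  have "\<Phi> 0 W V ?p = 0"
    using nat[rule_format, OF t(1), of \<xi> 0 V] \<xi> fy by (simp add: Ext_simps)
  then have "?p = (\<lambda>_. 0)"
    using bW pullback_in_dual[OF \<xi>(1) t(1)] zero zero_in_dual unfolding bij_betw_def by (metis inj_onD)
  then have 1: "\<xi> (z \<cdot> f) = 0" if "z \<in> Hom C W V" for z
    using that unfolding pullback_def by metis
  have "\<xi> = (\<lambda>_. 0)"
    by (rule dual_eq_zeroI[OF \<xi>(1)]) (use ext 1 in metis)
  then have "shM C h \<cdot> x = 0" using \<xi>(2) zero by (simp add: y_def)
  then obtain w where w: "w \<in> Hom C V (shO C W)" "x = (- shM C g) \<cdot> w"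
    using tri_factor_through_third[OF rotate[OF rotate[OF T]] x] by blast
  then have "w = 0" using orthD[OF W] by blast
  then show "x = 0" using w minus_in_Hom[OF shM_in_Hom[OF t(2)]] by simp
qed

lemma orth_add_of:
  assumes "\<forall>B \<in> S. local_End C B" "\<And>B. B \<in> S \<Longrightarrow> orth B Z" "V \<in> add_of C S"
  shows "orth V Z" "orth Z V"
proof -
  obtain Vs where "is_direct_sum C V Vs" "set Vs \<subseteq> S" using add_of_decomposition[OF assms(1,3)] .
  then show "orth V Z" using orth_direct_sum assms(2) by blast
  then show "orth Z V" by (rule orth_sym)
qed

lemma mult_direct_sum: "is_direct_sum C Y Ys \<Longrightarrow> mult Y L = (\<Sum>Z\<leftarrow>Ys. mult Z L)"
proof (induction Ys arbitrary: Y)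
  case Nil
  then show ?case using mult_zero_object is_direct_sum_Nil by simp
next
  case (Cons A Ys)
  then obtain R i p j q where "biproduct Y A R i p j q" "is_direct_sum C R Ys" unfolding is_direct_sum_Cons by blast
  then show ?case using Cons.IH mult_biproduct by simp
qed

lemma mult_direct_sum_pos:
  assumes "is_direct_sum C Y Ys"
  shows "0 < mult Y L \<longleftrightarrow> (\<exists>Z \<in> set Ys. 0 < mult Z L)"
proof -
  have "mult Y L = 0 \<longleftrightarrow> (\<forall>Z \<in> set Ys. mult Z L = 0)" using mult_direct_sum[OF assms] by simp
  then show ?thesis by auto
qed

text \<open>Members of \<open>add_of C {T}\<close> must be summands of sums of copies of
  \<open>T\<close>; one copy of \<open>T\<close> is spent for each entry of the list.\<close>

lemma summand_of_copies:
  assumes "is_direct_sum C X Xs" "\<And>Z. Z \<in> set Xs \<Longrightarrow> summand C Z T"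
  shows "\<exists>Y. is_direct_sum C Y (replicate (length Xs) T) \<and> summand C X Y"
  using assms
proof (induction Xs arbitrary: X)
  case Nil
  then show ?case using summand_refl by auto
next
  case (Cons A Xs)
  obtain R i p j q where X: "biproduct X A R i p j q" and R: "is_direct_sum C R Xs"
    using Cons.prems(1) unfolding is_direct_sum_Cons by blast
  obtain Y' where Y': "is_direct_sum C Y' (replicate (length Xs) T)" "summand C R Y'" using Cons.IH[OF R] Cons.prems(2) by auto
  obtain Y i' p' j' q' where Y: "biproduct Y T Y' i' p' j' q'" by (rule biproduct_exists)
  note b = biproductD[OF X] and c = biproductD[OF Y]
  obtain a a' where a: "a \<in> Hom C A T" "a' \<in> Hom C T A" "a' \<cdot> a = ident C A"
    using Cons.prems(2) summand_iff_retract by (metis list.set_intros(1))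
  obtain r r' where r: "r \<in> Hom C R Y'" "r' \<in> Hom C Y' R" "r' \<cdot> r = ident C R"
    using Y'(2) summand_iff_retract by metis
  obtain F where F: "F \<in> Hom C X Y" "F \<cdot> i = i' \<cdot> a" "F \<cdot> j = j' \<cdot> r" using biproduct_map[OF X Y a(1) r(1)] by metis
  obtain G where G: "G \<in> Hom C Y X" "G \<cdot> i' = i \<cdot> a'" "G \<cdot> j' = j \<cdot> r'" using biproduct_map[OF Y X a(2) r(2)] by metis
  have "G \<cdot> F = ident C X"
  proof (rule biproduct_eqI_from[OF X Comp_in_Hom[OF F(1) G(1)] ident_in_Hom])
    show "G \<cdot> F \<cdot> i = ident C X \<cdot> i"
      using Comp_assoc[OF b(1) F(1) G(1)] Comp_assoc[OF a(1) c(1) G(1)] Comp_assoc[OF a(1,2) b(1)] F G a b(1)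
        Comp_ident_left[OF b(1)] Comp_ident_right[OF b(1)] by simp
    show "G \<cdot> F \<cdot> j = ident C X \<cdot> j"
      using Comp_assoc[OF b(3) F(1) G(1)] Comp_assoc[OF r(1) c(3) G(1)] Comp_assoc[OF r(1,2) b(3)] F G r b(3)
        Comp_ident_left[OF b(3)] Comp_ident_right[OF b(3)] by simp
  qed
  then have "summand C X Y" using summand_iff_retract F(1) G(1) by blast
  moreover have "is_direct_sum C Y (T # replicate (length Xs) T)"
    using Y Y'(1) is_direct_sum_Cons by blast
  ultimately show ?case by auto
qed

text \<open>Trades the maximal rigid object for a finite set with pairwise vanishing Ext^1 and with
  maximality tested on indecomposable objects only. Closure of \<open>orth\<close> under summands
  and sums is proved in the first argument, and \<open>orth_sym\<close> carries it to the
  second.\<close>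

lemma maximal_rigid_precluster_iff:
  "S \<in> maximal_rigid_preclusters C \<longleftrightarrow> finite S \<and> (\<forall>B \<in> S. local_End C B) \<and>
     (\<forall>B \<in> S. \<forall>B' \<in> S. isomorphic C B B' \<longrightarrow> B = B') \<and> (\<forall>B \<in> S. \<forall>B' \<in> S. orth B B') \<and>
     (\<forall>X. local_End C X \<longrightarrow> (\<forall>B \<in> S. orth B X) \<longrightarrow> orth X X \<longrightarrow> (\<exists>B \<in> S. isomorphic C X B))"
proof
  assume "S \<in> maximal_rigid_preclusters C"
  then obtain T where T: "rigid C T" "\<And>X S. is_direct_sum C S [T, X] \<Longrightarrow> rigid C S \<Longrightarrow> X \<in> add_of C {T}"
    and loc: "\<forall>B \<in> S. local_End C B" and noniso: "\<forall>B \<in> S. \<forall>B' \<in> S. isomorphic C B B' \<longrightarrow> B = B'"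
    and summands: "\<forall>B \<in> S. summand C B T"
    and all: "\<And>M. local_End C M \<Longrightarrow> summand C M T \<Longrightarrow> (\<exists>N \<in> S. isomorphic C M N)"
    unfolding maximal_rigid_preclusters_def maximal_rigid_def represents_summands_def
      nonisomorphic_indecomposables_def indecomposable_iff_local_End by blast
  obtain Ts where Ts: "is_direct_sum C T Ts" "\<forall>Y \<in> set Ts. local_End C Y" by (rule KS_decomposition)
  have "\<exists>Z \<in> set Ts. isomorphic C B Z" if B: "B \<in> S" for B
  proof -
    have "0 < mult T B" using B loc summands mult_pos_iff_summand by blast
    then have "filter (isomorphic C B) Ts \<noteq> []" using mult_eq[OF Ts] by auto
    then show ?thesis by (auto simp: filter_empty_conv)
  qed
  \<comment> \<open>Sending each member of \<open>S\<close> to an isomorphic entry of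
    \<open>Ts\<close> is injective, since distinct members of \<open>S\<close> are not isomorphic;
    hence \<open>S\<close> is finite.\<close>
  then obtain h where h: "\<And>B. B \<in> S \<Longrightarrow> h B \<in> set Ts \<and> isomorphic C B (h B)" by metis
  have inj: "inj_on h S" using h noniso isomorphic_trans isomorphic_sym unfolding inj_on_def by metis
  have "h ` S \<subseteq> set Ts" using h by blast
  then have fin: "finite S" using finite_imageD[OF _ inj] finite_subset by blast
  have orthT: "orth B Z" if "B \<in> S" "orth T Z" for B Z
    using summands that orth_retract summand_iff_retract by metis
  have oTT: "orth T T" using T(1) rigid_iff_orth by blast
  have orth: "orth B B'" if "B \<in> S" "B' \<in> S" for B B'
    using orthT[OF that(1)] orth_sym[OF orthT[OF that(2) oTT]] by blast
  have max: "\<exists>B \<in> S. isomorphic C X B" if X: "local_End C X" "\<forall>B \<in> S. orth B X" "orth X X" for X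
  proof -
    have "T \<in> add_of C S" using add_of_iff_mult[OF loc] all mult_pos_iff_summand by blast
    then have TX: "orth T X" using orth_add_of[OF loc] X(2) by blast
    obtain Y where Y: "is_direct_sum C Y [T, X]" using ex_direct_sum by blast
    have "orth Y T" "orth Y X" using orth_direct_sum[OF _ Y, of "{T, X}"] oTT TX orth_sym[OF TX] X(3) by auto
    then have "orth Y Y" using orth_direct_sum[OF _ Y, of "{T, X}" Y] orth_sym by auto
    then have "X \<in> add_of C {T}" using T(2)[OF Y] rigid_iff_orth by blast
    then obtain Z Zs where Z: "set Zs \<subseteq> {T}" "is_direct_sum C Z Zs" "summand C X Z" unfolding add_of_def by blast
    have "0 < mult Z X" using Z(3) mult_pos_iff_summand[OF X(1)] by blast
    then have "0 < mult T X" using mult_direct_sum_pos[OF Z(2)] Z(1) by auto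
    then show ?thesis using all X(1) mult_pos_iff_summand by blast
  qed
  show "finite S \<and> (\<forall>B \<in> S. local_End C B) \<and> (\<forall>B \<in> S. \<forall>B' \<in> S. isomorphic C B B' \<longrightarrow> B = B') \<and> (\<forall>B \<in> S. \<forall>B' \<in> S. orth B B') \<and>
     (\<forall>X. local_End C X \<longrightarrow> (\<forall>B \<in> S. orth B X) \<longrightarrow> orth X X \<longrightarrow> (\<exists>B \<in> S. isomorphic C X B))"
    by (intro conjI allI impI) (fact fin, fact loc, fact noniso, (use orth in blast), rule max)
next
  assume *: "finite S \<and> (\<forall>B \<in> S. local_End C B) \<and> (\<forall>B \<in> S. \<forall>B' \<in> S. isomorphic C B B' \<longrightarrow> B = B') \<and> (\<forall>B \<in> S. \<forall>B' \<in> S. orth B B') \<and>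
     (\<forall>X. local_End C X \<longrightarrow> (\<forall>B \<in> S. orth B X) \<longrightarrow> orth X X \<longrightarrow> (\<exists>B \<in> S. isomorphic C X B))"
  then have fin: "finite S" by (rule conjunct1)
  have loc: "\<forall>B \<in> S. local_End C B" and noniso: "\<forall>B \<in> S. \<forall>B' \<in> S. isomorphic C B B' \<longrightarrow> B = B'"
    and orth: "\<forall>B \<in> S. \<forall>B' \<in> S. orth B B'"
    and max: "\<forall>X. local_End C X \<longrightarrow> (\<forall>B \<in> S. orth B X) \<longrightarrow> orth X X \<longrightarrow> (\<exists>B \<in> S. isomorphic C X B)"
    using * by simp_all
  obtain Ts where Ts: "set Ts = S" using finite_list[OF fin] by blast
  obtain T where T: "is_direct_sum C T Ts" using direct_sum_exists by blast
  have summands: "summand C B T" if "B \<in> S" for B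
    using direct_sum_member_retract[OF T] that Ts summand_iff_retract by blast
  have orthT: "orth T Z" if "\<forall>B \<in> S. orth B Z" for Z using orth_direct_sum[OF _ T, of S] Ts that by auto
  have "orth T T" using orthT orth orth_sym by blast
  moreover have "X \<in> add_of C {T}" if Y: "is_direct_sum C Y [T, X]" "rigid C Y" for X Y
  proof -
    obtain i p where ip: "i \<in> Hom C X Y" "p \<in> Hom C Y X" "p \<cdot> i = ident C X"
      using direct_sum_member_retract[OF Y(1)] by (metis list.set_intros)
    obtain i' p' where ip': "i' \<in> Hom C T Y" "p' \<in> Hom C Y T" "p' \<cdot> i' = ident C T"
      using direct_sum_member_retract[OF Y(1)] by (metis list.set_intros)
    have YY: "orth Y Y" using Y(2) rigid_iff_orth by blast
    have XY: "orth X Y" using orth_retract[OF YY ip] .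
    have TX: "orth T X" using orth_retract[OF orth_sym[OF XY] ip'] .
    have XX: "orth X X" using orth_retract[OF orth_sym[OF XY] ip] .
    have "\<exists>B \<in> S. isomorphic C L B" if L: "local_End C L" "0 < mult X L" for L
    proof -
      obtain a b where ab: "a \<in> Hom C L X" "b \<in> Hom C X L" "b \<cdot> a = ident C L" using L mult_pos_iff by blast
      have "orth L L" using orth_retract[OF orth_sym[OF orth_retract[OF XX ab]] ab] .
      moreover have "orth B L" if "B \<in> S" for B
        using orth_retract[OF orth_sym[OF TX] ab] summands[OF that] orth_sym orth_retract summand_iff_retract by metis
      ultimately show ?thesis using max L(1) by blast
    qed
    then obtain Xs where Xs: "is_direct_sum C X Xs" "set Xs \<subseteq> S" using decomposition_of_mult[of X S] by blast
    then obtain Z where "is_direct_sum C Z (replicate (length Xs) T)" "summand C X Z"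
      using summand_of_copies[OF Xs(1)] summands by blast
    moreover have "set (replicate (length Xs) T) \<subseteq> {T}" by auto
    ultimately show ?thesis unfolding add_of_def by blast
  qed
  ultimately have "maximal_rigid C T" unfolding maximal_rigid_def rigid_iff_orth by blast
  moreover have "\<exists>N \<in> S. isomorphic C M N" if M: "local_End C M" "summand C M T" for M
  proof -
    have "0 < mult T M" using M mult_pos_iff_summand by blast
    then have "filter (isomorphic C M) Ts \<noteq> []" using mult_eq[OF T] loc Ts by auto
    then show ?thesis using Ts by (auto simp: filter_empty_conv)
  qed
  ultimately show "S \<in> maximal_rigid_preclusters C"
    unfolding maximal_rigid_preclusters_def represents_summands_def
      nonisomorphic_indecomposables_def indecomposable_iff_local_End using loc noniso summands by blast
qed

end

section \<open>Complements of almost complete maximal rigid objects\<close>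

context two_Calabi_Yau_triangulated
begin

lemma tri_iso_first:
  assumes T: "tri C X Y Z f g h" and m: "is_iso C X' X m"
  shows "\<exists>h'. tri C X' Y Z (f \<cdot> m) g h'"
proof -
  note t = tri_Hom[OF T]
  obtain m' where m': "m \<in> Hom C X' X" "m' \<in> Hom C X X'" "m' \<cdot> m = ident C X'" "m \<cdot> m' = ident C X" "is_iso C X X' m'"
    using m by (rule is_isoE)
  have "tri C X' Y Z (f \<cdot> m) g (shM C m' \<cdot> h)"
  proof (rule tri_iso[OF T m'(5) is_iso_ident is_iso_ident])
    show "ident C Y \<cdot> f = f \<cdot> m \<cdot> m'"
      using Comp_assoc[OF m'(2,1) t(1)] m'(4) Comp_ident_left[OF t(1)] Comp_ident_right[OF t(1)] by simp
    show "ident C Z \<cdot> g = g \<cdot> ident C Y" using Comp_ident_left[OF t(2)] Comp_ident_right[OF t(2)] by simp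
    show h': "shM C m' \<cdot> h \<in> Hom C Z (shO C X')" using Comp_in_Hom[OF t(3) shM_in_Hom[OF m'(2)]] .
    show "shM C m' \<cdot> h = shM C m' \<cdot> h \<cdot> ident C Z" using Comp_ident_right[OF h'] by simp
  qed (use t m' in \<open>auto intro: Comp_in_Hom\<close>)
  then show ?thesis by blast
qed

lemma tri_iso_third:
  assumes T: "tri C X Y Z f g h" and m: "is_iso C Z Z' m"
  shows "\<exists>h'. tri C X Y Z' f (m \<cdot> g) h'"
proof -
  note t = tri_Hom[OF T]
  obtain m' where m': "m \<in> Hom C Z Z'" "m' \<in> Hom C Z' Z" "m' \<cdot> m = ident C Z" "m \<cdot> m' = ident C Z'"
    using m by (rule is_isoE)
  have "tri C X Y Z' f (m \<cdot> g) (h \<cdot> m')"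
  proof (rule tri_iso[OF T is_iso_ident is_iso_ident m])
    show "ident C Y \<cdot> f = f \<cdot> ident C X" using Comp_ident_left[OF t(1)] Comp_ident_right[OF t(1)] by simp
    show mg: "m \<cdot> g \<in> Hom C Y Z'" using Comp_in_Hom[OF t(2) m'(1)] .
    show "m \<cdot> g = m \<cdot> g \<cdot> ident C Y" using Comp_ident_right[OF mg] by simp
    show "shM C (ident C X) \<cdot> h = h \<cdot> m' \<cdot> m"
      using Comp_assoc[OF m'(1,2) t(3)] m'(3) Comp_ident_left[OF t(3)] Comp_ident_right[OF t(3)] by (simp add: shM_ident)
  qed (use t m' in \<open>auto intro: Comp_in_Hom\<close>)
  then show ?thesis by blast
qed

lemma local_End_in_add_of:
  assumes "\<forall>B \<in> S. local_End C B" "local_End C M" "M \<in> add_of C S"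
  shows "\<exists>B \<in> S. isomorphic C M B"
  using add_of_iff_mult[OF assms(1)] assms(2,3) mult_local_End[OF assms(2), of M] by auto

lemma member_in_add_of: "B \<in> S \<Longrightarrow> B \<in> add_of C S"
  using direct_sum_in_add_of[OF is_direct_sum_single, of B S] by simp

lemma isomorphic_in_add_of:
  assumes "\<forall>B \<in> S. local_End C B" "X \<in> add_of C S" "isomorphic C X Y"
  shows "Y \<in> add_of C S"
  using assms(2) mult_isomorphic[OF assms(3)] unfolding add_of_iff_mult[OF assms(1)] by simp

lemma retract_in_add_of:
  assumes "\<forall>B \<in> S. local_End C B" "X \<in> add_of C S" "i \<in> Hom C A X" "p \<in> Hom C X A" "p \<cdot> i = ident C A"
  shows "A \<in> add_of C S"
proof -
  obtain Y j q where Y: "biproduct X A Y i p j q" using split_mono_complement[OF assms(3-5)] .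
  show ?thesis
    using assms(2) mult_biproduct[OF Y] unfolding add_of_iff_mult[OF assms(1)] by simp
qed

lemma split_epi_of_zero:
  assumes T: "tri C N U M f g h" and "h = 0"
  shows "\<exists>d \<in> Hom C M U. g \<cdot> d = ident C M"
  using tri_factor_through_middle[OF T ident_in_Hom] assms(2) Comp_zero_left[OF ident_in_Hom] by metis

lemma zero_of_split_mono:
  assumes T: "tri C N U M f g h" and c: "c \<in> Hom C U N" "c \<cdot> f = ident C N"
  shows "h = 0"
proof -
  note t = tri_Hom[OF T]
  have "h = shM C (c \<cdot> f) \<cdot> h" using c(2) Comp_ident_left[OF t(3)] by (simp add: shM_ident)
  also have "\<dots> = shM C c \<cdot> (shM C f \<cdot> h)"
    using shM_Comp[OF t(1) c(1)] Comp_assoc[OF t(3) shM_in_Hom[OF t(1)] shM_in_Hom[OF c(1)]] by simp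
  also have "\<dots> = 0" using tri_Comp_zero(3)[OF T] shM_in_Hom[OF c(1)] by simp
  finally show ?thesis .
qed

text \<open>The obstruction to lifting \<open>k\<close> along \<open>g\<close> is
  \<open>h k\<close>, an element of Ext^1(V, N).\<close>

lemma right_approx_of_orth:
  assumes T: "tri C N U M f g h" and o: "orth V N" and k: "k \<in> Hom C V M"
  shows "\<exists>k' \<in> Hom C V U. k = g \<cdot> k'"
proof -
  note t = tri_Hom[OF T]
  have "h \<cdot> k = 0" using orthD[OF o] Comp_in_Hom[OF k t(3)] by blast
  then show ?thesis using tri_factor_through_middle[OF T k] by metis
qed

text \<open>The obstruction to extending \<open>k\<close> over \<open>f\<close> is
  \<open>k[1] h\<close>, an element of Ext^1(M, V).\<close>

lemma left_approx_of_orth: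
  assumes T: "tri C N U M f g h" and o: "orth M V" and k: "k \<in> Hom C N V"
  shows "\<exists>k' \<in> Hom C U V. k = k' \<cdot> f"
proof -
  note t = tri_Hom[OF T]
  have "shM C k \<cdot> h = 0" using orthD[OF o] Comp_in_Hom[OF t(3) shM_in_Hom[OF k]] by blast
  then show ?thesis using tri_extend_first[OF T k] by metis
qed

text \<open>Exactness of Hom(V, U) -> Hom(V, M) -> Ext^1(V, N) -> Ext^1(V, U), where
  \<open>lift\<close> says that the first map is surjective.\<close>

lemma orth_cocone:
  assumes T: "tri C N U M f g h" and o: "orth V U" and lift: "\<And>k. k \<in> Hom C V M \<Longrightarrow> \<exists>k' \<in> Hom C V U. k = g \<cdot> k'"
  shows "orth V N"
  unfolding orth_def
proof
  note t = tri_Hom[OF T]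
  fix x assume x: "x \<in> Hom C V (shO C N)"
  have "shM C f \<cdot> x = 0" using orthD[OF o] Comp_in_Hom[OF x shM_in_Hom[OF t(1)]] by blast
  then obtain y where y: "y \<in> Hom C V M" "x = h \<cdot> y" using tri_factor_through_third[OF T x] by metis
  then obtain z where z: "z \<in> Hom C V U" "y = g \<cdot> z" using lift by blast
  then show "x = 0" using y Comp_assoc[OF z(1) t(2,3)] tri_Comp_zero(2)[OF T] by simp
qed

text \<open>For Ext^1(N, N), a map \<open>N -> M\<close> extends over \<open>f\<close> because
  \<open>M\<close> is rigid, and the extension lifts along \<open>g\<close> because its source
  \<open>U\<close> lies in \<open>add S\<close>. So every map \<open>N -> M\<close> lifts, and
  \<open>orth_cocone\<close> applies.\<close>

lemma rigid_cocone:
  assumes loc: "\<forall>B \<in> S. local_End C B" and orth: "\<forall>B \<in> S. \<forall>B' \<in> S. orth B B'"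
    and T: "tri C N U M f g h" and U: "U \<in> add_of C S"
    and lift: "\<And>V k. V \<in> add_of C S \<Longrightarrow> k \<in> Hom C V M \<Longrightarrow> \<exists>k' \<in> Hom C V U. k = g \<cdot> k'" and M: "orth M M"
  shows "B \<in> S \<Longrightarrow> orth B N" "orth N N"
proof -
  note t = tri_Hom[OF T]
  show BN: "orth B N" if B: "B \<in> S" for B
  proof (rule orth_cocone[OF T])
    show "orth B U" using orth_add_of(2)[OF loc _ U] orth B by blast
  qed (use lift member_in_add_of[OF B] in blast)
  show "orth N N"
  proof (rule orth_cocone[OF T])
    show "orth N U" using orth_add_of(2)[OF loc BN U] .
    fix k assume k: "k \<in> Hom C N M"
    obtain b where b: "b \<in> Hom C U M" "k = b \<cdot> f" using left_approx_of_orth[OF T M k] by blast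
    obtain c where c: "c \<in> Hom C U U" "b = g \<cdot> c" using lift[OF U b(1)] by blast
    show "\<exists>k' \<in> Hom C N U. k = g \<cdot> k'"
      using b c Comp_assoc[OF t(1) c(1) t(2)] Comp_in_Hom[OF t(1) c(1)] by blast
  qed
qed

text \<open>Since \<open>M\<close> is not in \<open>add S\<close>, \<open>g\<close> is not a split
  epimorphism, so \<open>h \<noteq> 0\<close>. This makes \<open>N\<close> nonzero, keeps
  \<open>f\<close> from being a split monomorphism, and exhibits a nonzero element of Ext^1(M,
  N).\<close>

lemma exchange_right:
  assumes S: "finite S" "\<forall>B \<in> S. local_End C B" "\<forall>B \<in> S. \<forall>B' \<in> S. orth B B'"
    and M: "local_End C M" "orth M M" "\<forall>B \<in> S. orth B M" "\<forall>B \<in> S. \<not> isomorphic C M B"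
  obtains N U f g h where "tri C N U M f g h" "minimal_left_approx C (add_of C S) N U f"
    "minimal_right_approx C (add_of C S) U M g" "local_End C N" "\<forall>B \<in> S. \<not> isomorphic C N B"
    "\<forall>B \<in> S. orth B N" "orth N N" "\<not> orth M N"
proof -
  note loc = S(2)
  obtain U g where g: "minimal_right_approx C (add_of C S) U M g" using minimal_right_approx_exists[OF S(1,2)] .
  then have U: "U \<in> add_of C S" and gh: "g \<in> Hom C U M"
    and lift: "\<And>V k. \<lbrakk>V \<in> add_of C S; k \<in> Hom C V M\<rbrakk> \<Longrightarrow> \<exists>k' \<in> Hom C V U. k = g \<cdot> k'"
    and min: "\<forall>\<phi> \<in> Hom C U U. g \<cdot> \<phi> = g \<longrightarrow> is_iso C U U \<phi>"
    unfolding minimal_right_approx_def by blast+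
  obtain Z h k where "tri C U M Z g h k" using tri_complete[OF gh] by blast
  moreover obtain N where "Z = shO C N" by (rule shO_obtains)
  ultimately obtain f where T: "tri C N U M f g h" using unrotate by metis
  note t = tri_Hom[OF T]
  have "M \<notin> add_of C S" using local_End_in_add_of[OF loc M(1)] M(4) by blast
  then have nepi: "g \<cdot> d \<noteq> ident C M" if "d \<in> Hom C M U" for d
    using retract_in_add_of[OF loc U that gh] by blast
  then have h0: "h \<noteq> 0" using split_epi_of_zero[OF T] by blast
  have nmono: "c \<cdot> f \<noteq> ident C N" if "c \<in> Hom C U N" for c
    using zero_of_split_mono[OF T that] h0 by blast
  have ext: "\<exists>k' \<in> Hom C U V. k = k' \<cdot> f" if V: "V \<in> add_of C S" "k \<in> Hom C N V" for V k
    using left_approx_of_orth[OF T _ V(2)] orth_add_of(2)[OF loc _ V(1)] M(3) by blast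
  have "zero_object C N \<Longrightarrow> h = 0"
    using zero_object_Hom_to[of "shO C N" h M] zero_object_shO_iff t(3) by blast
  then have N: "local_End C N"
    using local_End_cocone[OF T M(1) _ _ _ min] h0 ext[OF U] lift[OF U] by blast
  have minf: "minimal_left_approx C (add_of C S) N U f"
    unfolding minimal_left_approx_def using U t(1) ext left_minimal_of_local_cone[OF T M(1) nepi] by blast
  have "\<not> isomorphic C N B" if B: "B \<in> S" for B
  proof
    assume "isomorphic C N B"
    then have "N \<in> add_of C S" using isomorphic_in_add_of[OF loc member_in_add_of[OF B]] isomorphic_sym by blast
    then show False using ext[OF _ ident_in_Hom] nmono by metis
  qed
  moreover have "\<not> orth M N" using orthD t(3) h0 by blast
  moreover note rigid_cocone[OF loc S(3) T U lift M(2)]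
  ultimately show ?thesis using that[OF T minf g N] by blast
qed

text \<open>
  The cocone \<open>f : T1 \<rightarrow> T0\<close> of a minimal right \<open>add S\<close>-approximation \<open>T0 \<rightarrow> N\<close> is rigid, so \<open>T1\<close> lies in
  \<open>add S\<close>. As \<open>N\<close> is rigid, every map \<open>T1 \<rightarrow> T0\<close> has the form \<open>v f + f w\<close>, so \<open>T1\<close> and \<open>T0\<close> have no
  common summand; hence \<open>T1 \<cong> M\<close> and \<open>T0 \<in> add (S - {M})\<close>.
\<close>

lemma complement_is_cone:
  assumes S: "S \<in> maximal_rigid_preclusters C" and M: "M \<in> S"
    and N: "local_End C N" "orth N N" "\<forall>B \<in> S - {M}. orth B N" "\<forall>B \<in> S. \<not> isomorphic C N B"
    and s: "minimal_left_approx C (add_of C (S - {M})) M U' s" and T': "tri C M U' M' s t' u"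
  shows "isomorphic C N M'"
proof -
  let ?S = "S - {M}"
  have fin: "finite S" and loc: "\<forall>B \<in> S. local_End C B" and orth: "\<forall>B \<in> S. \<forall>B' \<in> S. orth B B'"
    and max: "\<And>X. \<lbrakk>local_End C X; \<forall>B \<in> S. orth B X; orth X X\<rbrakk> \<Longrightarrow> \<exists>B \<in> S. isomorphic C X B"
    using S unfolding maximal_rigid_precluster_iff by auto
  have loc': "\<forall>B \<in> ?S. local_End C B" using loc by blast
  obtain T0 g where g: "minimal_right_approx C (add_of C S) T0 N g" using minimal_right_approx_exists[OF fin loc] .
  then have T0: "T0 \<in> add_of C S" and gh: "g \<in> Hom C T0 N"
    and lift: "\<And>V k. \<lbrakk>V \<in> add_of C S; k \<in> Hom C V N\<rbrakk> \<Longrightarrow> \<exists>k' \<in> Hom C V T0. k = g \<cdot> k'"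
    and min: "\<forall>\<phi> \<in> Hom C T0 T0. g \<cdot> \<phi> = g \<longrightarrow> is_iso C T0 T0 \<phi>"
    unfolding minimal_right_approx_def by blast+
  obtain Z h k where "tri C T0 N Z g h k" using tri_complete[OF gh] by blast
  moreover obtain T1 where "Z = shO C T1" by (rule shO_obtains)
  ultimately obtain f where T: "tri C T1 T0 N f g h" using unrotate by metis
  note t = tri_Hom[OF T]
  have "N \<notin> add_of C S" using local_End_in_add_of[OF loc N(1)] N(4) by blast
  then have nepi: "g \<cdot> d \<noteq> ident C N" if "d \<in> Hom C N T0" for d
    using retract_in_add_of[OF loc T0 that gh] by blast
  then have h0: "h \<noteq> 0" using split_epi_of_zero[OF T] by blast
  have T1: "orth B T1" if "B \<in> S" for B using rigid_cocone(1)[OF loc orth T T0 lift N(2) that] .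
  have T11: "orth T1 T1" using rigid_cocone(2)[OF loc orth T T0 lift N(2)] .
  have T1_comp: "\<exists>B \<in> S. isomorphic C L B" if L: "local_End C L" "0 < mult T1 L" for L
  proof -
    obtain a b where ab: "a \<in> Hom C L T1" "b \<in> Hom C T1 L" "b \<cdot> a = ident C L" using L mult_pos_iff by blast
    show ?thesis
    proof (rule max[OF L(1)])
      show "\<forall>B \<in> S. orth B L" using orth_sym[OF orth_retract[OF orth_sym[OF T1] ab]] by blast
      show "orth L L" using orth_retract[OF orth_sym[OF orth_retract[OF T11 ab]] ab] .
    qed
  qed
  then have T1_add: "T1 \<in> add_of C S" using add_of_iff_mult[OF loc] by blast
  have ext: "\<exists>k' \<in> Hom C T0 V. k = k' \<cdot> f" if V: "V \<in> add_of C ?S" "k \<in> Hom C T1 V" for V k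
    using left_approx_of_orth[OF T _ V(2)] orth_add_of(2)[OF loc' _ V(1)] N(3) by blast
  \<comment> \<open>No component of \<open>f\<close> between indecomposable summands is invertible:
    it would split off a summand of \<open>T0\<close> in the image of \<open>f\<close>, which
    \<open>g\<close> kills against minimality.\<close>
  have noF: "\<not> is_iso C B B (b \<cdot> (f \<cdot> a))" if B: "local_End C B" "a \<in> Hom C B T1" "b \<in> Hom C T0 B" for B a b
  proof
    assume iso: "is_iso C B B (b \<cdot> (f \<cdot> a))"
    note fa = Comp_in_Hom[OF B(2) t(1)]
    obtain a' w where w: "w \<in> Hom C B B" "a' = f \<cdot> a \<cdot> w" "a' \<in> Hom C B T0" "b \<cdot> a' = ident C B"
      using retraction_of_iso[OF fa B(3) iso] by metis
    have "g \<cdot> a' = 0"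
      using w(1,2) Comp_assoc[OF w(1) fa t(2)] Comp_assoc[OF B(2) t(1,2)] tri_Comp_zero(1)[OF T] B(2) by simp
    then have "zero_object C B" using right_minimal_kernel_summand[OF gh min w(3) B(3) w(4)] by blast
    then show False using B(1) unfolding local_End_def by blast
  qed
  \<comment> \<open>For a summand isomorphic to some \<open>B \<noteq> M\<close>, the projection
    from \<open>T1\<close> extends over \<open>f\<close>, because Ext^1(N, B) vanishes; that would
    be an invertible component of \<open>f\<close>.\<close>
  have T1_M: "isomorphic C L M" if L: "local_End C L" "0 < mult T1 L" for L
  proof -
    obtain B where B: "B \<in> S" "isomorphic C L B" using T1_comp[OF L] by blast
    have "B = M"
    proof (rule ccontr)
      assume "B \<noteq> M"
      then have "L \<in> add_of C ?S"
        using B isomorphic_in_add_of[OF loc' member_in_add_of] isomorphic_sym by blast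
      moreover obtain a q where a: "a \<in> Hom C L T1" "q \<in> Hom C T1 L" "q \<cdot> a = ident C L" using L mult_pos_iff by blast
      ultimately obtain c where c: "c \<in> Hom C T0 L" "q = c \<cdot> f" using ext by blast
      then have "c \<cdot> (f \<cdot> a) = ident C L" using a Comp_assoc[OF a(1) t(1) c(1)] by simp
      then show False using noF[OF L(1) a(1) c(1)] is_iso_ident by simp
    qed
    then show ?thesis using B by simp
  qed
  have "T1 \<in> add_of C {}" if "\<not> (\<exists>L. local_End C L \<and> 0 < mult T1 L)"
    using that add_of_iff_mult[of "{}"] by blast
  moreover have "zero_object C X" if "X \<in> add_of C {}" for X
    using add_of_decomposition[OF _ that] is_direct_sum_Nil by fastforce
  moreover have T1_nz: "\<not> zero_object C T1"
    using zero_object_Hom_to[of "shO C T1" h N] zero_object_shO_iff t(3) h0 by blast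
  ultimately obtain L where "local_End C L" "0 < mult T1 L" by blast
  then have "0 < mult T1 M" using T1_M mult_isomorphic_right by metis
  then obtain j q where j: "j \<in> Hom C M T1" "q \<in> Hom C T1 M" "q \<cdot> j = ident C M"
    using mult_pos_iff loc M by blast
  have T0_M: "\<not> (0 < mult T0 M)"
  proof
    assume "0 < mult T0 M"
    then obtain i p where i: "i \<in> Hom C M T0" "p \<in> Hom C T0 M" "p \<cdot> i = ident C M"
      using mult_pos_iff loc M by blast
    note iq = Comp_in_Hom[OF j(2) i(1)]
    obtain v where v: "v \<in> Hom C T0 N" "g \<cdot> (i \<cdot> q) = v \<cdot> f"
      using left_approx_of_orth[OF T N(2) Comp_in_Hom[OF iq t(2)]] by blast
    obtain v' where v': "v' \<in> Hom C T0 T0" "v = g \<cdot> v'" using lift[OF T0 v(1)] by blast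
    note vf = Comp_in_Hom[OF t(1) v'(1)]
    have "g \<cdot> (i \<cdot> q - v' \<cdot> f) = 0"
      using Comp_diff_right[OF iq vf t(2)] v v' Comp_assoc[OF t(1) v'(1) t(2)] by simp
    then obtain w where w: "w \<in> Hom C T1 T1" "i \<cdot> q - v' \<cdot> f = f \<cdot> w"
      using tri_factor_through_first[OF T diff_in_Hom[OF iq vf]] by metis
    note fw = Comp_in_Hom[OF w(1) t(1)]
    have e: "i \<cdot> q = v' \<cdot> f + f \<cdot> w" using w(2) by (simp add: algebra_simps)
    have "i = (i \<cdot> q) \<cdot> j" using j Comp_assoc[OF j(1,2) i(1)] Comp_ident_right[OF i(1)] by simp
    also have "\<dots> = v' \<cdot> (f \<cdot> j) + f \<cdot> (w \<cdot> j)"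
      unfolding e using Comp_add_left[OF j(1) vf fw] Comp_assoc[OF j(1) t(1) v'(1)] Comp_assoc[OF j(1) w(1) t(1)] by simp
    finally have "p \<cdot> i = p \<cdot> (v' \<cdot> (f \<cdot> j) + f \<cdot> (w \<cdot> j))" by simp
    note fj = Comp_in_Hom[OF j(1) t(1)] and wj = Comp_in_Hom[OF j(1) w(1)] and pv = Comp_in_Hom[OF v'(1) i(2)]
    note fwj = Comp_in_Hom[OF wj t(1)]
    have "p \<cdot> i = (p \<cdot> v') \<cdot> (f \<cdot> j) + p \<cdot> (f \<cdot> (w \<cdot> j))"
      using \<open>p \<cdot> i = p \<cdot> (v' \<cdot> (f \<cdot> j) + f \<cdot> (w \<cdot> j))\<close> Comp_add_right[OF Comp_in_Hom[OF fj v'(1)] fwj i(2)]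
        Comp_assoc[OF fj v'(1) i(2)] by simp
    then have "is_iso C M M ((p \<cdot> v') \<cdot> (f \<cdot> j) + p \<cdot> (f \<cdot> (w \<cdot> j)))" using i(3) is_iso_ident by metis
    then show False
      using local_End_Hom_cases[OF _ Comp_in_Hom[OF fj pv] Comp_in_Hom[OF fwj i(2)]] loc M
        noF[OF _ j(1) pv] noF[OF _ wj i(2)] by blast
  qed
  have T0_add: "T0 \<in> add_of C ?S"
    unfolding add_of_iff_mult[OF loc']
  proof (intro allI impI)
    fix L assume L: "local_End C L" "0 < mult T0 L"
    then obtain B where B: "B \<in> S" "isomorphic C L B" using T0 add_of_iff_mult[OF loc] by blast
    moreover have "B \<noteq> M" using B L T0_M mult_isomorphic_right by metis
    ultimately show "\<exists>B \<in> ?S. isomorphic C L B" by blast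
  qed
  \<comment> \<open>So far \<open>T1\<close> is a nonzero sum of copies of \<open>M\<close>;
    locality of its endomorphism ring leaves exactly one copy.\<close>
  have T1_loc: "local_End C T1"
    using local_End_cocone[OF T N(1) T1_nz _ _ min] ext[OF T0_add] lift[OF T0] by blast
  then have "isomorphic C T1 M" using T1_M[OF T1_loc] mult_local_End[OF T1_loc, of T1] by simp
  then obtain m where m: "is_iso C M T1 m" using isomorphic_sym unfolding isomorphic_def by blast
  have "minimal_left_approx C (add_of C ?S) T1 T0 f"
    unfolding minimal_left_approx_def using T0_add t(1) ext left_minimal_of_local_cone[OF T N(1) nepi] by blast
  then have "minimal_left_approx C (add_of C ?S) M T0 (f \<cdot> m)" using minimal_left_approx_isomorphic m by blast
  moreover obtain h' where "tri C M T0 N (f \<cdot> m) g h'" using tri_iso_first[OF T m] by blast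
  ultimately show ?thesis using minimal_left_approx_cone_unique[OF _ s _ T'] by blast
qed

text \<open>\<open>M'\<close> is not shown to be a complement here. It is the fixed object with
  which \<open>complement_is_cone\<close> identifies every second complement.\<close>

lemma exchange_left:
  assumes S: "finite S" "\<forall>B \<in> S. local_End C B"
    and M: "local_End C M" "\<forall>B \<in> S. orth B M" "\<forall>B \<in> S. \<not> isomorphic C M B"
  obtains U' M' s t u where "tri C M U' M' s t u" "minimal_left_approx C (add_of C S) M U' s"
    "minimal_right_approx C (add_of C S) U' M' t"
proof -
  note loc = S(2)
  obtain U' s where s: "minimal_left_approx C (add_of C S) M U' s" using minimal_left_approx_exists[OF S] .
  then have U': "U' \<in> add_of C S" "s \<in> Hom C M U'" unfolding minimal_left_approx_def by blast+
  obtain M' t u where T: "tri C M U' M' s t u" using tri_complete[OF U'(2)] by blast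
  note th = tri_Hom[OF T]
  have nmono: "c \<cdot> s \<noteq> ident C M" if "c \<in> Hom C U' M" for c
    using retract_in_add_of[OF loc U' that] local_End_in_add_of[OF loc M(1)] M(3) by blast
  have lift: "\<exists>k' \<in> Hom C V U'. k = t \<cdot> k'" if V: "V \<in> add_of C S" "k \<in> Hom C V M'" for V k
    using right_approx_of_orth[OF T _ V(2)] orth_add_of(1)[OF loc _ V(1)] M(2) by blast
  have "minimal_right_approx C (add_of C S) U' M' t"
    unfolding minimal_right_approx_def
    using U'(1) th lift right_minimal_of_local_cocone[OF T M(1) nmono] by blast
  then show ?thesis using that T s by blast
qed

end

section \<open>Exchange triangles of maximal rigid objects\<close>

context two_Calabi_Yau_triangulated
begin

abbreviation MR :: "'o set set" where "MR \<equiv> maximal_rigid_preclusters C"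

abbreviation partner :: "'o set \<Rightarrow> 'o \<Rightarrow> 'o \<Rightarrow> bool" where
  "partner S M N \<equiv> is_exchange_partner C MR (S - {M}) M N"

lemma MR_D:
  assumes "S \<in> MR"
  shows "finite S" "\<forall>B \<in> S. local_End C B" "\<forall>B \<in> S. \<forall>B' \<in> S. isomorphic C B B' \<longrightarrow> B = B'"
    "\<forall>B \<in> S. \<forall>B' \<in> S. orth B B'"
    "\<And>X. \<lbrakk>local_End C X; \<forall>B \<in> S. orth B X; orth X X\<rbrakk> \<Longrightarrow> \<exists>B \<in> S. isomorphic C X B"
  using assms unfolding maximal_rigid_precluster_iff by simp_all

lemma MR_remove:
  assumes "S \<in> MR" "M \<in> S"
  shows "finite (S - {M})" "\<forall>B \<in> S - {M}. local_End C B" "\<forall>B \<in> S - {M}. \<forall>B' \<in> S - {M}. orth B B'"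
    "local_End C M" "orth M M" "\<forall>B \<in> S - {M}. orth B M" "\<forall>B \<in> S - {M}. \<not> isomorphic C M B"
  using MR_D(1-4)[OF assms(1)] assms(2) by auto

lemma partnerD:
  assumes S: "S \<in> MR" "M \<in> S" and N: "partner S M N"
  shows "local_End C N" "\<forall>B \<in> S. \<not> isomorphic C N B" "orth N N" "\<forall>B \<in> S - {M}. orth B N" "insert N (S - {M}) \<in> MR"
    "N \<notin> S"
proof -
  show loc: "local_End C N" and S': "insert N (S - {M}) \<in> MR"
    using N unfolding is_exchange_partner_def indecomposable_iff_local_End by auto
  show "\<forall>B \<in> S. \<not> isomorphic C N B"
    using N MR_D(3)[OF S'] unfolding is_exchange_partner_def by blast
  then show "N \<notin> S" by auto
  show "orth N N" "\<forall>B \<in> S - {M}. orth B N" using MR_D(4)[OF S'] by blast+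
qed

lemma partners_isomorphic:
  assumes S: "S \<in> MR" "M \<in> S" and N: "partner S M N" "partner S M N'"
  shows "isomorphic C N N'"
proof -
  note r = MR_remove[OF S]
  obtain U' M' s t u where s: "tri C M U' M' s t u" "minimal_left_approx C (add_of C (S - {M})) M U' s"
    using exchange_left[OF r(1,2,4,6,7)] by metis
  have "isomorphic C N M'" "isomorphic C N' M'"
    using complement_is_cone[OF S _ _ _ _ s(2,1)] partnerD[OF S N(1)] partnerD[OF S N(2)] by blast+
  then show ?thesis using isomorphic_trans isomorphic_sym by blast
qed

text \<open>The candidate \<open>N\<close> comes from \<open>exchange_right\<close>. For maximality
  of the new set, an indecomposable \<open>X\<close> compatible with it is not \<open>M\<close>,
  because Ext^1(M, N) is nonzero. So \<open>X\<close> is isomorphic to a member of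
  \<open>S - {M}\<close>, or it is a second complement and, like \<open>N\<close>, isomorphic to the
  cone of the minimal left approximation of \<open>M\<close>.\<close>

lemma partner_exists:
  assumes S: "S \<in> MR" "M \<in> S"
  obtains N U f g h where "partner S M N" "tri C N U M f g h"
    "minimal_left_approx C (add_of C (S - {M})) N U f" "minimal_right_approx C (add_of C (S - {M})) U M g"
proof -
  note r = MR_remove[OF S]
  obtain N U f g h where N: "tri C N U M f g h" "minimal_left_approx C (add_of C (S - {M})) N U f"
    "minimal_right_approx C (add_of C (S - {M})) U M g" "local_End C N" "\<forall>B \<in> S - {M}. \<not> isomorphic C N B"
    "\<forall>B \<in> S - {M}. orth B N" "orth N N" "\<not> orth M N"
    using exchange_right[OF r(1-7)] .
  have NM: "\<not> isomorphic C N M"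
  proof
    assume "isomorphic C N M"
    then have "orth N M" using orth_isomorphic[OF r(5)] isomorphic_sym by blast
    then show False using N(8) orth_sym by blast
  qed
  obtain U' M' s t u where s: "tri C M U' M' s t u" "minimal_left_approx C (add_of C (S - {M})) M U' s"
    using exchange_left[OF r(1,2,4,6,7)] by metis
  have cone: "isomorphic C X M'" if "local_End C X" "orth X X" "\<forall>B \<in> S - {M}. orth B X" "\<forall>B \<in> S. \<not> isomorphic C X B" for X
    using complement_is_cone[OF S that s(2,1)] .
  have "insert N (S - {M}) \<in> MR"
    unfolding maximal_rigid_precluster_iff
  proof (intro conjI)
    show "finite (insert N (S - {M}))" "\<forall>B \<in> insert N (S - {M}). local_End C B" using r N by auto
    show "\<forall>B \<in> insert N (S - {M}). \<forall>B' \<in> insert N (S - {M}). isomorphic C B B' \<longrightarrow> B = B'"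
      using N(5) MR_D(3)[OF S(1)] isomorphic_sym by blast
    show "\<forall>B \<in> insert N (S - {M}). \<forall>B' \<in> insert N (S - {M}). orth B B'"
      using N(6,7) r(3) orth_sym by blast
    show "\<forall>X. local_End C X \<longrightarrow> (\<forall>B \<in> insert N (S - {M}). orth B X) \<longrightarrow> orth X X \<longrightarrow>
      (\<exists>B \<in> insert N (S - {M}). isomorphic C X B)"
    proof (intro allI impI)
      fix X assume X: "local_End C X" "\<forall>B \<in> insert N (S - {M}). orth B X" "orth X X"
      show "\<exists>B \<in> insert N (S - {M}). isomorphic C X B"
      proof (cases "\<exists>B \<in> S. isomorphic C X B")
        case True
        moreover have "\<not> isomorphic C X M"
        proof
          assume "isomorphic C X M"
          then have "orth M N" using orth_isomorphic orth_sym X(2) by blast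
          then show False using N(8) by blast
        qed
        ultimately show ?thesis by blast
      next
        case False
        have "isomorphic C X M'" using cone X False by blast
        moreover have "isomorphic C N M'" using cone N NM by blast
        ultimately show ?thesis using isomorphic_trans isomorphic_sym by blast
      qed
    qed
  qed
  moreover have "N \<notin> S - {M}" using N(5) isomorphic_refl by blast
  ultimately have "partner S M N"
    unfolding is_exchange_partner_def indecomposable_iff_local_End using N(4) NM by blast
  then show ?thesis using that N by blast
qed

text \<open>The two triangles are constructed independently, with end terms \<open>N0\<close> and
  \<open>M'\<close>. Both are transported to the given \<open>N\<close>: the first by uniqueness of
  partners, the second by \<open>complement_is_cone\<close>.\<close>

lemma exchange_triangles_exist:
  assumes S: "S \<in> MR" "M \<in> S" and N: "partner S M N"
  shows "\<exists>U U'. exchange_triangles C (S - {M}) M N U U'"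
proof -
  note r = MR_remove[OF S]
  obtain N0 U f g h where N0: "partner S M N0" and T: "tri C N0 U M f g h"
    "minimal_left_approx C (add_of C (S - {M})) N0 U f" "minimal_right_approx C (add_of C (S - {M})) U M g"
    using partner_exists[OF S] .
  obtain U' M' s t u where T': "tri C M U' M' s t u" "minimal_left_approx C (add_of C (S - {M})) M U' s"
    "minimal_right_approx C (add_of C (S - {M})) U' M' t"
    using exchange_left[OF r(1,2,4,6,7)] .
  obtain n where n: "is_iso C N N0 n" using partners_isomorphic[OF S N N0] unfolding isomorphic_def by blast
  have "isomorphic C N M'" using complement_is_cone[OF S _ _ _ _ T'(2,1)] partnerD[OF S N] by blast
  then obtain m where m: "is_iso C M' N m" using isomorphic_sym unfolding isomorphic_def by blast
  obtain h' u' where "tri C N U M (f \<cdot> n) g h'" "tri C M U' N s (m \<cdot> t) u'"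
    using tri_iso_first[OF T(1) n] tri_iso_third[OF T'(1) m] by blast
  then show ?thesis
    unfolding exchange_triangles_def
    using minimal_left_approx_isomorphic[OF T(2) n] minimal_right_approx_isomorphic[OF T'(3) m] T(3) T'(2) by blast
qed

theorem weak_cluster_structure_maximal_rigid: "weak_cluster_structure C MR"
  unfolding weak_cluster_structure_def nonisomorphic_indecomposables_def indecomposable_iff_local_End
proof (intro conjI ballI allI impI)
  fix S M assume S: "S \<in> MR" "M \<in> S"
  show "local_End C M" using MR_D(2)[OF S(1)] S(2) by blast
  show "\<exists>N. partner S M N" using partner_exists[OF S] by metis
  fix N assume N: "partner S M N"
  show "\<exists>U U'. exchange_triangles C (S - {M}) M N U U'" using exchange_triangles_exist[OF S N] .
  fix N' assume "partner S M N'"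
  then show "isomorphic C N N'" using partners_isomorphic[OF S N] by blast
next
  fix S M N assume "S \<in> MR" "M \<in> S" "N \<in> S" "isomorphic C M N"
  then show "M = N" using MR_D(3) by blast
qed

section \<open>The chosen middle terms and their summands\<close>

abbreviation mid :: "'o set \<Rightarrow> 'o \<Rightarrow> 'o" where "mid S M \<equiv> middle_U C MR M (S - {M})"

abbreviation mid' :: "'o set \<Rightarrow> 'o \<Rightarrow> 'o" where "mid' S M \<equiv> middle_U' C MR M (S - {M})"

lemma middles:
  assumes S: "S \<in> MR" "M \<in> S"
  obtains N where "partner S M N" "exchange_triangles C (S - {M}) M N (mid S M) (mid' S M)"
proof -
  let ?P = "\<lambda>(U, U'). \<exists>N. partner S M N \<and> exchange_triangles C (S - {M}) M N U U'"
  obtain N where "partner S M N" using partner_exists[OF S] by metis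
  then have "\<exists>x. ?P x" using exchange_triangles_exist[OF S] by fast
  then have "?P (exchange_middles C MR M (S - {M}))" unfolding exchange_middles_def by (rule someI_ex)
  then show ?thesis using that unfolding middle_U_def middle_U'_def by (auto split: prod.splits)
qed

text \<open>The choice in \<open>exchange_middles\<close> may refer to another partner. But
  \<open>U\<close> is a minimal right and \<open>U'\<close> a minimal left approximation of
  \<open>M\<close> itself, so up to isomorphism they do not depend on the partner.\<close>

lemma middles_of_partner:
  assumes S: "S \<in> MR" "M \<in> S" and N: "partner S M N"
  obtains U U' where "exchange_triangles C (S - {M}) M N U U'" "isomorphic C U (mid S M)" "isomorphic C U' (mid' S M)"
proof -
  obtain N0 where N0: "partner S M N0" "exchange_triangles C (S - {M}) M N0 (mid S M) (mid' S M)" using middles[OF S] .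
  obtain U U' where U: "exchange_triangles C (S - {M}) M N U U'" using exchange_triangles_exist[OF S N] by blast
  have "isomorphic C U (mid S M)" "isomorphic C U' (mid' S M)"
    using N0(2) U minimal_right_approx_unique minimal_left_approx_unique
    unfolding exchange_triangles_def isomorphic_def by meson+
  then show ?thesis using that U by blast
qed

lemma middles_in_add_of:
  assumes S: "S \<in> MR" "M \<in> S"
  shows "mid S M \<in> add_of C (S - {M})" "mid' S M \<in> add_of C (S - {M})"
proof -
  obtain N where "exchange_triangles C (S - {M}) M N (mid S M) (mid' S M)" using middles[OF S] by metis
  then show "mid S M \<in> add_of C (S - {M})" "mid' S M \<in> add_of C (S - {M})"
    unfolding exchange_triangles_def minimal_right_approx_def minimal_left_approx_def by blast+
qed

lemma mult_outside_add_of: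
  assumes "\<forall>B \<in> S. local_End C B" "X \<in> add_of C S" "local_End C L" "\<forall>B \<in> S. \<not> isomorphic C L B"
  shows "mult X L = 0"
  using assms add_of_iff_mult by blast

lemma add_of_remove:
  assumes "\<forall>B \<in> S. local_End C B" "X \<in> add_of C S" "mult X k = 0"
  shows "X \<in> add_of C (S - {k})"
proof -
  have loc: "\<forall>B \<in> S - {k}. local_End C B" using assms(1) by blast
  show ?thesis
    unfolding add_of_iff_mult[OF loc]
  proof (intro allI impI)
    fix L assume L: "local_End C L" "0 < mult X L"
    then obtain B where B: "B \<in> S" "isomorphic C L B" using assms(2) add_of_iff_mult[OF assms(1)] by blast
    then have "B \<noteq> k" using L(2) assms(3) mult_isomorphic_right[OF B(2), of X] by auto
    then show "\<exists>B \<in> S - {k}. isomorphic C L B" using B by blast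
  qed
qed

lemma add_of_mono: "S \<subseteq> S' \<Longrightarrow> add_of C S \<subseteq> add_of C S'"
  unfolding add_of_def by blast

text \<open>
  If \<open>k\<close> occurs in \<open>U'\<^sub>i\<close> through a map \<open>i \<rightarrow> k\<close> but \<open>i\<close> does not occur in \<open>U\<^sub>k\<close>, that map factors through
  \<open>add (S - {i, k})\<close>, which contradicts minimality.
\<close>

lemma mult_mid'_imp_mid:
  assumes S: "S \<in> MR" "i \<in> S" "k \<in> S" "i \<noteq> k" and pos: "0 < mult (mid' S i) k"
  shows "0 < mult (mid S k) i"
proof (rule ccontr)
  assume "\<not> 0 < mult (mid S k) i"
  note rk = MR_remove[OF S(1,3)]
  obtain s where s: "minimal_left_approx C (add_of C (S - {i})) i (mid' S i) s"
    using middles[OF S(1,2)] unfolding exchange_triangles_def by metis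
  obtain g where g: "minimal_right_approx C (add_of C (S - {k})) (mid S k) k g"
    using middles[OF S(1,3)] unfolding exchange_triangles_def by metis
  have "mid S k \<in> add_of C (S - {k} - {i})"
    using add_of_remove[OF rk(2) middles_in_add_of(1)[OF S(1,3)]] \<open>\<not> 0 < mult (mid S k) i\<close> by simp
  then have Uk: "mid S k \<in> add_of C (S - {i})" using add_of_mono[of "S - {k} - {i}" "S - {i}"] by blast
  have sH: "s \<in> Hom C i (mid' S i)" and gH: "g \<in> Hom C (mid S k) k" using s g unfolding minimal_left_approx_def minimal_right_approx_def by auto
  obtain \<iota> \<pi> where \<iota>: "\<iota> \<in> Hom C k (mid' S i)" "\<pi> \<in> Hom C (mid' S i) k" "\<pi> \<cdot> \<iota> = ident C k"
    using pos mult_pos_iff[OF rk(4)] by blast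
  have "i \<in> add_of C (S - {k})" using member_in_add_of[of i "S - {k}"] S(2,4) by simp
  then obtain a where a: "a \<in> Hom C i (mid S k)" "\<pi> \<cdot> s = g \<cdot> a"
    using g Comp_in_Hom[OF sH \<iota>(2)] unfolding minimal_right_approx_def by blast
  obtain a' where a': "a' \<in> Hom C (mid' S i) (mid S k)" "a = a' \<cdot> s"
    using s Uk a(1) unfolding minimal_left_approx_def by blast
  \<comment> \<open>Subtracting the part through \<open>mid S k\<close> achieves
    \<open>p s = 0\<close>. The composite \<open>g a' \<iota>\<close> is not invertible, since
    \<open>k\<close> is not a summand of \<open>mid S k\<close>, so locality makes
    \<open>p \<iota>\<close> invertible: a summand \<open>k\<close> of \<open>mid' S i\<close> that
    \<open>s\<close> does not reach.\<close>
  define p where "p = \<pi> - g \<cdot> a'"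
  note ga = Comp_in_Hom[OF a'(1) gH] and ai = Comp_in_Hom[OF \<iota>(1) a'(1)]
  have p: "p \<in> Hom C (mid' S i) k" unfolding p_def using diff_in_Hom[OF \<iota>(2) ga] .
  have ps: "p \<cdot> s = 0"
    using Comp_diff_left[OF sH \<iota>(2) ga] Comp_assoc[OF sH a'(1) gH] a(2) a'(2) by (simp add: p_def)
  have pi: "p \<cdot> \<iota> + g \<cdot> (a' \<cdot> \<iota>) = ident C k"
    using Comp_diff_left[OF \<iota>(1,2) ga] Comp_assoc[OF \<iota>(1) a'(1) gH] \<iota>(3) by (simp add: p_def)
  have "\<not> is_iso C k k (g \<cdot> (a' \<cdot> \<iota>))"
  proof
    assume "is_iso C k k (g \<cdot> (a' \<cdot> \<iota>))"
    then obtain b' where "b' \<in> Hom C (mid S k) k" "b' \<cdot> (a' \<cdot> \<iota>) = ident C k" using retraction_of_iso[OF ai gH] by blast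
    then have "k \<in> add_of C (S - {k})" using retract_in_add_of[OF rk(2) middles_in_add_of(1)[OF S(1,3)] ai] by blast
    then show False using local_End_in_add_of[OF rk(2,4)] rk(7) by blast
  qed
  then have "is_iso C k k (p \<cdot> \<iota>)"
    using local_End_Hom_cases[OF rk(4) Comp_in_Hom[OF \<iota>(1) p] Comp_in_Hom[OF ai gH]] is_iso_ident[of k] pi by metis
  then obtain \<iota>' where "\<iota>' \<in> Hom C k (mid' S i)" "p \<cdot> \<iota>' = ident C k" using retraction_of_iso[OF \<iota>(1) p] by blast
  then have "zero_object C k"
    using left_minimal_cokernel_summand[OF sH _ _ p _ ps] s unfolding minimal_left_approx_def by blast
  then show False using rk(4) unfolding local_End_def by blast
qed

text \<open>Dual to \<open>mult_mid'_imp_mid\<close>: the map \<open>k -> i\<close> through which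
  \<open>k\<close> occurs in \<open>mid S i\<close> factors through \<open>mid' S k\<close>. If
  \<open>i\<close> is absent there, the factor \<open>mid' S k -> i\<close> lifts along
  \<open>g\<close>, and subtracting this lift leaves a summand \<open>k\<close> killed by
  \<open>g\<close>.\<close>

lemma mult_mid_imp_mid':
  assumes S: "S \<in> MR" "i \<in> S" "k \<in> S" "i \<noteq> k" and pos: "0 < mult (mid S i) k"
  shows "0 < mult (mid' S k) i"
proof (rule ccontr)
  assume "\<not> 0 < mult (mid' S k) i"
  note rk = MR_remove[OF S(1,3)]
  obtain g where g: "minimal_right_approx C (add_of C (S - {i})) (mid S i) i g"
    using middles[OF S(1,2)] unfolding exchange_triangles_def by metis
  obtain s where s: "minimal_left_approx C (add_of C (S - {k})) k (mid' S k) s"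
    using middles[OF S(1,3)] unfolding exchange_triangles_def by metis
  have "mid' S k \<in> add_of C (S - {k} - {i})"
    using add_of_remove[OF rk(2) middles_in_add_of(2)[OF S(1,3)]] \<open>\<not> 0 < mult (mid' S k) i\<close> by simp
  then have Uk: "mid' S k \<in> add_of C (S - {i})" using add_of_mono[of "S - {k} - {i}" "S - {i}"] by blast
  have sH: "s \<in> Hom C k (mid' S k)" and gH: "g \<in> Hom C (mid S i) i" using s g unfolding minimal_left_approx_def minimal_right_approx_def by auto
  obtain \<iota> \<pi> where \<iota>: "\<iota> \<in> Hom C k (mid S i)" "\<pi> \<in> Hom C (mid S i) k" "\<pi> \<cdot> \<iota> = ident C k"
    using pos mult_pos_iff[OF rk(4)] by blast
  have "i \<in> add_of C (S - {k})" using member_in_add_of[of i "S - {k}"] S(2,4) by simp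
  then obtain a where a: "a \<in> Hom C (mid' S k) i" "g \<cdot> \<iota> = a \<cdot> s"
    using s Comp_in_Hom[OF \<iota>(1) gH] unfolding minimal_left_approx_def by blast
  obtain a' where a': "a' \<in> Hom C (mid' S k) (mid S i)" "a = g \<cdot> a'"
    using g Uk a(1) unfolding minimal_right_approx_def by blast
  define p where "p = \<iota> - a' \<cdot> s"
  note as = Comp_in_Hom[OF sH a'(1)] and pa = Comp_in_Hom[OF a'(1) \<iota>(2)]
  have p: "p \<in> Hom C k (mid S i)" unfolding p_def using diff_in_Hom[OF \<iota>(1) as] .
  have gp: "g \<cdot> p = 0"
    using Comp_diff_right[OF \<iota>(1) as gH] Comp_assoc[OF sH a'(1) gH] a(2) a'(2) by (simp add: p_def)
  have pi: "\<pi> \<cdot> p + (\<pi> \<cdot> a') \<cdot> s = ident C k"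
    using Comp_diff_right[OF \<iota>(1) as \<iota>(2)] Comp_assoc[OF sH a'(1) \<iota>(2)] \<iota>(3) by (simp add: p_def)
  have "\<not> is_iso C k k ((\<pi> \<cdot> a') \<cdot> s)"
  proof
    assume "is_iso C k k ((\<pi> \<cdot> a') \<cdot> s)"
    then obtain b' where "b' \<in> Hom C (mid' S k) k" "b' \<cdot> s = ident C k" using retraction_of_iso[OF sH pa] by blast
    then have "k \<in> add_of C (S - {k})" using retract_in_add_of[OF rk(2) middles_in_add_of(2)[OF S(1,3)] sH] by blast
    then show False using local_End_in_add_of[OF rk(2,4)] rk(7) by blast
  qed
  then have "is_iso C k k (\<pi> \<cdot> p)"
    using local_End_Hom_cases[OF rk(4) Comp_in_Hom[OF p \<iota>(2)] Comp_in_Hom[OF sH pa]] is_iso_ident[of k] pi by metis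
  then obtain \<pi>' where "\<pi>' \<in> Hom C (mid S i) k" "\<pi>' \<cdot> p = ident C k" using retraction_of_iso[OF p \<iota>(2)] by blast
  then have "zero_object C k"
    using right_minimal_kernel_summand[OF gH _ p _ _ gp] g unfolding minimal_right_approx_def by blast
  then show False using rk(4) unfolding local_End_def by blast
qed

text \<open>The triangles of \<open>k\<close> are those of \<open>N\<close> in the opposite order:
  \<open>U'\<close> is also the minimal right approximation of \<open>N\<close>, and
  \<open>U\<close> its minimal left approximation, with respect to the same
  \<open>S - {k}\<close>.\<close>

lemma middles_swap:
  assumes S: "S \<in> MR" "k \<in> S" and N: "partner S k N"
  shows "isomorphic C (mid (insert N (S - {k})) N) (mid' S k)" "isomorphic C (mid' (insert N (S - {k})) N) (mid S k)"
proof -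
  note p = partnerD[OF S N]
  have eq: "insert N (S - {k}) - {N} = S - {k}" using p(6) by auto
  obtain U U' where U: "exchange_triangles C (S - {k}) k N U U'" "isomorphic C U (mid S k)" "isomorphic C U' (mid' S k)"
    using middles_of_partner[OF S N] .
  obtain N1 where "exchange_triangles C (S - {k}) N N1 (mid (insert N (S - {k})) N) (mid' (insert N (S - {k})) N)"
    using middles[OF p(5), of N] unfolding eq by auto
  then have "isomorphic C (mid (insert N (S - {k})) N) U'" "isomorphic C (mid' (insert N (S - {k})) N) U"
    using U(1) minimal_right_approx_unique minimal_left_approx_unique
    unfolding exchange_triangles_def isomorphic_def by meson+
  then show "isomorphic C (mid (insert N (S - {k})) N) (mid' S k)" "isomorphic C (mid' (insert N (S - {k})) N) (mid S k)"
    using U isomorphic_trans by blast+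
qed

lemma biproduct_in_add_of:
  assumes "\<forall>B \<in> S. local_End C B" "biproduct X A B i p j q" "A \<in> add_of C S" "B \<in> add_of C S"
  shows "X \<in> add_of C S"
  using assms(3,4) mult_biproduct[OF assms(2)] unfolding add_of_iff_mult[OF assms(1)] by auto

text \<open>Replaces each summand \<open>k\<close> of \<open>Z\<close> by \<open>U\<close>, along \<open>k \<rightarrow> U \<rightarrow> N\<close>.\<close>

lemma replace_summands:
  assumes loc: "\<forall>B \<in> S. local_End C B" and T: "tri C k U N s t u" and U: "U \<in> add_of C S"
    and Z: "is_direct_sum C Z Zs" "set Zs \<subseteq> insert k S"
  shows "\<exists>W Q \<zeta> a b n. tri C Z W Q \<zeta> a b \<and> W \<in> add_of C S \<and> (\<forall>Y. mult Q Y = n * mult N Y) \<and>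
    (\<forall>Y. mult W Y + n * mult k Y = mult Z Y + n * mult U Y) \<and> (\<forall>V. orth N V \<longrightarrow> orth Q V)"
  using Z
proof (induction Zs arbitrary: Z)
  case Nil
  then have Z: "zero_object C Z" using is_direct_sum_Nil by blast
  have "Z \<in> add_of C S" using direct_sum_in_add_of[OF Nil.prems(1)] by simp
  moreover have "orth Z V" for V unfolding orth_def using zero_object_Hom_from[OF Z] by blast
  ultimately show ?case using tri_ident[OF Z, of Z] mult_zero_object[OF Z]
    by (intro exI[of _ Z] exI[of _ "ident C Z"] exI[of _ "0::'m"] exI[of _ "0::nat"]) auto
next
  case (Cons B Zs)
  obtain R i p j q where R: "biproduct Z B R i p j q" "is_direct_sum C R Zs"
    using Cons.prems(1) unfolding is_direct_sum_Cons by blast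
  obtain W Q \<zeta> a b n where IH: "tri C R W Q \<zeta> a b" "W \<in> add_of C S" "\<forall>Y. mult Q Y = n * mult N Y"
    "\<forall>Y. mult W Y + n * mult k Y = mult R Y + n * mult U Y" "\<forall>V. orth N V \<longrightarrow> orth Q V"
    using Cons.IH[OF R(2)] Cons.prems(2) by auto
  \<comment> \<open>A summand \<open>k\<close> contributes the given triangle with
    \<open>m = 1\<close>; any other summand \<open>B\<close> contributes the identity triangle
    \<open>B = B -> 0\<close> with \<open>m = 0\<close>.\<close>
  have ex: "\<exists>U0 N0 s0 t0 u0 m. tri C B U0 N0 s0 t0 u0 \<and> U0 \<in> add_of C S \<and> (\<forall>Y. mult N0 Y = m * mult N Y) \<and>
    (\<forall>Y. mult U0 Y + m * mult k Y = mult B Y + m * mult U Y) \<and> (\<forall>V. orth N V \<longrightarrow> orth N0 V)"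
  proof (cases "B = k")
    case True
    then show ?thesis using T U by (intro exI[of _ U] exI[of _ N] exI[of _ s] exI[of _ t] exI[of _ u] exI[of _ "1::nat"]) auto
  next
    case False
    obtain K where K: "zero_object C K" using ex_zero_object by blast
    have "B \<in> add_of C S" using member_in_add_of False Cons.prems(2) by auto
    moreover have "orth K V" for V unfolding orth_def using zero_object_Hom_from[OF K] by blast
    ultimately show ?thesis using tri_ident[OF K, of B] mult_zero_object[OF K]
      by (intro exI[of _ B] exI[of _ K] exI[of _ "ident C B"] exI[of _ "0::'m"] exI[of _ "0::nat"]) auto
  qed
  obtain U0 N0 s0 t0 u0 m where B: "tri C B U0 N0 s0 t0 u0" "U0 \<in> add_of C S" "\<forall>Y. mult N0 Y = m * mult N Y"
    "\<forall>Y. mult U0 Y + m * mult k Y = mult B Y + m * mult U Y" "\<forall>V. orth N V \<longrightarrow> orth N0 V"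
    using ex by (elim exE conjE) (rule that)
  obtain W' iw pw jw qw where W': "biproduct W' U0 W iw pw jw qw" by (rule biproduct_exists)
  obtain Q' iq pq jq qq where Q': "biproduct Q' N0 Q iq pq jq qq" by (rule biproduct_exists)
  obtain F G H where "tri C Z W' Q' F G H" using tri_biproduct[OF B(1) IH(1) R(1) W' Q'] by blast
  moreover have "W' \<in> add_of C S" using biproduct_in_add_of[OF loc W' B(2) IH(2)] .
  moreover have "\<forall>Y. mult Q' Y = (m + n) * mult N Y" using mult_biproduct[OF Q'] B(3) IH(3) by (simp add: algebra_simps)
  moreover have "mult W' Y + (m + n) * mult k Y = mult Z Y + (m + n) * mult U Y" for Y
    using mult_biproduct[OF W', of Y] mult_biproduct[OF R(1), of Y] B(4)[rule_format, of Y] IH(4)[rule_format, of Y]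
    by (simp add: algebra_simps)
  moreover have "orth Q' V" if "orth N V" for V
  proof -
    have "is_direct_sum C Q' [N0, Q]" using Q' is_direct_sum_biproduct by blast
    then show ?thesis using orth_direct_sum[of "{N0, Q}" V Q' "[N0, Q]"] B(5) IH(5) that by auto
  qed
  ultimately show ?case by blast
qed

end

section \<open>Matrix mutation\<close>

context two_Calabi_Yau_triangulated
begin

text \<open>
  \<open>W\<close> and \<open>E\<close> below are the middle terms of a possibly non-minimal pair of exchange triangles
  \<open>i \<rightarrow> W \<rightarrow> X\<close> and \<open>X \<rightarrow> E \<rightarrow> i\<close> for the mutated precluster; \<open>E\<close> is \<open>mid S i \<oplus> Q\<close>.
\<close>

lemma mult_middles_mutation:
  assumes S: "S \<in> MR" "i \<in> S" "k \<in> S" "i \<noteq> k" and N: "partner S k N"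
    and zero: "mult (mid S i) k = 0" "mult (mid' S k) i = 0"
  defines "S' \<equiv> insert N (S - {k})" and "m \<equiv> mult (mid' S i) k"
  shows "mult (mid' S' i) Y + mult (mid S i) Y + m * mult N Y + m * mult k Y =
    mult (mid S' i) Y + mult (mid' S i) Y + m * mult (mid' S k) Y"
proof -
  let ?K = "S - {k} - {i}"
  note ri = MR_remove[OF S(1,2)] and rk = MR_remove[OF S(1,3)] and pN = partnerD[OF S(1,3) N]
  have S': "S' \<in> MR" "i \<in> S'" unfolding S'_def using pN(5) S by auto
  note ri' = MR_remove[OF S']
  have locK: "\<forall>B \<in> ?K. local_End C B" using rk(2) by blast
  have S'i: "S' - {i} = insert N ?K" unfolding S'_def using pN(6) S(2) by auto
  obtain U0 U where U: "exchange_triangles C (S - {k}) k N U0 U" "isomorphic C U (mid' S k)"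
    using middles_of_partner[OF S(1,3) N] by metis
  then obtain s t u where Tk: "tri C k U N s t u" "minimal_right_approx C (add_of C (S - {k})) U N t"
    "minimal_left_approx C (add_of C (S - {k})) k U s"
    unfolding exchange_triangles_def by blast
  note tk = tri_Hom[OF Tk(1)]
  have mU: "mult U Y = mult (mid' S k) Y" for Y using mult_isomorphic[OF U(2)] .
  have "U \<in> add_of C (S - {k})" using Tk(2) unfolding minimal_right_approx_def by blast
  \<comment> \<open>As \<open>i\<close> does not occur in \<open>mid' S k\<close>, what replaces
    \<open>k\<close> involves only the common part \<open>?K\<close>.\<close>
  then have UK: "U \<in> add_of C ?K" using add_of_remove[OF rk(2)] mU zero(2) by simp
  obtain Ni where Ni: "exchange_triangles C (S - {i}) i Ni (mid S i) (mid' S i)" using middles[OF S(1,2)] by metis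
  then obtain f g h s' t' u' where Ti: "tri C Ni (mid S i) i f g h" "tri C i (mid' S i) Ni s' t' u'"
    "minimal_left_approx C (add_of C (S - {i})) i (mid' S i) s'"
    unfolding exchange_triangles_def by blast
  note ti = tri_Hom[OF Ti(1)] and ti' = tri_Hom[OF Ti(2)]
  obtain Zs where Zs: "is_direct_sum C (mid' S i) Zs" "set Zs \<subseteq> S - {i}"
    using add_of_decomposition[OF ri(2) middles_in_add_of(2)[OF S(1,2)]] .
  then have "set Zs \<subseteq> insert k ?K" by blast
  from replace_summands[OF locK Tk(1) UK Zs(1) this] obtain W Q \<zeta> a b n where
    TW: "tri C (mid' S i) W Q \<zeta> a b" and W: "W \<in> add_of C ?K" and mQ: "\<And>Y. mult Q Y = n * mult N Y"
    and mW: "\<And>Y. mult W Y + n * mult k Y = mult (mid' S i) Y + n * mult U Y" and oQ: "\<And>V. orth N V \<Longrightarrow> orth Q V"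
    by blast
  note tW = tri_Hom[OF TW]
  have kK: "\<forall>B \<in> ?K. \<not> isomorphic C k B" using rk(7) by blast
  \<comment> \<open>Counting copies of \<open>k\<close>, which is absent from \<open>W\<close> and
    \<open>U\<close>, identifies the number \<open>n\<close> of replacements with
    \<open>m\<close>.\<close>
  have "mult W k = 0" "mult U k = 0" using mult_outside_add_of[OF locK _ rk(4) kK] W UK by blast+
  then have n: "n = m" using mW[of k] mult_local_End[OF rk(4), of k] by (simp add: m_def)
  have oNK: "orth N B" if "B \<in> ?K" for B using pN(4) that orth_sym by blast
  obtain X c d where TX: "tri C i W X (\<zeta> \<cdot> s') c d" using tri_complete[OF Comp_in_Hom[OF ti'(1) tW(1)]] by blast
  \<comment> \<open>The octahedron on \<open>i -> mid' S i -> W\<close> exhibits the cone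
    \<open>X\<close> as an extension of \<open>Q\<close> by \<open>Ni\<close>.\<close>
  from octahedral[OF Ti(2) TW TX] obtain p v where TNi: "tri C Ni X Q p v (shM C t' \<cdot> b)" by blast
  note tNi = tri_Hom[OF TNi]
  \<comment> \<open>Desuspending \<open>i\<close> turns the first exchange triangle into
    \<open>i' -> Ni -> mid S i\<close>, whose first map can be composed with \<open>Ni -> X\<close>.
    The octahedron on this composite makes its cone \<open>E\<close> an extension of
    \<open>Q\<close> by \<open>mid S i\<close>.\<close>
  obtain i' where i': "i = shO C i'" by (rule shO_obtains)
  obtain e where e: "tri C i' Ni (mid S i) e f g" using unrotate[of Ni "mid S i" i' f g h] Ti(1) i' by metis
  note te = tri_Hom[OF e]
  obtain E x y where TE: "tri C i' X E (p \<cdot> e) x y" using tri_complete[OF Comp_in_Hom[OF te(1) tNi(1)]] by blast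
  from octahedral[OF e TNi TE] obtain u2 v2 where
    TU: "tri C (mid S i) E Q u2 v2 (shM C f \<cdot> (shM C t' \<cdot> b))" by blast
  note tU = tri_Hom[OF TU]
  have midK: "mid S i \<in> add_of C ?K"
    using add_of_remove[OF ri(2) middles_in_add_of(1)[OF S(1,2)] zero(1)] by (simp add: Diff_insert2[symmetric] insert_commute)
  \<comment> \<open>The extension splits: \<open>Q\<close> is built from copies of \<open>N\<close>,
    and \<open>k\<close> does not occur in \<open>mid S i\<close>, so Ext^1(Q, mid S i)
    vanishes.\<close>
  have "orth Q (mid S i)"
    using oQ orth_add_of(2)[OF locK _ midK] pN(4) by blast
  then have "shM C f \<cdot> (shM C t' \<cdot> b) = 0" using orthD tU(3) by blast
  then obtain z where z: "z \<in> Hom C E (mid S i)" "ident C (mid S i) = z \<cdot> u2"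
    using tri_extend_first[OF TU ident_in_Hom] shM_ident Comp_zero_right[OF ident_in_Hom] by metis
  obtain j where E: "biproduct E (mid S i) Q u2 z j v2" using split_mono_biproduct[OF tU(1) z(1) z(2)[symmetric] TU] .
  obtain r where TE': "tri C X E i x y r" using rotate[OF TE] i' by metis
  \<comment> \<open>A map \<open>i -> B\<close> extends over \<open>s'\<close> and then over
    \<open>\<zeta>\<close>, where the obstruction lies in Ext^1(Q, B) = 0.\<close>
  have W_ext: "\<exists>\<kappa>' \<in> Hom C W B. \<kappa> = \<kappa>' \<cdot> (\<zeta> \<cdot> s')" if B: "B \<in> ?K" "\<kappa> \<in> Hom C i B" for B \<kappa>
  proof -
    have "B \<in> add_of C (S - {i})" using member_in_add_of[of B "S - {i}"] B by simp
    then obtain \<kappa>1 where \<kappa>1: "\<kappa>1 \<in> Hom C (mid' S i) B" "\<kappa> = \<kappa>1 \<cdot> s'"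
      using Ti(3) B(2) unfolding minimal_left_approx_def by blast
    obtain \<kappa>2 where \<kappa>2: "\<kappa>2 \<in> Hom C W B" "\<kappa>1 = \<kappa>2 \<cdot> \<zeta>"
      using left_approx_of_orth[OF TW oQ[OF oNK[OF B(1)]] \<kappa>1(1)] by blast
    show ?thesis using \<kappa>1(2) \<kappa>2 Comp_assoc[OF ti'(1) tW(1) \<kappa>2(1)] by auto
  qed
  note \<zeta>s = Comp_in_Hom[OF ti'(1) tW(1)]
  have ext: "\<exists>\<kappa>' \<in> Hom C W B. \<kappa> = \<kappa>' \<cdot> (\<zeta> \<cdot> s')" if B: "B \<in> S' - {i}" "\<kappa> \<in> Hom C i B" for B \<kappa>
  proof (cases "B \<in> ?K")
    case True
    then show ?thesis using W_ext B(2) by blast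
  next
    case False
    then have BN: "B = N" using B(1) S'i by blast
    \<comment> \<open>\<open>N\<close> is not in \<open>add (S - {i})\<close>, so \<open>s'\<close>
      says nothing about maps to it. They factor through the right approximation
      \<open>U -> N\<close> instead, and \<open>U\<close> lies in \<open>add ?K\<close>, where
      \<open>W_ext\<close> applies.\<close>
    have "i \<in> add_of C (S - {k})" using member_in_add_of[of i "S - {k}"] S(2,4) by simp
    then obtain \<kappa>1 where \<kappa>1: "\<kappa>1 \<in> Hom C i U" "\<kappa> = t \<cdot> \<kappa>1"
      using Tk(2) B(2) BN unfolding minimal_right_approx_def by blast
    obtain Us where Us: "is_direct_sum C U Us" "set Us \<subseteq> ?K" using add_of_decomposition[OF locK UK] .
    obtain \<kappa>2 where "\<kappa>2 \<in> Hom C W U" "\<kappa>1 = \<kappa>2 \<cdot> (\<zeta> \<cdot> s')"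
      using factor_through_left[OF \<zeta>s W_ext Us \<kappa>1(1)] by blast
    then show ?thesis using \<kappa>1(2) Comp_assoc[OF \<zeta>s _ tk(2)] Comp_in_Hom[OF _ tk(2)] BN by metis
  qed
  have subK: "add_of C ?K \<subseteq> add_of C (S' - {i})" by (rule add_of_mono) (auto simp: S'i)
  \<comment> \<open>Since maps from \<open>i\<close> to \<open>B\<close> extend over
    \<open>\<zeta> s'\<close>, duality makes \<open>X\<close> compatible with
    \<open>S' - {i}\<close>; this in turn makes \<open>y\<close> a right approximation.\<close>
  have oX: "orth B X" if B: "B \<in> S' - {i}" for B
  proof (rule orth_cone[OF TX])
    show "orth B W" using orth_add_of(2)[OF ri'(2) _ subsetD[OF subK W], of B] ri'(3) B by blast
  qed (use ext[OF B] in blast)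
  have lift: "\<exists>\<kappa>' \<in> Hom C V E. \<kappa> = y \<cdot> \<kappa>'" if V: "V \<in> add_of C (S' - {i})" "\<kappa> \<in> Hom C V i" for V \<kappa>
    using right_approx_of_orth[OF TE' _ V(2)] orth_add_of(1)[OF ri'(2) oX V(1)] by blast
  have ext': "\<exists>\<kappa>' \<in> Hom C W V. \<kappa> = \<kappa>' \<cdot> (\<zeta> \<cdot> s')" if V: "V \<in> add_of C (S' - {i})" "\<kappa> \<in> Hom C i V" for V \<kappa>
  proof -
    obtain Vs where Vs: "is_direct_sum C V Vs" "set Vs \<subseteq> S' - {i}" using add_of_decomposition[OF ri'(2) V(1)] .
    show ?thesis by (rule factor_through_left[OF \<zeta>s ext Vs V(2)])
  qed
  have "Q \<in> add_of C (S' - {i})"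
    unfolding add_of_iff_mult[OF ri'(2)]
  proof (intro allI impI)
    fix L assume L: "local_End C L" "0 < mult Q L"
    then have "0 < mult N L" using mQ[of L] by (cases "mult N L") auto
    then have "isomorphic C L N" using mult_local_End[OF pN(1), of L] by (auto split: if_splits)
    then show "\<exists>B \<in> S' - {i}. isomorphic C L B" using S'i by blast
  qed
  then have EA: "E \<in> add_of C (S' - {i})" using biproduct_in_add_of[OF ri'(2) E] subK midK by blast
  have WA: "W \<in> add_of C (S' - {i})" using subK W by blast
  obtain N2 where "exchange_triangles C (S' - {i}) i N2 (mid S' i) (mid' S' i)" using middles[OF S'] by metis
  then obtain f2 g2 h2 s2 t2 w2 where
    T2: "tri C N2 (mid S' i) i f2 g2 h2" "minimal_right_approx C (add_of C (S' - {i})) (mid S' i) i g2"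
    and T2': "tri C i (mid' S' i) N2 s2 t2 w2" "minimal_left_approx C (add_of C (S' - {i})) i (mid' S' i) s2"
    unfolding exchange_triangles_def by blast
  obtain V i1 p1 j1 q1 i2 p2 j2 q2 where V: "biproduct E (mid S' i) V i1 p1 j1 q1" "biproduct X N2 V i2 p2 j2 q2"
    using right_approx_split[OF T2(1) TE' T2(2) EA] lift[OF middles_in_add_of(1)[OF S']] by blast
  obtain V' i1 p1 j1 q1 i2 p2 j2 q2 where V': "biproduct W (mid' S' i) V' i1 p1 j1 q1" "biproduct X N2 V' i2 p2 j2 q2"
    using left_approx_split[OF T2'(1) TX T2'(2) WA] ext'[OF middles_in_add_of(2)[OF S']] by blast
  \<comment> \<open>The same \<open>X\<close> occurs in both triangles, so the surplus
    \<open>V\<close> of \<open>E\<close> and the surplus \<open>V'\<close> of \<open>W\<close> have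
    equal multiplicities and cancel.\<close>
  have "mult V Y = mult V' Y" using mult_biproduct[OF V(2), of Y] mult_biproduct[OF V'(2), of Y] by simp
  then have "mult (mid' S' i) Y + mult E Y = mult (mid S' i) Y + mult W Y"
    using mult_biproduct[OF V(1), of Y] mult_biproduct[OF V'(1), of Y] by simp
  then show ?thesis
    using mult_biproduct[OF E, of Y] mQ[of Y] mW[of Y] mU[of Y] n by simp
qed

lemma no_common_summand_mult:
  assumes "no_common_summand C X Y" "local_End C L"
  shows "mult X L = 0 \<or> mult Y L = 0"
  using assms mult_pos_iff_summand[OF assms(2)] unfolding no_common_summand_def local_End_def by blast

text \<open>As \<open>mid S k\<close> and \<open>mid' S k\<close> share no summand, the numerator in
  \<open>FZ_mutation\<close> is twice a one-sided term: |b_Xk| times the multiplicity of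
  \<open>Y\<close> in \<open>mid' S k\<close> if b_Xk is nonnegative, and minus |b_Xk| times its
  multiplicity in \<open>mid S k\<close> otherwise. This is the correction that
  \<open>mult_middles_mutation\<close> produces.\<close>

lemma exchange_matrix_mutation:
  assumes ncs: "\<And>S M. \<lbrakk>S \<in> MR; M \<in> S\<rbrakk> \<Longrightarrow> no_common_summand C (mid S M) (mid' S M)"
    and S: "S \<in> MR" "k \<in> S" and N: "partner S k N" and X: "X \<in> S" and Y: "Y \<in> S"
  shows "exchange_matrix C MR (insert N (S - {k})) ((id(k := N)) X) ((id(k := N)) Y) =
    FZ_mutation k (exchange_matrix C MR S) X Y"
proof -
  define S' where "S' = insert N (S - {k})"
  let ?b = "exchange_matrix C MR S" and ?b' = "exchange_matrix C MR S'"
  note rk = MR_remove[OF S] and pN = partnerD[OF S N]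
  have loc: "\<forall>B \<in> S. local_End C B" using MR_D(2)[OF S(1)] .
  have S': "S' \<in> MR" "N \<in> S'" unfolding S'_def using pN(5) by auto
  have S'N: "S' - {N} = S - {k}" unfolding S'_def using pN(6) by auto
  have b: "?b x y = int (mult (mid' S x) y) - int (mult (mid S x) y)" for x y unfolding exchange_matrix_def ..
  have b': "?b' x y = int (mult (mid' S' x) y) - int (mult (mid S' x) y)" for x y unfolding exchange_matrix_def ..
  have swap: "mult (mid S' N) y = mult (mid' S k) y" "mult (mid' S' N) y = mult (mid S k) y" for y
    using middles_swap[OF S N] mult_isomorphic unfolding S'_def by blast+
  have noniso: "\<not> isomorphic C x y" if "x \<in> S" "y \<in> S" "x \<noteq> y" for x y using MR_D(3)[OF S(1)] that by blast
  have diag: "mult (mid S x) x = 0" "mult (mid' S x) x = 0" if "x \<in> S" for x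
    using mult_outside_add_of[OF MR_remove(2)[OF S(1) that] _ MR_remove(4)[OF S(1) that] MR_remove(7)[OF S(1) that]]
      middles_in_add_of[OF S(1) that] by blast+
  have outN: "mult (mid S x) N = 0" "mult (mid' S x) N = 0" if "x \<in> S" for x
    using mult_outside_add_of[OF MR_remove(2)[OF S(1) that] _ pN(1)] pN(2)
      middles_in_add_of[OF S(1) that] by blast+
  have outk: "mult (mid S' x) k = 0" "mult (mid' S' x) k = 0" if "x \<in> S'" for x
  proof -
    have "\<forall>B \<in> S' - {x}. \<not> isomorphic C k B"
      unfolding S'_def using rk(7) pN(2) S(2) isomorphic_sym by blast
    then show "mult (mid S' x) k = 0" "mult (mid' S' x) k = 0"
      using mult_outside_add_of[OF MR_remove(2)[OF S'(1) that] _ rk(4)] middles_in_add_of[OF S'(1) that] by blast+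
  qed
  have mNN: "mult N N = 1" and mkk: "mult k k = 1" and mkN: "mult k N = 0" "mult N k = 0"
    using mult_local_End[OF pN(1)] mult_local_End[OF rk(4)] pN(2) S(2) isomorphic_sym by auto
  have mj: "mult N y = 0" "mult k y = 0" if "y \<in> S" "y \<noteq> k" for y
    using mult_local_End[OF pN(1), of y] mult_local_End[OF rk(4), of y] pN(2) noniso[OF that(1) S(2) that(2)] that isomorphic_sym
    by auto
  show ?thesis
  proof (cases "X = k")
    \<comment> \<open>Row \<open>k\<close>: mutation swaps the two middle terms, which changes the
      sign of the row.\<close>
    case True
    then show ?thesis
      using swap[of Y] swap[of N] diag[OF S(2)] outN[OF S(2)]
      by (cases "Y = k") (simp_all add: FZ_mutation_def b b' S'_def[symmetric])
  next
    case Xk: False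
    have XS': "X \<in> S'" unfolding S'_def using X Xk by blast
    have FZ: "?b' X Y = FZ_mutation k ?b X Y" if Yk: "Y \<noteq> k"
      and *: "?b' X Y = ?b X Y + \<bar>?b X k\<bar> * int (if 0 \<le> ?b X k then mult (mid' S k) Y else 0)
         - \<bar>?b X k\<bar> * int (if 0 \<le> ?b X k then 0 else mult (mid S k) Y)"
    proof -
      consider "mult (mid S k) Y = 0" | "mult (mid' S k) Y = 0"
        using no_common_summand_mult[OF ncs[OF S] bspec[OF loc Y]] by (elim disjE)
      then have "\<bar>?b X k\<bar> * ?b k Y + ?b X k * \<bar>?b k Y\<bar> =
        2 * (\<bar>?b X k\<bar> * int (if 0 \<le> ?b X k then mult (mid' S k) Y else 0)
         - \<bar>?b X k\<bar> * int (if 0 \<le> ?b X k then 0 else mult (mid S k) Y))"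
        by cases (auto simp: b[of k Y] abs_if algebra_simps)
      then show ?thesis using * Xk Yk by (simp add: FZ_mutation_def)
    qed
    have main: "(Y \<noteq> k \<longrightarrow> ?b' X Y = ?b X Y + \<bar>?b X k\<bar> * int (if 0 \<le> ?b X k then mult (mid' S k) Y else 0)
         - \<bar>?b X k\<bar> * int (if 0 \<le> ?b X k then 0 else mult (mid S k) Y)) \<and> ?b' X N = - ?b X k"
    proof (cases "mult (mid S X) k = 0")
      case True
      \<comment> \<open>With \<open>k\<close> absent from \<open>mid S X\<close>, sign coherence
        removes \<open>X\<close> from \<open>mid' S k\<close>, so the counting equation holds for
        \<open>S\<close> itself. At \<open>Y\<close> it gives the old columns, at \<open>N\<close>
        the column of the new summand.\<close>
      have z: "mult (mid' S k) X = 0"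
        using mult_mid'_imp_mid[OF S X Xk[symmetric]] True by auto
      define m where "m = mult (mid' S X) k"
      note eq = mult_middles_mutation[OF S(1) X S(2) Xk N True z, folded S'_def m_def]
      have bk: "?b X k = int m" using True by (simp add: b m_def)
      have "?b' X Y = ?b X Y + int m * int (mult (mid' S k) Y)" if "Y \<noteq> k"
        using arg_cong[OF eq[of Y], of int] mj[OF Y that] by (simp add: b b')
      moreover have "?b' X N = - int m"
        using arg_cong[OF eq[of N], of int] mNN mkN outN[OF X] outN[OF S(2)] by (simp add: b')
      ultimately show ?thesis using bk by simp
    next
      case False
      \<comment> \<open>Now \<open>X\<close> occurs in \<open>mid' S k\<close>, hence not in
        \<open>mid S k\<close>, which is the second middle term of \<open>N\<close> in
        \<open>S'\<close>. Thus the counting equation becomes available for mutating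
        \<open>S'\<close> back at \<open>N\<close>.\<close>
      then have pos: "0 < mult (mid' S k) X" using mult_mid_imp_mid'[OF S(1) X S(2) Xk] by simp
      then have z1: "mult (mid S k) X = 0" using no_common_summand_mult[OF ncs[OF S], of X] loc X by auto
      have z2: "mult (mid' S X) k = 0" using no_common_summand_mult[OF ncs[OF S(1) X], of k] rk(4) False by auto
      have XN: "X \<noteq> N" using pN(6) X by blast
      have partner': "partner S' N k"
        unfolding is_exchange_partner_def indecomposable_iff_local_End S'N
        using rk(4) pN(2) S(2) isomorphic_sym S(1) by (auto simp: insert_absorb)
      have z3: "mult (mid' S' N) X = 0" using swap(2) z1 by simp
      have z4: "mult (mid S' X) N = 0"
        using mult_mid_imp_mid'[OF S'(1) XS' S'(2) XN] z3 by auto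
      have S'': "insert k (S' - {N}) = S" using S'N S(2) by auto
      define m where "m = mult (mid' S' X) N"
      note eq = mult_middles_mutation[OF S'(1) XS' S'(2) XN partner' z4 z3, unfolded S'', folded m_def]
      \<comment> \<open>Evaluation at \<open>k\<close>, which occurs in no middle term of
        \<open>S'\<close>, expresses \<open>m\<close> through the original precluster.\<close>
      have m: "m = mult (mid S X) k"
        using eq[of k] z2 outk[OF XS'] mkk mkN outk(2)[OF S'(2)] by simp
      have bk: "?b X k = - int m" "m > 0" using z2 False by (simp_all add: b m)
      have "?b' X Y = ?b X Y - int m * int (mult (mid S k) Y)" if "Y \<noteq> k"
        using arg_cong[OF eq[of Y], of int] mj[OF Y that] swap(2)[of Y] by (simp add: b b')
      moreover have "?b' X N = int m" using z4 by (simp add: b' m_def)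
      ultimately show ?thesis using bk by simp
    qed
    show ?thesis
    proof (cases "Y = k")
      case True
      then show ?thesis using main Xk by (simp add: FZ_mutation_def S'_def[symmetric])
    next
      case False
      then show ?thesis using main FZ Xk by (simp add: S'_def[symmetric])
    qed
  qed
qed

end

theorem theorem1p1:
  fixes C :: "('k::field, 'o, 'm::ab_group_add) tricat"
  assumes "triangulated_category C"
    and "Krull_Schmidt C"
    and "Hom_finite C"
    and "two_Calabi_Yau C"
    and "\<And>T M. \<lbrakk>T \<in> maximal_rigid_preclusters C; M \<in> T\<rbrakk> \<Longrightarrow>
           no_common_summand C
             (middle_U C (maximal_rigid_preclusters C) M (T - {M}))
             (middle_U' C (maximal_rigid_preclusters C) M (T - {M}))"
  shows "cluster_structure C (maximal_rigid_preclusters C)"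
proof -
  interpret triangulated_category C by fact
  interpret two_Calabi_Yau_triangulated C by unfold_locales fact+
  show ?thesis
    unfolding cluster_structure_def
    using weak_cluster_structure_maximal_rigid assms(5) exchange_matrix_mutation[OF assms(5)] by blast
qed

end
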